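(* Let $\mathbb{F}$ be $\mathbb{C}$ or $\mathbb{F}_p$ ($p$ prime), and let $G=\mathrm{Aff}(1,\mathbb{F})$. There exists an absolute constant $C>0$ such that the following holds. Suppose $Y\subseteq\mathbb{F}$ is finite, $0<\alpha<1$, and $A\subseteq\mathrm{Sym}_\alpha(Y)$ is finite. Let $J\geq1$ be an integer such that $(\alpha/2)^{2^J}\geq1/|Y|$, and if $\mathbb{F}=\mathbb{F}_p$ suppose also that $|Y|\leq(\alpha/2)^{2^J}p$. Then there is an element $g\in G$ and an abelian subgroup $H$ of $G$ such that \[ |A\cap gH|\gg\left(\frac\alpha2\right)^{C2^J}|Y|^{-C/J}|A|. \]
   Context: $\mathrm{Aff}(1,\mathbb{F})$ is the group of maps $x\mapsto ax+b$ ($a,b\in\mathbb{F}$, $a\neq0$) under composition, acting on $\mathbb{F}$. For finite $Y\subseteq\mathbb{F}$ and $0<\alpha\leq1$, $\mathrm{Sym}_\alpha(Y)=\{g\in G: |Y\cap gY|\geq\alpha|Y|\}$. $f\gg g$ means $f\geq cg$ for an absolute constant $c>0$. *)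

theory Defs
  imports
    Complex_Main
    "HOL-Number_Theory.Residues"
    "HOL-Algebra.Bij"
    "HOL-Algebra.Algebraic_Closure_Type"
begin

text \<open>
  Fields are rendered with explicit carriers (\<open>HOL-Algebra\<close>), so that a constant can be
  quantified uniformly over all the prime fields \<open>residue_ring p\<close>. The complex field in this
  setting is \<open>ring_of_type_algebra :: complex ring\<close>.
\<close>

abbreviation complex_field :: "complex ring" where
  "complex_field \<equiv> ring_of_type_algebra"

definition affine_map :: "('a, 'm) ring_scheme \<Rightarrow> 'a \<Rightarrow> 'a \<Rightarrow> 'a \<Rightarrow> 'a" where
  "affine_map F a b = (\<lambda>x\<in>carrier F. a \<otimes>\<^bsub>F\<^esub> x \<oplus>\<^bsub>F\<^esub> b)"

text \<open>
  Multiplication (composition) and unit are inherited from \<open>BijGroup\<close>, whose elements are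
  bijections of the carrier, extended by \<open>undefined\<close> outside of it.
\<close>

definition Aff :: "('a, 'm) ring_scheme \<Rightarrow> ('a \<Rightarrow> 'a) monoid" where
  "Aff F = (BijGroup (carrier F))
     \<lparr>carrier := {affine_map F a b | a b. a \<in> carrier F \<and> b \<in> carrier F \<and> a \<noteq> \<zero>\<^bsub>F\<^esub>}\<rparr>"

definition Sym :: "('a, 'm) ring_scheme \<Rightarrow> real \<Rightarrow> 'a set \<Rightarrow> ('a \<Rightarrow> 'a) set" where
  "Sym F \<alpha> Y = {g \<in> carrier (Aff F). real (card (Y \<inter> g ` Y)) \<ge> \<alpha> * real (card Y)}"

lemma affine_map_in_Bij:
  assumes "field F" "a \<in> carrier F" "b \<in> carrier F" "a \<noteq> \<zero>\<^bsub>F\<^esub>"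
  shows "affine_map F a b \<in> Bij (carrier F)"
proof -
  interpret field F by fact
  have i: "inv\<^bsub>F\<^esub> a \<in> carrier F" "a \<otimes>\<^bsub>F\<^esub> inv\<^bsub>F\<^esub> a = \<one>\<^bsub>F\<^esub>" "inv\<^bsub>F\<^esub> a \<otimes>\<^bsub>F\<^esub> a = \<one>\<^bsub>F\<^esub>"
    using assms field_Units by auto
  have "bij_betw (affine_map F a b) (carrier F) (carrier F)"
  proof (rule bij_betw_byWitness[where f' = "\<lambda>y. inv\<^bsub>F\<^esub> a \<otimes>\<^bsub>F\<^esub> (y \<ominus>\<^bsub>F\<^esub> b)"])
    show "\<forall>x\<in>carrier F. inv\<^bsub>F\<^esub> a \<otimes>\<^bsub>F\<^esub> (affine_map F a b x \<ominus>\<^bsub>F\<^esub> b) = x"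
    proof
      fix x assume x: "x \<in> carrier F"
      have "affine_map F a b x \<ominus>\<^bsub>F\<^esub> b = a \<otimes>\<^bsub>F\<^esub> x"
        using x assms by (simp add: affine_map_def a_minus_def a_assoc r_neg)
      then show "inv\<^bsub>F\<^esub> a \<otimes>\<^bsub>F\<^esub> (affine_map F a b x \<ominus>\<^bsub>F\<^esub> b) = x"
        using x assms i by (simp add: m_assoc[symmetric])
    qed
    show "\<forall>y\<in>carrier F. affine_map F a b (inv\<^bsub>F\<^esub> a \<otimes>\<^bsub>F\<^esub> (y \<ominus>\<^bsub>F\<^esub> b)) = y"
      using assms i
      by (simp add: affine_map_def m_assoc[symmetric]) (simp add: a_minus_def a_assoc l_neg)
  qed (use assms i in \<open>auto simp: affine_map_def\<close>)
  then show ?thesis by (simp add: Bij_def affine_map_def)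
qed

lemma compose_affine_map:
  assumes "field F" "a \<in> carrier F" "b \<in> carrier F" "c \<in> carrier F" "d \<in> carrier F"
  shows "compose (carrier F) (affine_map F a b) (affine_map F c d) =
           affine_map F (a \<otimes>\<^bsub>F\<^esub> c) (a \<otimes>\<^bsub>F\<^esub> d \<oplus>\<^bsub>F\<^esub> b)"
proof -
  interpret field F by fact
  show ?thesis
    using assms by (auto simp: compose_def affine_map_def fun_eq_iff restrict_def r_distr m_assoc a_assoc)
qed

lemma group_Aff:
  assumes "field F"
  shows "group (Aff F)"
proof -
  interpret field F by fact
  have mult: "affine_map F a b \<otimes>\<^bsub>Aff F\<^esub> affine_map F c d =
                affine_map F (a \<otimes>\<^bsub>F\<^esub> c) (a \<otimes>\<^bsub>F\<^esub> d \<oplus>\<^bsub>F\<^esub> b)"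
    if "a \<in> carrier F" "b \<in> carrier F" "c \<in> carrier F" "d \<in> carrier F" "a \<noteq> \<zero>\<^bsub>F\<^esub>" "c \<noteq> \<zero>\<^bsub>F\<^esub>" for a b c d
    using that assms affine_map_in_Bij[OF assms] compose_affine_map[OF assms]
    by (simp add: Aff_def BijGroup_def)
  have one: "\<one>\<^bsub>Aff F\<^esub> = affine_map F \<one>\<^bsub>F\<^esub> \<zero>\<^bsub>F\<^esub>"
    by (auto simp: Aff_def BijGroup_def affine_map_def)
  have car: "carrier (Aff F) =
      {affine_map F a b | a b. a \<in> carrier F \<and> b \<in> carrier F \<and> a \<noteq> \<zero>\<^bsub>F\<^esub>}"
    by (simp add: Aff_def)
  show ?thesis
  proof (rule groupI)
    fix x y assume "x \<in> carrier (Aff F)" "y \<in> carrier (Aff F)"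
    then obtain a b c d where *: "x = affine_map F a b" "y = affine_map F c d"
      "a \<in> carrier F" "b \<in> carrier F" "c \<in> carrier F" "d \<in> carrier F" "a \<noteq> \<zero>\<^bsub>F\<^esub>" "c \<noteq> \<zero>\<^bsub>F\<^esub>"
      by (auto simp: car)
    then have "a \<otimes>\<^bsub>F\<^esub> c \<noteq> \<zero>\<^bsub>F\<^esub>" by (simp add: integral_iff)
    with * show "x \<otimes>\<^bsub>Aff F\<^esub> y \<in> carrier (Aff F)"
      by (simp add: mult) (auto simp: car)
  next
    show "\<one>\<^bsub>Aff F\<^esub> \<in> carrier (Aff F)" unfolding one car by force
  next
    fix x y z assume "x \<in> carrier (Aff F)" "y \<in> carrier (Aff F)" "z \<in> carrier (Aff F)"
    then have "x \<in> Bij (carrier F)" "y \<in> Bij (carrier F)" "z \<in> Bij (carrier F)"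
      using affine_map_in_Bij[OF assms] by (auto simp: car)
    then show "x \<otimes>\<^bsub>Aff F\<^esub> y \<otimes>\<^bsub>Aff F\<^esub> z = x \<otimes>\<^bsub>Aff F\<^esub> (y \<otimes>\<^bsub>Aff F\<^esub> z)"
      by (simp add: Aff_def BijGroup_def compose_Bij compose_assoc[OF Bij_imp_funcset, symmetric])
  next
    fix x assume "x \<in> carrier (Aff F)"
    then obtain a b where *: "x = affine_map F a b"
      "a \<in> carrier F" "b \<in> carrier F" "a \<noteq> \<zero>\<^bsub>F\<^esub>"
      by (auto simp: car)
    show "\<one>\<^bsub>Aff F\<^esub> \<otimes>\<^bsub>Aff F\<^esub> x = x"
      using * by (simp add: one mult)
    have i: "inv\<^bsub>F\<^esub> a \<in> carrier F" "inv\<^bsub>F\<^esub> a \<otimes>\<^bsub>F\<^esub> a = \<one>\<^bsub>F\<^esub>" "inv\<^bsub>F\<^esub> a \<noteq> \<zero>\<^bsub>F\<^esub>"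
      using * field_Units by (auto simp: nonzero_imp_inverse_nonzero)
    let ?y = "affine_map F (inv\<^bsub>F\<^esub> a) (\<ominus>\<^bsub>F\<^esub> (inv\<^bsub>F\<^esub> a \<otimes>\<^bsub>F\<^esub> b))"
    have "?y \<otimes>\<^bsub>Aff F\<^esub> x = \<one>\<^bsub>Aff F\<^esub>"
      using * i by (simp add: one mult r_neg)
    moreover have "?y \<in> carrier (Aff F)"
      unfolding car using * i by blast
    ultimately show "\<exists>y\<in>carrier (Aff F). y \<otimes>\<^bsub>Aff F\<^esub> x = \<one>\<^bsub>Aff F\<^esub>" by blast
  qed
qed

end

theory Submission
  imports Defs "HOL-Analysis.L2_Norm"
begin

text \<open>
  Let \<open>w\<^sub>0\<close> be the uniform weight on \<open>A\<close> and let \<open>w\<^sub>j\<^sub>+\<^sub>1\<close> be the distribution of \<open>a\<inverse> b\<close> for \<open>a\<close>, \<open>b\<close> independent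
  with distribution \<open>w\<^sub>j\<close>. By Cauchy--Schwarz the mean of \<open>\<bar>Y \<inter> gY\<bar> / \<bar>Y\<bar>\<close> under \<open>w\<^sub>j\<close> is at least
  \<open>\<alpha> ^ (2 ^ j)\<close>. As two points determine an affine map, this bounds the energy
  \<open>\<Sum>g. (w\<^sub>j g)\<^sup>2\<close> from below by about \<open>\<alpha> ^ (2 ^ (j + 1)) / \<bar>Y\<bar>\<^sup>2\<close>, and over the field with \<open>p\<close> elements, where \<open>Y\<close> is sparse, a
  second moment argument also bounds it by about \<open>\<alpha> ^ (2 ^ (j + 1)) / p\<close>. Since the
  energies are at most 1, between some two consecutive even steps below \<open>J\<close> the energy drops by a factor of at most
  about \<open>\<bar>Y\<bar> powr (O(1) / J)\<close>, up to powers of \<open>\<alpha> ^ (2 ^ J)\<close>. A level set of the weight in between then has large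
  multiplicative energy, and Balog--Szemeredi--Gowers yields a symmetric set \<open>D\<close> of slow growth. If \<open>D\<close> meets
  no abelian coset in a large set, it has many slopes \<open>T\<close> and its powers contain many translations \<open>U\<close>; a pivot
  argument embeds \<open>U \<times> T\<close>, or half of the field, into the translations of a bounded power of \<open>D\<close>,
  which are too few. Finally a coset that is heavy for \<open>w\<^sub>j\<close> has a translate that is heavy for \<open>w\<^sub>0\<close>,
  since \<open>w\<^sub>j\<^sub>+\<^sub>1 (gH)\<close> is an average of the numbers \<open>w\<^sub>j (agH)\<close>.
\<close>

subsection \<open>Collisions, popular fibres and dense graphs\<close>

text \<open>Energies are compared two steps apart because two facts about the middle weight meet
  there: the energy at step j bounds the weight at step j + 1 pointwise, and the energy at step j +
  2 is the weighted number of collisions a^-1 b = c^-1 d at step j + 1. If the two energies are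
  comparable, the middle weight has nearly as many collisions as its maximum allows, and so does a
  level set whose size is about one over that maximum. For J = 1 there is no such pair of steps up
  to J, but the claim is then so weak that a single element of A satisfies it.

  The obstacle over a prime field is that a set may fail to grow merely because it already fills
  much of the affine group. Sparsity of Y excludes this: the second energy bound keeps the level set
  below p times a power of K, far from the roughly p^2 elements of the group.

  All losses are recorded as powers of a single number K. This produces large exponents, but only
  their being absolute matters for the constant C.\<close>

lemma Cauchy_Schwarz_sum:
  fixes f g :: "'a \<Rightarrow> real"
  shows "(\<Sum>i\<in>A. f i * g i)\<^sup>2 \<le> (\<Sum>i\<in>A. (f i)\<^sup>2) * (\<Sum>i\<in>A. (g i)\<^sup>2)"
proof -
  have "\<bar>\<Sum>i\<in>A. f i * g i\<bar> \<le> (\<Sum>i\<in>A. \<bar>f i\<bar> * \<bar>g i\<bar>)"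
    using sum_abs[of "\<lambda>i. f i * g i" A] by (simp add: abs_mult)
  also have "\<dots> \<le> L2_set f A * L2_set g A" by (rule L2_set_mult_ineq)
  finally have "\<bar>\<Sum>i\<in>A. f i * g i\<bar>\<^sup>2 \<le> (L2_set f A * L2_set g A)\<^sup>2"
    by (rule power_mono) simp
  then show ?thesis
    by (simp add: power_mult_distrib L2_set_def sum_nonneg)
qed


text \<open>Double counting by representations: \<open>f\<close> recovers \<open>x\<close> from each
  element of \<open>R x\<close>, so these sets are disjoint. An infinite \<open>I\<close> has
  \<open>card\<close> 0. It is applied with \<open>R x\<close> a family of ways to write
  \<open>x\<close> as a product or a quotient.\<close>

lemma card_le_if_disjoint_reps:
  fixes t :: real
  assumes "finite Z" "\<And>x. x \<in> I \<Longrightarrow> R x \<subseteq> Z" "\<And>x. x \<in> I \<Longrightarrow> t \<le> real (card (R x))"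
    and "\<And>x z. x \<in> I \<Longrightarrow> z \<in> R x \<Longrightarrow> f z = x"
  shows "t * real (card I) \<le> real (card Z)"
proof (cases "finite I")
  case True
  have "t * real (card I) = (\<Sum>x\<in>I. t)" by simp
  also have "\<dots> \<le> (\<Sum>x\<in>I. real (card (R x)))" by (intro sum_mono assms)
  also have "\<dots> = real (card (\<Union>x\<in>I. R x))"
  proof (subst card_UN_disjoint)
    show "\<forall>i\<in>I. \<forall>j\<in>I. i \<noteq> j \<longrightarrow> R i \<inter> R j = {}"
      using assms(4) by (metis disjoint_iff)
    show "\<forall>x\<in>I. finite (R x)"
      using assms(1,2) finite_subset by blast
  qed (use True in auto)
  also have "\<dots> \<le> real (card Z)"
    using assms by (intro of_nat_mono card_mono) auto
  finally show ?thesis .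
qed auto

lemma card_collisions:
  assumes "finite P"
  shows "card {(p, p'). p \<in> P \<and> p' \<in> P \<and> f p = f p'} = (\<Sum>p\<in>P. card {p' \<in> P. f p' = f p})"
proof -
  have "{(p, p'). p \<in> P \<and> p' \<in> P \<and> f p = f p'} = (SIGMA p:P. {p' \<in> P. f p' = f p})"
    by auto
  then show ?thesis using assms by simp
qed

lemma card_collisions_image:
  assumes "finite P"
  shows "card {(p, p'). p \<in> P \<and> p' \<in> P \<and> f p = f p'} = (\<Sum>x\<in>f ` P. (card {p \<in> P. f p = x})\<^sup>2)"
proof -
  have "(\<Sum>p\<in>P. card {p' \<in> P. f p' = f p}) = (\<Sum>x\<in>f ` P. \<Sum>p\<in>{p\<in>P. f p = x}. card {p' \<in> P. f p' = f p})"
    by (rule sum.image_gen[OF assms])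
  also have "\<dots> = (\<Sum>x\<in>f ` P. (card {p \<in> P. f p = x})\<^sup>2)"
    by (intro sum.cong refl) (simp add: power2_eq_square)
  finally show ?thesis by (simp add: card_collisions[OF assms])
qed

text \<open>Cauchy-Schwarz over the fibres of \<open>f\<close>: few values force many
  collisions.\<close>

lemma card_square_le_collisions:
  assumes "finite P"
  shows "(real (card P))\<^sup>2 \<le> real (card (f ` P)) * real (card {(p, p'). p \<in> P \<and> p' \<in> P \<and> f p = f p'})"
proof -
  have "real (card P) = (\<Sum>p\<in>P. 1)" by simp
  also have "\<dots> = (\<Sum>x\<in>f ` P. 1 * real (card {p \<in> P. f p = x}))"
    using sum.image_gen[OF assms, of "\<lambda>_. 1 :: real" f] by simp
  finally have "(real (card P))\<^sup>2 = \<dots>\<^sup>2" by (rule arg_cong)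
  also have "\<dots> \<le> (\<Sum>x\<in>f ` P. 1\<^sup>2) * (\<Sum>x\<in>f ` P. (real (card {p \<in> P. f p = x}))\<^sup>2)"
    by (rule Cauchy_Schwarz_sum)
  finally show ?thesis
    by (simp add: card_collisions_image[OF assms] del: of_nat_power add: of_nat_power[symmetric])
qed

text \<open>An element of a fibre smaller than \<open>t\<close> contributes less than
  \<open>t\<close>, any other at most \<open>n\<close>. With \<open>t\<close> chosen so that the
  first term is half of the collisions, many elements must lie in popular fibres.\<close>

lemma collisions_le_popular:
  fixes t n :: real
  assumes "finite P" "\<And>p. p \<in> P \<Longrightarrow> real (card {p' \<in> P. f p' = f p}) \<le> n" "0 \<le> t"
  shows "real (card {(p, p'). p \<in> P \<and> p' \<in> P \<and> f p = f p'})
    \<le> t * real (card P) + n * real (card {p \<in> P. t \<le> real (card {p' \<in> P. f p' = f p})})"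
proof -
  let ?r = "\<lambda>p. real (card {p' \<in> P. f p' = f p})"
  have "real (card {(p, p'). p \<in> P \<and> p' \<in> P \<and> f p = f p'}) = (\<Sum>p\<in>P. ?r p)"
    by (simp add: card_collisions[OF assms(1)])
  also have "\<dots> \<le> (\<Sum>p\<in>P. t + (if t \<le> ?r p then n else 0))"
    using assms(2,3) by (intro sum_mono) (auto intro: add_increasing)
  also have "\<dots> = t * real (card P) + n * real (card {p \<in> P. t \<le> ?r p})"
    using assms by (simp add: sum.distrib sum.If_cases Int_def)
  finally show ?thesis .
qed

text \<open>
  Dependent random choice: the set is cut out of the neighbourhood of a random vertex, since few pairs with
  small common neighbourhood survive in it.
\<close>
lemma graph_popular_triples:
  fixes \<delta> :: real
  assumes A: "finite A" and \<Gamma>: "\<Gamma> \<subseteq> A \<times> A" and sym: "\<And>a b. (a, b) \<in> \<Gamma> \<Longrightarrow> (b, a) \<in> \<Gamma>"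
    and \<delta>: "0 < \<delta>" and dense: "\<delta> * (real (card A))\<^sup>2 \<le> real (card \<Gamma>)"
  shows "\<exists>M\<subseteq>A. \<delta> * real (card A) / 4 \<le> real (card M) \<and>
    (\<forall>b\<in>M. \<forall>b'\<in>M. \<delta> ^ 5 * real (card A) ^ 3 / 4096 \<le>
      real (card {(v, c, v'). (b, v) \<in> \<Gamma> \<and> (v, c) \<in> \<Gamma> \<and> (c, v') \<in> \<Gamma> \<and> (v', b') \<in> \<Gamma>}))"
proof (cases "A = {}")
  case True
  then show ?thesis by auto
next
  case False
  define n where "n = real (card A)"
  have n: "n > 0" using A False by (auto simp: n_def card_gt_0_iff)
  define N where "N v = {b. (v, b) \<in> \<Gamma>}" for v
  have NA: "N v \<subseteq> A" for v using \<Gamma> by (auto simp: N_def)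
  have fN [simp]: "finite (N v)" for v using NA A by (rule finite_subset)
  \<comment> \<open>With 32, the bad pairs counted with weight 16 cost at most half of the lower
    bound \<open>sumN\<close> on the second moment of the degrees.\<close>
  define \<epsilon> where "\<epsilon> = \<delta>\<^sup>2 / 32"
  define bad where "bad b b' \<longleftrightarrow> real (card (N b \<inter> N b')) < \<epsilon> * n" for b b'
  define Bd where "Bd v = {(b, b'). b \<in> N v \<and> b' \<in> N v \<and> bad b b'}" for v
  have fBd [simp]: "finite (Bd v)" for v
    by (rule finite_subset[of _ "N v \<times> N v"]) (auto simp: Bd_def)
  have \<Gamma>': "\<Gamma> = (SIGMA v:A. N v)" using \<Gamma> by (auto simp: N_def)
  have card\<Gamma>: "card \<Gamma> = (\<Sum>v\<in>A. card (N v))" unfolding \<Gamma>' using A by simp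
  have "(\<delta> * n\<^sup>2)\<^sup>2 \<le> (real (card \<Gamma>))\<^sup>2"
    using dense \<delta> by (intro power_mono) (auto simp: n_def)
  also have "\<dots> = (\<Sum>v\<in>A. 1 * real (card (N v)))\<^sup>2" by (simp add: card\<Gamma>)
  also have "\<dots> \<le> (\<Sum>v\<in>A. 1\<^sup>2) * (\<Sum>v\<in>A. (real (card (N v)))\<^sup>2)"
    by (rule Cauchy_Schwarz_sum)
  finally have "\<delta>\<^sup>2 * n ^ 3 * n \<le> (\<Sum>v\<in>A. (real (card (N v)))\<^sup>2) * n"
    by (simp add: n_def power_mult_distrib algebra_simps power2_eq_square power3_eq_cube)
  then have sumN: "\<delta>\<^sup>2 * n ^ 3 \<le> (\<Sum>v\<in>A. (real (card (N v)))\<^sup>2)" using n by simp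
  have "(\<Sum>v\<in>A. card (Bd v)) = card (SIGMA v:A. Bd v)"
    using A by simp
  also have "\<dots> = card ((\<lambda>(v, b, b'). ((b, b'), v)) ` (SIGMA v:A. Bd v))"
    by (rule card_image[symmetric]) (auto simp: inj_on_def)
  also have "(\<lambda>(v, b, b'). ((b, b'), v)) ` (SIGMA v:A. Bd v)
      = (SIGMA q:{(b, b'). b \<in> A \<and> b' \<in> A \<and> bad b b'}. N (fst q) \<inter> N (snd q))" (is "_ = ?S")
  proof
    show "?S \<subseteq> (\<lambda>(v, b, b'). ((b, b'), v)) ` (SIGMA v:A. Bd v)"
    proof
      fix q assume "q \<in> ?S"
      then obtain b b' v where q: "q = ((b, b'), v)" "bad b b'" "v \<in> N b" "v \<in> N b'" by auto
      then have "(v, b, b') \<in> (SIGMA v:A. Bd v)"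
        using \<Gamma> sym by (auto simp: Bd_def N_def)
      then show "q \<in> (\<lambda>(v, b, b'). ((b, b'), v)) ` (SIGMA v:A. Bd v)"
        using q by force
    qed
  qed (use \<Gamma> sym in \<open>auto simp: Bd_def N_def\<close>)
  also have "card ?S = (\<Sum>q\<in>{(b, b'). b \<in> A \<and> b' \<in> A \<and> bad b b'}. card (N (fst q) \<inter> N (snd q)))"
    using A by (subst card_SigmaI) (auto intro!: finite_subset[of "{(b, b'). b \<in> A \<and> b' \<in> A \<and> bad b b'}" "A \<times> A"])
  finally have "real (\<Sum>v\<in>A. card (Bd v)) = (\<Sum>q\<in>{(b, b'). b \<in> A \<and> b' \<in> A \<and> bad b b'}. real (card (N (fst q) \<inter> N (snd q))))"
    by simp
  also have "\<dots> \<le> (\<Sum>q\<in>{(b, b'). b \<in> A \<and> b' \<in> A \<and> bad b b'}. \<epsilon> * n)"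
    by (intro sum_mono) (auto simp: bad_def)
  also have "\<dots> \<le> (\<Sum>q\<in>A \<times> A. \<epsilon> * n)"
    using A n by (intro sum_mono2) (auto simp: \<epsilon>_def)
  also have "\<dots> = \<epsilon> * n ^ 3" by (simp add: n_def power3_eq_cube card_cartesian_product)
  finally have sumB: "(\<Sum>v\<in>A. real (card (Bd v))) \<le> \<epsilon> * n ^ 3" by simp
  \<comment> \<open>Averaging finds a vertex of large degree k with at most k^2 / 16 bad pairs in
    its neighbourhood. By Markov at most k / 4 neighbours then belong to more than k / 4 bad pairs,
    and the remaining ones form \<open>M\<close>.\<close>
  have "\<exists>v\<in>A. \<delta>\<^sup>2 * n\<^sup>2 / 2 \<le> (real (card (N v)))\<^sup>2 - 16 * real (card (Bd v))"
  proof (rule ccontr)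
    assume "\<not> ?thesis"
    then have "(\<Sum>v\<in>A. (real (card (N v)))\<^sup>2 - 16 * real (card (Bd v))) < (\<Sum>v\<in>A. \<delta>\<^sup>2 * n\<^sup>2 / 2)"
      using A False by (intro sum_strict_mono) (auto simp: not_le)
    also have "\<dots> = \<delta>\<^sup>2 * n ^ 3 / 2" by (simp add: n_def power2_eq_square power3_eq_cube)
    finally have "(\<Sum>v\<in>A. (real (card (N v)))\<^sup>2) - 16 * (\<Sum>v\<in>A. real (card (Bd v))) < \<delta>\<^sup>2 * n ^ 3 / 2"
      by (simp add: sum_subtractf sum_distrib_left)
    then show False using sumN sumB by (simp add: \<epsilon>_def)
  qed
  then obtain v where v: "v \<in> A" "\<delta>\<^sup>2 * n\<^sup>2 / 2 \<le> (real (card (N v)))\<^sup>2 - 16 * real (card (Bd v))"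
    by blast
  define k where "k = real (card (N v))"
  have nn: "0 \<le> \<delta>\<^sup>2 * n\<^sup>2" by simp
  have vk: "\<delta>\<^sup>2 * n\<^sup>2 / 2 \<le> k\<^sup>2 - 16 * real (card (Bd v))"
    using v(2) by (simp only: k_def)
  have "(\<delta> * n / 2)\<^sup>2 = \<delta>\<^sup>2 * n\<^sup>2 / 4" by (simp add: power_mult_distrib power_divide)
  then have "(\<delta> * n / 2)\<^sup>2 \<le> k\<^sup>2" using vk nn by linarith
  then have k: "\<delta> * n / 2 \<le> k" by (rule power2_le_imp_le) (simp add: k_def)
  have "0 < \<delta> * n" using \<delta> n by simp
  then have k0: "k > 0" using k by linarith
  have Bdk: "16 * real (card (Bd v)) \<le> k\<^sup>2" using vk nn by linarith
  define bs where "bs b = {b' \<in> N v. bad b b'}" for b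
  define M where "M = {b \<in> N v. 4 * real (card (bs b)) \<le> k}"
  have MN: "M \<subseteq> N v" by (auto simp: M_def)
  have [simp]: "finite M" using MN fN finite_subset by blast
  have bsfin: "finite (bs b)" for b by (simp add: bs_def)
  have "(k / 4) * real (card (N v - M)) = (\<Sum>b\<in>N v - M. k / 4)" by simp
  also have "\<dots> \<le> (\<Sum>b\<in>N v - M. real (card (bs b)))"
    by (intro sum_mono) (auto simp: M_def)
  also have "\<dots> \<le> (\<Sum>b\<in>N v. real (card (bs b)))" by (intro sum_mono2) auto
  also have "\<dots> = real (card (SIGMA b:N v. bs b))" using bsfin by simp
  also have "(SIGMA b:N v. bs b) = Bd v" by (auto simp: Bd_def bs_def)
  finally have "k * real (card (N v - M)) \<le> k * (k / 4)"
    using Bdk by (simp add: power2_eq_square)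
  then have "real (card (N v - M)) \<le> k / 4" using k0 by simp
  moreover have "real (card (N v - M)) = k - real (card M)"
    using MN by (simp add: k_def card_Diff_subset card_mono of_nat_diff)
  ultimately have M: "3 / 4 * k \<le> real (card M)" by simp
  have "\<delta> ^ 5 * n ^ 3 / 4096 \<le>
      real (card {(v, c, v'). (b, v) \<in> \<Gamma> \<and> (v, c) \<in> \<Gamma> \<and> (c, v') \<in> \<Gamma> \<and> (v', b') \<in> \<Gamma>})" (is "_ \<le> real (card ?T)")
    if b: "b \<in> M" "b' \<in> M" for b b'
  proof -
    \<comment> \<open>At most k / 4 vertices are bad for \<open>b\<close> and at most k / 4 for
      \<open>b'\<close>, so half of \<open>N v\<close> can serve as the middle vertex of a path of
      length four.\<close>
    define Cs where "Cs = N v - (bs b \<union> bs b')"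
    have "k - real (card (bs b \<union> bs b')) \<le> real (card Cs)"
      using diff_card_le_card_Diff[of "bs b \<union> bs b'" "N v"] bsfin by (simp add: k_def Cs_def)
    moreover have "real (card (bs b \<union> bs b')) \<le> real (card (bs b)) + real (card (bs b'))"
      using card_Un_le[of "bs b" "bs b'"] by simp
    ultimately have Cs: "k / 2 \<le> real (card Cs)" using b by (auto simp: M_def)
    have fT: "finite ?T"
      by (rule finite_subset[of _ "A \<times> A \<times> A"]) (use \<Gamma> A in auto)
    let ?S = "SIGMA c:Cs. (N b \<inter> N c) \<times> (N b' \<inter> N c)"
    have "\<delta> ^ 5 * n ^ 3 / 4096 = (\<delta> * n / 4) * (\<epsilon> * n)\<^sup>2"
      by (simp add: \<epsilon>_def power_mult_distrib power_divide eval_nat_numeral)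
    also have "\<dots> \<le> real (card Cs) * (\<epsilon> * n)\<^sup>2"
      using Cs k by (intro mult_right_mono) auto
    also have "\<dots> = (\<Sum>c\<in>Cs. (\<epsilon> * n) * (\<epsilon> * n))" by (simp add: power2_eq_square)
    also have "\<dots> \<le> (\<Sum>c\<in>Cs. real (card (N b \<inter> N c)) * real (card (N b' \<inter> N c)))"
      using n by (intro sum_mono mult_mono) (auto simp: Cs_def bs_def bad_def \<epsilon>_def)
    also have "\<dots> = real (card ?S)"
      by (subst card_SigmaI) (auto simp: Cs_def card_cartesian_product)
    also have "card ?S = card ((\<lambda>(c, v, v'). (v, c, v')) ` ?S)"
      by (rule card_image[symmetric]) (auto simp: inj_on_def)
    also have "real \<dots> \<le> real (card ?T)"
      using fT sym by (intro of_nat_mono card_mono) (auto simp: N_def)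
    finally show ?thesis .
  qed
  moreover have "M \<subseteq> A" using MN NA by blast
  moreover have "\<delta> * n / 4 \<le> real (card M)" using M k k0 by linarith
  ultimately show ?thesis unfolding n_def by blast
qed

subsection \<open>Balog--Szemeredi--Gowers and popular quotients in groups\<close>

context group
begin

lemma inv_mult_cross_eq_iff:
  assumes "a \<in> carrier G" "b \<in> carrier G" "c \<in> carrier G" "d \<in> carrier G"
  shows "inv a \<otimes> b = inv c \<otimes> d \<longleftrightarrow> c \<otimes> inv a = d \<otimes> inv b"
proof
  assume "inv a \<otimes> b = inv c \<otimes> d"
  then have "c \<otimes> (inv a \<otimes> b) \<otimes> inv b = c \<otimes> (inv c \<otimes> d) \<otimes> inv b" by simp
  then show "c \<otimes> inv a = d \<otimes> inv b"
    using assms by (simp add: m_assoc inv_solve_left' r_inv) (simp add: m_assoc[symmetric])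
next
  assume *: "c \<otimes> inv a = d \<otimes> inv b"
  have "inv a \<otimes> b = inv c \<otimes> (c \<otimes> inv a) \<otimes> b"
    using assms by (simp add: m_assoc[symmetric])
  also have "\<dots> = inv c \<otimes> d" using assms by (simp add: * m_assoc)
  finally show "inv a \<otimes> b = inv c \<otimes> d" .
qed

section \<open>Multiplicative energy and the Balog-Szemeredi-Gowers theorem\<close>

text \<open>The cardinalities of \<open>lcoll A\<close> and \<open>rcoll A\<close> are the
  multiplicative energy of \<open>A\<close>, counted through left and right quotients. The
  convolutions use a^-1 b, Balog-Szemeredi-Gowers uses a b^-1.\<close>

definition lcoll :: "'a set \<Rightarrow> (('a \<times> 'a) \<times> ('a \<times> 'a)) set" where
  "lcoll A = {(p, q). p \<in> A \<times> A \<and> q \<in> A \<times> A \<and>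
     (\<lambda>(a, b). inv a \<otimes> b) p = (\<lambda>(a, b). inv a \<otimes> b) q}"

definition rcoll :: "'a set \<Rightarrow> (('a \<times> 'a) \<times> ('a \<times> 'a)) set" where
  "rcoll A = {(p, q). p \<in> A \<times> A \<and> q \<in> A \<times> A \<and>
     (\<lambda>(a, b). a \<otimes> inv b) p = (\<lambda>(a, b). a \<otimes> inv b) q}"

text \<open>The exchange in \<open>inv_mult_cross_eq_iff\<close> is a bijection on quadruples.
  Energy thus passes between left and right quotients, although the sizes of the two quotient sets
  are not comparable in a nonabelian group.\<close>

lemma card_lcoll_eq_card_rcoll:
  assumes "A \<subseteq> carrier G"
  shows "card (lcoll A) = card (rcoll A)"
proof (rule bij_betw_same_card[where f = "\<lambda>((a, b), (c, d)). ((c, a), (d, b))"],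
    rule bij_betw_byWitness[where f' = "\<lambda>((c, a), (d, b)). ((a, b), (c, d))"])
  show "(\<lambda>((a, b), (c, d)). ((c, a), (d, b))) ` lcoll A \<subseteq> rcoll A"
    "(\<lambda>((c, a), (d, b)). ((a, b), (c, d))) ` rcoll A \<subseteq> lcoll A"
    using assms inv_mult_cross_eq_iff by (auto simp: lcoll_def rcoll_def subset_iff)
qed auto

lemma card_left_quotient_fibre_le:
  assumes "finite A" "A \<subseteq> carrier G"
  shows "card {p \<in> A \<times> A. (\<lambda>(a, b). inv a \<otimes> b) p = x} \<le> card A"
proof (rule card_inj_on_le[where f = fst])
  show "inj_on fst {p \<in> A \<times> A. (\<lambda>(a, b). inv a \<otimes> b) p = x}"
    using assms(2) by (auto simp: inj_on_def subset_iff)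
qed (use assms in auto)

lemma card_right_quotient_fibre_le:
  assumes "finite A" "A \<subseteq> carrier G"
  shows "card {p \<in> A \<times> A. (\<lambda>(a, b). a \<otimes> inv b) p = x} \<le> card A"
proof (rule card_inj_on_le[where f = snd])
  show "inj_on snd {p \<in> A \<times> A. (\<lambda>(a, b). a \<otimes> inv b) p = x}"
    using assms(2) by (auto simp: inj_on_def subset_iff)
qed (use assms in auto)

text \<open>\<open>\<Gamma>\<close> joins \<open>a\<close> to \<open>b\<close> when a b^-1 is
  popular. The quotient of two elements of the dense piece \<open>M\<close> telescopes along paths
  of length four into four popular quotients, in about n^3 ways, while there are only 2 L n popular
  quotients.\<close>

lemma balog_szemeredi_gowers:
  fixes L :: real
  assumes A: "A \<subseteq> carrier G" "finite A" "A \<noteq> {}" and L: "1 \<le> L"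
    and energy: "real (card A) ^ 3 \<le> L * real (card (rcoll A))"
  obtains M where "M \<subseteq> A" "real (card A) \<le> 8 * L * real (card M)"
    "real (card (M <#> m_inv G ` M)) \<le> 2 ^ 24 * L ^ 10 * real (card M)"
proof -
  define n where "n = real (card A)"
  have n: "n > 0" using A by (auto simp: n_def card_gt_0_iff)
  define rq where "rq = (\<lambda>(a, b). a \<otimes> inv b)"
  define rp where "rp x = real (card {p \<in> A \<times> A. rq p = x})" for x
  define B where "B = {x \<in> rq ` (A \<times> A). n / (2 * L) \<le> rp x}"
  define \<Gamma> where "\<Gamma> = {p \<in> A \<times> A. n / (2 * L) \<le> rp (rq p)}"
  have fB: "finite B" using A by (simp add: B_def)
  have \<Gamma>B: "(a, b) \<in> \<Gamma> \<longleftrightarrow> a \<in> A \<and> b \<in> A \<and> a \<otimes> inv b \<in> B" for a b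
    by (force simp: \<Gamma>_def B_def rq_def)
  \<comment> \<open>At the threshold n / (2 L) the pairs with an unpopular quotient carry at most
    half of the energy.\<close>
  have "n ^ 3 \<le> L * (n / (2 * L) * real (card (A \<times> A)) + n * real (card \<Gamma>))"
  proof -
    have "real (card (rcoll A)) \<le> n / (2 * L) * real (card (A \<times> A)) + n * real (card \<Gamma>)"
      unfolding rcoll_def \<Gamma>_def rp_def rq_def
      by (rule collisions_le_popular)
         (use A L n card_right_quotient_fibre_le in \<open>auto simp: n_def\<close>)
    then have "L * real (card (rcoll A)) \<le> L * (n / (2 * L) * real (card (A \<times> A)) + n * real (card \<Gamma>))"
      using L by (intro mult_left_mono) auto
    with energy show ?thesis by (simp add: n_def)
  qed
  also have "\<dots> = n ^ 3 / 2 + L * n * real (card \<Gamma>)"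
    using L by (simp add: n_def card_cartesian_product field_simps power3_eq_cube)
  finally have "n * (n\<^sup>2 / 2) \<le> n * (L * real (card \<Gamma>))"
    by (simp add: field_simps power2_eq_square power3_eq_cube)
  then have dense: "1 / (2 * L) * n\<^sup>2 \<le> real (card \<Gamma>)"
    using n L by (simp add: field_simps)
  have rp_inv: "rp (inv x) = rp x" if "x \<in> carrier G" for x
  proof -
    have "card {p \<in> A \<times> A. rq p = inv x} = card {p \<in> A \<times> A. rq p = x}"
    proof (rule bij_betw_same_card[where f = prod.swap], rule bij_betw_byWitness[where f' = prod.swap])
      have *: "a \<otimes> inv b = inv x \<longleftrightarrow> b \<otimes> inv a = x" if "a \<in> A" "b \<in> A" for a b
      proof -
        have "a \<in> carrier G" "b \<in> carrier G" using A that by auto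
        then have "inv (b \<otimes> inv a) = a \<otimes> inv b" by (simp add: inv_mult_group)
        then show ?thesis using \<open>x \<in> carrier G\<close> \<open>a \<in> carrier G\<close> \<open>b \<in> carrier G\<close>
          by (metis inv_closed inv_inv m_closed)
      qed
      show "prod.swap ` {p \<in> A \<times> A. rq p = inv x} \<subseteq> {p \<in> A \<times> A. rq p = x}"
        "prod.swap ` {p \<in> A \<times> A. rq p = x} \<subseteq> {p \<in> A \<times> A. rq p = inv x}"
        using * by (auto simp: rq_def)
    qed auto
    then show ?thesis by (simp add: rp_def)
  qed
  have sym: "(b, a) \<in> \<Gamma>" if "(a, b) \<in> \<Gamma>" for a b
  proof -
    have "a \<in> carrier G" "b \<in> carrier G" using that A by (auto simp: \<Gamma>_def)
    then have "rq (b, a) = inv (rq (a, b))" "rq (a, b) \<in> carrier G"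
      by (auto simp: rq_def inv_mult_group)
    then show ?thesis using that rp_inv by (auto simp: \<Gamma>_def)
  qed
  have "n / (2 * L) * real (card B) \<le> real (card (A \<times> A))"
    by (rule card_le_if_disjoint_reps[where R = "\<lambda>x. {p \<in> A \<times> A. rq p = x}" and f = rq])
       (use A in \<open>auto simp: B_def rp_def\<close>)
  also have "\<dots> = n * n" by (simp add: n_def card_cartesian_product)
  finally have "n * real (card B) \<le> n * (2 * L * n)" using L by (simp add: field_simps)
  then have cardB: "real (card B) \<le> 2 * L * n" using n by simp
  obtain M where M: "M \<subseteq> A" "1 / (2 * L) * n / 4 \<le> real (card M)"
    and trip: "\<forall>b\<in>M. \<forall>b'\<in>M. (1 / (2 * L)) ^ 5 * n ^ 3 / 4096 \<le>
      real (card {(v, c, v'). (b, v) \<in> \<Gamma> \<and> (v, c) \<in> \<Gamma> \<and> (c, v') \<in> \<Gamma> \<and> (v', b') \<in> \<Gamma>})"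
    using graph_popular_triples[of A \<Gamma> "1 / (2 * L)"] A L sym dense
    by (auto simp: \<Gamma>_def n_def)
  have Mc: "M \<subseteq> carrier G" using M A by auto
  have nM: "n \<le> 8 * L * real (card M)" using M(2) L by (simp add: field_simps)
  define T where "T b b' = {(v, c, v'). (b, v) \<in> \<Gamma> \<and> (v, c) \<in> \<Gamma> \<and> (c, v') \<in> \<Gamma> \<and> (v', b') \<in> \<Gamma>}" for b b'
  \<comment> \<open>One pair of endpoints is fixed for each quotient and only the path between them
    varies, which is what makes \<open>h\<close> injective.\<close>
  define rep where "rep x = (SOME p. p \<in> M \<times> M \<and> rq p = x)" for x
  have rep: "rep x \<in> M \<times> M \<and> rq (rep x) = x" if x: "x \<in> M <#> m_inv G ` M" for x
    unfolding rep_def by (rule someI_ex) (use x in \<open>force simp: set_mult_def rq_def\<close>)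
  define h where "h b b' = (\<lambda>(v, c, v'). (b \<otimes> inv v, v \<otimes> inv c, c \<otimes> inv v', v' \<otimes> inv b'))" for b b'
  define R where "R x = h (fst (rep x)) (snd (rep x)) ` T (fst (rep x)) (snd (rep x))" for x
  have inj: "inj_on (h b b') (T b b')" if "b \<in> M" "b' \<in> M" for b b'
  proof (rule inj_onI)
    fix p q assume pq: "p \<in> T b b'" "q \<in> T b b'" "h b b' p = h b b' q"
    obtain v c v' where p: "p = (v, c, v')" by (cases p)
    obtain u d u' where q: "q = (u, d, u')" by (cases q)
    have car: "v \<in> carrier G" "c \<in> carrier G" "v' \<in> carrier G" "u \<in> carrier G" "d \<in> carrier G" "u' \<in> carrier G"
      "b \<in> carrier G" "b' \<in> carrier G"
      using pq p q A Mc that by (auto simp: T_def \<Gamma>B)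
    have "b \<otimes> inv v = b \<otimes> inv u" "v \<otimes> inv c = u \<otimes> inv d" "c \<otimes> inv v' = d \<otimes> inv u'"
      using pq p q by (auto simp: h_def)
    then show "p = q" using car p q by (metis inv_closed inv_inv l_cancel)
  qed
  have "(1 / (2 * L)) ^ 5 * n ^ 3 / 4096 * real (card (M <#> m_inv G ` M))
      \<le> real (card (B \<times> B \<times> B \<times> B))"
  proof (rule card_le_if_disjoint_reps[where R = R and f = "\<lambda>(x, y, z, w). x \<otimes> y \<otimes> z \<otimes> w"])
    fix x assume x: "x \<in> M <#> m_inv G ` M"
    obtain b b' where r: "rep x = (b, b')" by (cases "rep x")
    have b: "b \<in> M" "b' \<in> M" "b \<otimes> inv b' = x" using rep[OF x] r by (auto simp: rq_def)
    show "R x \<subseteq> B \<times> B \<times> B \<times> B"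
      by (auto simp: R_def h_def T_def \<Gamma>B)
    show "(1 / (2 * L)) ^ 5 * n ^ 3 / 4096 \<le> real (card (R x))"
    proof -
      have "card (R x) = card (T b b')" by (simp add: R_def r card_image[OF inj[OF b(1,2)]])
      then show ?thesis using trip b(1,2) by (simp only: T_def)
    qed
    fix z assume "z \<in> R x"
    then obtain v c v' where z: "z = h b b' (v, c, v')" "(v, c, v') \<in> T b b'"
      by (auto simp: R_def r)
    have car: "v \<in> carrier G" "c \<in> carrier G" "v' \<in> carrier G" "b \<in> carrier G" "b' \<in> carrier G"
      using z A Mc b by (auto simp: T_def \<Gamma>B)
    have "b \<otimes> inv v \<otimes> (v \<otimes> inv c) \<otimes> (c \<otimes> inv v') \<otimes> (v' \<otimes> inv b') = b \<otimes> inv b'"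
      using car by (simp add: m_assoc inv_solve_left')
    then show "(\<lambda>(x, y, z, w). x \<otimes> y \<otimes> z \<otimes> w) z = x"
      using b z by (simp add: h_def)
  qed (use fB in auto)
  also have "\<dots> = real (card B) ^ 4"
    by (simp add: card_cartesian_product eval_nat_numeral)
  also have "\<dots> \<le> (2 * L * n) ^ 4" using cardB by (intro power_mono) auto
  \<comment> \<open>2^21 = 4096 * 2^5 * 2^4: the path count contributes 4096 and (2 L)^5, the four
    popular quotients (2 L)^4.\<close>
  finally have "n ^ 3 * real (card (M <#> m_inv G ` M)) \<le> n ^ 3 * (2 ^ 21 * L ^ 9 * n)"
    using L by (simp add: field_simps power_mult_distrib eval_nat_numeral)
  then have "real (card (M <#> m_inv G ` M)) \<le> 2 ^ 21 * L ^ 9 * n" using n by simp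
  also have "\<dots> \<le> 2 ^ 21 * L ^ 9 * (8 * L * real (card M))"
    using nM L by (intro mult_left_mono) auto
  also have "\<dots> = 2 ^ 24 * L ^ 10 * real (card M)"
    by (simp add: eval_nat_numeral)
  finally show ?thesis using that M nM by (simp add: n_def)
qed

section \<open>Popular quotients and their product sets\<close>

text \<open>A small M M^-1 does not bound M^-1 M in a nonabelian group: take M to be the union of H
  and x H with H x H large. Restricting to left quotients with at least \<open>t\<close>
  representations restores control over all powers.\<close>

definition popular_quotients :: "'a set \<Rightarrow> real \<Rightarrow> 'a set" where
  "popular_quotients M t =
     {x \<in> carrier G. t \<le> real (card {p \<in> M \<times> M. (\<lambda>(y, z). inv y \<otimes> z) p = x})}"

lemma popular_quotients_subset: "0 < t \<Longrightarrow> popular_quotients M t \<subseteq> (\<lambda>(y, z). inv y \<otimes> z) ` (M \<times> M)"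
proof
  fix x assume "0 < t" "x \<in> popular_quotients M t"
  then have "card {p \<in> M \<times> M. (\<lambda>(y, z). inv y \<otimes> z) p = x} \<noteq> 0"
    by (auto simp: popular_quotients_def simp del: card_eq_0_iff)
  then have "{p \<in> M \<times> M. (\<lambda>(y, z). inv y \<otimes> z) p = x} \<noteq> {}" by (metis card.empty)
  then show "x \<in> (\<lambda>(y, z). inv y \<otimes> z) ` (M \<times> M)" by blast
qed

lemma finite_popular_quotients: "finite M \<Longrightarrow> 0 < t \<Longrightarrow> finite (popular_quotients M t)"
  by (rule finite_subset[OF popular_quotients_subset]) auto

lemma inv_mem_popular_quotients:
  assumes "M \<subseteq> carrier G" "x \<in> popular_quotients M t"
  shows "inv x \<in> popular_quotients M t"
proof -
  have x: "x \<in> carrier G" using assms by (simp add: popular_quotients_def)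
  have "card {p \<in> M \<times> M. (\<lambda>(y, z). inv y \<otimes> z) p = inv x} = card {p \<in> M \<times> M. (\<lambda>(y, z). inv y \<otimes> z) p = x}"
  proof (rule bij_betw_same_card[where f = prod.swap], rule bij_betw_byWitness[where f' = prod.swap])
    have *: "inv a \<otimes> b = inv x \<longleftrightarrow> inv b \<otimes> a = x" if "a \<in> M" "b \<in> M" for a b
    proof -
      have ab: "a \<in> carrier G" "b \<in> carrier G" using assms that by auto
      then have "inv (inv b \<otimes> a) = inv a \<otimes> b" by (simp add: inv_mult_group)
      then show ?thesis using x ab by (metis inv_closed inv_inv m_closed)
    qed
    show "prod.swap ` {p \<in> M \<times> M. (\<lambda>(y, z). inv y \<otimes> z) p = inv x} \<subseteq> {p \<in> M \<times> M. (\<lambda>(y, z). inv y \<otimes> z) p = x}"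
      "prod.swap ` {p \<in> M \<times> M. (\<lambda>(y, z). inv y \<otimes> z) p = x} \<subseteq> {p \<in> M \<times> M. (\<lambda>(y, z). inv y \<otimes> z) p = inv x}"
      using * by auto
  qed auto
  then show ?thesis using assms x by (simp add: popular_quotients_def)
qed

lemma one_mem_popular_quotients:
  assumes "M \<subseteq> carrier G" "finite M" "t \<le> real (card M)"
  shows "\<one> \<in> popular_quotients M t"
proof -
  have "card M = card ((\<lambda>y. (y, y)) ` M)" by (rule card_image[symmetric]) (auto simp: inj_on_def)
  also have "\<dots> \<le> card {p \<in> M \<times> M. (\<lambda>(y, z). inv y \<otimes> z) p = \<one>}"
    using assms(1,2) by (intro card_mono) (auto intro: l_inv)
  finally show ?thesis using assms(3) by (simp add: popular_quotients_def)
qed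

text \<open>By Cauchy-Schwarz a small M M^-1 forces large energy. The same energy counts left
  collisions, of which unpopular left quotients carry at most half.\<close>

lemma card_popular_quotients_ge:
  fixes L :: real
  assumes M: "M \<subseteq> carrier G" "finite M" "M \<noteq> {}" and L: "0 < L"
    and small: "real (card (M <#> m_inv G ` M)) \<le> L * real (card M)"
  shows "real (card M) \<le> 2 * L * real (card (popular_quotients M (real (card M) / (2 * L))))"
proof -
  define m where "m = real (card M)"
  have m: "m > 0" using M by (auto simp: m_def card_gt_0_iff)
  define lq where "lq = (\<lambda>(y, z). inv y \<otimes> z)"
  define D where "D = popular_quotients M (m / (2 * L))"
  have rqimg: "(\<lambda>(a, b). a \<otimes> inv b) ` (M \<times> M) = M <#> m_inv G ` M"
    by (auto simp: set_mult_def)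
  have "(real (card (M \<times> M)))\<^sup>2 \<le> real (card (M <#> m_inv G ` M)) * real (card (rcoll M))"
    using card_square_le_collisions[of "M \<times> M" "\<lambda>(a, b). a \<otimes> inv b"] M
    unfolding rqimg rcoll_def by simp
  also have "\<dots> \<le> (L * m) * real (card (rcoll M))"
    using small by (intro mult_right_mono) (auto simp: m_def)
  finally have "m * m ^ 3 \<le> m * (L * real (card (rcoll M)))"
    by (simp add: m_def card_cartesian_product power2_eq_square power3_eq_cube algebra_simps)
  then have "m ^ 3 \<le> L * real (card (lcoll M))"
    using m M by (simp add: card_lcoll_eq_card_rcoll)
  also have "\<dots> \<le> L * (m / (2 * L) * real (card (M \<times> M))
      + m * real (card {p \<in> M \<times> M. m / (2 * L) \<le> real (card {p' \<in> M \<times> M. lq p' = lq p})}))"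
    unfolding lcoll_def lq_def
    by (intro mult_left_mono collisions_le_popular)
       (use M L m card_left_quotient_fibre_le in \<open>auto simp: m_def\<close>)
  also have "{p \<in> M \<times> M. m / (2 * L) \<le> real (card {p' \<in> M \<times> M. lq p' = lq p})}
      = (\<Union>x\<in>D. {p \<in> M \<times> M. lq p = x})"
    using M by (auto simp: D_def popular_quotients_def lq_def subset_iff)
  also have "real (card \<dots>) \<le> m * real (card D)"
  proof -
    have fD: "finite D" using m L M unfolding D_def by (intro finite_popular_quotients) auto
    have "real (card (\<Union>x\<in>D. {p \<in> M \<times> M. lq p = x})) \<le> (\<Sum>x\<in>D. real (card {p \<in> M \<times> M. lq p = x}))"
      using card_UN_le[OF fD, of "\<lambda>x. {p \<in> M \<times> M. lq p = x}"]
      by (simp only: of_nat_sum[symmetric] of_nat_le_iff)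
    also have "\<dots> \<le> (\<Sum>x\<in>D. m)"
      using card_left_quotient_fibre_le M by (intro sum_mono) (auto simp: lq_def m_def)
    finally show ?thesis by (simp add: mult.commute)
  qed
  finally have "m ^ 3 \<le> L * (m / (2 * L) * real (card (M \<times> M)) + m * (m * real (card D)))"
    using L m by simp
  also have "\<dots> = m ^ 3 / 2 + m\<^sup>2 * (L * real (card D))"
    using L by (simp add: m_def card_cartesian_product field_simps power2_eq_square power3_eq_cube)
  finally have "m\<^sup>2 * (m / 2) \<le> m\<^sup>2 * (L * real (card D))"
    by (simp add: power2_eq_square power3_eq_cube)
  then have "m / 2 \<le> L * real (card D)" using m by simp
  then show ?thesis by (simp add: D_def m_def)
qed

text \<open>An element s d m^-1 factors as (s y^-1)(z m^-1) for each of the at least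
  \<open>t\<close> pairs with y^-1 z = d. A factor from the popular quotients is thus exchanged for
  the constant |M M^-1| / t.\<close>

lemma card_mult_popular_quotients_le:
  assumes S: "S \<subseteq> carrier G" "finite S" and M: "M \<subseteq> carrier G" "finite M"
  shows "t * real (card (S <#> popular_quotients M t <#> m_inv G ` M))
    \<le> real (card (S <#> m_inv G ` M)) * real (card (M <#> m_inv G ` M))"
proof -
  define D where "D = popular_quotients M t"
  define rep where "rep x = (SOME q. fst q \<in> S \<and> fst (snd q) \<in> D \<and> snd (snd q) \<in> M \<and>
      fst q \<otimes> fst (snd q) \<otimes> inv (snd (snd q)) = x)" for x
  define R where "R x = (\<lambda>(y, z). (fst (rep x) \<otimes> inv y, z \<otimes> inv (snd (snd (rep x))))) `
      {p \<in> M \<times> M. (\<lambda>(y, z). inv y \<otimes> z) p = fst (snd (rep x))}" for x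
  have fin: "finite (S <#> m_inv G ` M)" "finite (M <#> m_inv G ` M)"
    using S M by (auto simp: set_mult_def)
  have "t * real (card (S <#> D <#> m_inv G ` M))
    \<le> real (card ((S <#> m_inv G ` M) \<times> (M <#> m_inv G ` M)))"
  proof (rule card_le_if_disjoint_reps[where R = R and f = "\<lambda>(a, b). a \<otimes> b"])
    fix x assume x: "x \<in> S <#> D <#> m_inv G ` M"
    then have "\<exists>q. fst q \<in> S \<and> fst (snd q) \<in> D \<and> snd (snd q) \<in> M \<and>
      fst q \<otimes> fst (snd q) \<otimes> inv (snd (snd q)) = x"
      by (force simp: set_mult_def)
    from someI_ex[OF this] obtain s d m where r: "rep x = (s, d, m)" and sdm: "s \<in> S" "d \<in> D" "m \<in> M" "s \<otimes> d \<otimes> inv m = x"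
      unfolding rep_def[symmetric] by (metis prod.collapse)
    have car: "s \<in> carrier G" "m \<in> carrier G" using sdm S M by auto
    show "R x \<subseteq> (S <#> m_inv G ` M) \<times> (M <#> m_inv G ` M)"
      using sdm by (auto simp: R_def r set_mult_def)
    have "inj_on (\<lambda>(y, z). (s \<otimes> inv y, z \<otimes> inv m)) {p \<in> M \<times> M. (\<lambda>(y, z). inv y \<otimes> z) p = d}"
    proof (rule inj_onI, clarsimp)
      fix y z y' z'
      assume *: "y \<in> M" "y' \<in> M" "z \<in> M" "z' \<in> M" "s \<otimes> inv y = s \<otimes> inv y'" "z \<otimes> inv m = z' \<otimes> inv m"
      have "y \<in> carrier G" "y' \<in> carrier G" "z \<in> carrier G" "z' \<in> carrier G" using * M by auto
      then show "y = y' \<and> z = z'" using * car by (metis inv_closed inv_inv l_cancel r_cancel)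
    qed
    then show "t \<le> real (card (R x))"
      using sdm(2) by (simp add: R_def r card_image D_def popular_quotients_def)
    fix w assume "w \<in> R x"
    then obtain y z where w: "w = (s \<otimes> inv y, z \<otimes> inv m)" "y \<in> M" "z \<in> M" "inv y \<otimes> z = d"
      by (auto simp: R_def r)
    have "y \<in> carrier G" "z \<in> carrier G" using w M by auto
    then have "s \<otimes> inv y \<otimes> (z \<otimes> inv m) = s \<otimes> (inv y \<otimes> z) \<otimes> inv m"
      using car by (simp add: m_assoc)
    then show "(\<lambda>(a, b). a \<otimes> b) w = x" using w sdm by simp
  qed (use fin in auto)
  then show ?thesis by (simp add: card_cartesian_product D_def)
qed

primrec setpow :: "'a set \<Rightarrow> nat \<Rightarrow> 'a set" where
  "setpow D 0 = {\<one>}"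
| "setpow D (Suc n) = setpow D n <#> D"

lemma setpow_closed: "D \<subseteq> carrier G \<Longrightarrow> setpow D n \<subseteq> carrier G"
  by (induction n) (auto simp: set_mult_def)

lemma finite_setpow: "finite D \<Longrightarrow> finite (setpow D n)"
  by (induction n) (auto simp: set_mult_def)

lemma mult_mem_setpow:
  assumes "D \<subseteq> carrier G" "x \<in> setpow D m" "y \<in> setpow D n"
  shows "x \<otimes> y \<in> setpow D (m + n)"
  using assms(3)
proof (induction n arbitrary: y)
  case 0
  have "x \<in> carrier G" using assms(1,2) setpow_closed by blast
  then show ?case using 0 assms by auto
next
  case (Suc n)
  then obtain z d where yzd: "y = z \<otimes> d" "z \<in> setpow D n" "d \<in> D" by (auto simp: set_mult_def)
  then have "x \<otimes> y = x \<otimes> z \<otimes> d"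
    using assms setpow_closed[OF assms(1)] by (auto simp: m_assoc subset_iff)
  then show ?case using Suc.IH[OF yzd(2)] yzd by (auto simp: set_mult_def)
qed

lemma setpow_mono:
  assumes "D \<subseteq> carrier G" "\<one> \<in> D" "m \<le> n"
  shows "setpow D m \<subseteq> setpow D n"
  using assms(3)
proof (induction rule: dec_induct)
  case (step n)
  have "setpow D n \<subseteq> setpow D (Suc n)"
  proof
    fix x assume x: "x \<in> setpow D n"
    have "x \<in> carrier G" using x assms(1) setpow_closed by blast
    then have "x \<otimes> \<one> = x" by simp
    then show "x \<in> setpow D (Suc n)" using x assms by (force simp: set_mult_def)
  qed
  with step show ?case by blast
qed simp

lemma mem_setpow_1: "D \<subseteq> carrier G \<Longrightarrow> x \<in> D \<Longrightarrow> x \<in> setpow D 1"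
  by (force simp: set_mult_def)

lemma inv_mem_setpow:
  assumes D: "D \<subseteq> carrier G" "\<And>x. x \<in> D \<Longrightarrow> inv x \<in> D" and "x \<in> setpow D n"
  shows "inv x \<in> setpow D n"
  using assms(3)
proof (induction n arbitrary: x)
  case (Suc n)
  then obtain z d where zd: "x = z \<otimes> d" "z \<in> setpow D n" "d \<in> D" by (auto simp: set_mult_def)
  have "inv d \<otimes> inv z \<in> setpow D (1 + n)"
    using Suc.IH[OF zd(2)] zd(3) D mem_setpow_1 by (intro mult_mem_setpow) auto
  moreover have "inv x = inv d \<otimes> inv z"
    using zd D(1) setpow_closed[OF D(1), of n] by (auto simp: subset_iff inv_mult_group)
  ultimately show ?case by simp
qed simp

text \<open>The induction keeps M^-1 appended on the right, as
  \<open>card_mult_popular_quotients_le\<close> needs it again at each step. In the end, right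
  translation by the inverse of one element of \<open>M\<close> embeds the power itself.\<close>

lemma card_setpow_popular_quotients_le:
  assumes M: "M \<subseteq> carrier G" "finite M" "M \<noteq> {}" and t: "0 < t"
  shows "real (card (setpow (popular_quotients M t) n))
    \<le> (real (card (M <#> m_inv G ` M)) / t) ^ n * real (card M)"
proof -
  let ?D = "popular_quotients M t"
  have D: "?D \<subseteq> carrier G" "finite ?D"
    using finite_popular_quotients[OF M(2) t] by (auto simp: popular_quotients_def)
  have fin: "finite (setpow ?D n)" for n using D finite_setpow by blast
  have *: "real (card (setpow ?D n <#> m_inv G ` M))
    \<le> (real (card (M <#> m_inv G ` M)) / t) ^ n * real (card M)"
  proof (induction n)
    case 0
    have "{\<one>} <#> m_inv G ` M = m_inv G ` M" using M by (force simp: set_mult_def)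
    then show ?case using M by (simp add: card_image_le)
  next
    case (Suc n)
    have "t * real (card (setpow ?D (Suc n) <#> m_inv G ` M))
        \<le> real (card (setpow ?D n <#> m_inv G ` M)) * real (card (M <#> m_inv G ` M))"
      using card_mult_popular_quotients_le[OF setpow_closed[OF D(1)] fin M(1,2)] by simp
    also have "\<dots> \<le> ((real (card (M <#> m_inv G ` M)) / t) ^ n * real (card M)) * real (card (M <#> m_inv G ` M))"
      by (intro mult_right_mono Suc.IH) auto
    finally show ?case using t by (simp add: field_simps)
  qed
  obtain m where m: "m \<in> M" using M by auto
  have "card (setpow ?D n) = card ((\<lambda>x. x \<otimes> inv m) ` setpow ?D n)"
    using setpow_closed[OF D(1)] m M by (intro card_image[symmetric]) (auto simp: inj_on_def subset_iff)
  also have "\<dots> \<le> card (setpow ?D n <#> m_inv G ` M)"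
    using m fin M by (intro card_mono) (auto simp: set_mult_def)
  finally show ?thesis using * by linarith
qed

text \<open>A popular quotient in g H yields at least \<open>t\<close> pairs with z in (y g) H.
  Averaging over y finds a coset of the same \<open>H\<close> that is rich in
  \<open>M\<close>.\<close>

lemma popular_quotients_coset:
  fixes t :: real
  assumes M: "M \<subseteq> carrier G" "finite M" "M \<noteq> {}" and H: "H \<subseteq> carrier G" and g: "g \<in> carrier G"
    and t: "0 < t"
  shows "\<exists>g'\<in>carrier G. t * real (card (popular_quotients M t \<inter> (g <# H))) \<le>
    real (card M) * real (card (M \<inter> (g' <# H)))"
proof -
  let ?D = "popular_quotients M t" and ?C = "g <# H"
  have "t * real (card (?D \<inter> ?C)) \<le> real (card (SIGMA y:M. M \<inter> ((y \<otimes> g) <# H)))"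
  proof (rule card_le_if_disjoint_reps[where R = "\<lambda>x. {p \<in> M \<times> M. (\<lambda>(y, z). inv y \<otimes> z) p = x}"
        and f = "\<lambda>(y, z). inv y \<otimes> z"])
    fix x assume x: "x \<in> ?D \<inter> ?C"
    then obtain h where h: "h \<in> H" "x = g \<otimes> h" by (auto simp: l_coset_def)
    have "z \<in> (y \<otimes> g) <# H" if "y \<in> M" "z \<in> M" "inv y \<otimes> z = x" for y z
    proof -
      have car: "y \<in> carrier G" "z \<in> carrier G" "h \<in> carrier G" using that M H h by auto
      then have "z = y \<otimes> (inv y \<otimes> z)" by (simp add: m_assoc[symmetric])
      then have "z = y \<otimes> g \<otimes> h" using that h car g by (simp add: m_assoc)
      then show ?thesis using h by (auto simp: l_coset_def)
    qed
    then show "{p \<in> M \<times> M. (\<lambda>(y, z). inv y \<otimes> z) p = x} \<subseteq> (SIGMA y:M. M \<inter> ((y \<otimes> g) <# H))"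
      by auto
  qed (use M in \<open>auto simp: popular_quotients_def\<close>)
  also have "\<dots> = (\<Sum>y\<in>M. real (card (M \<inter> ((y \<otimes> g) <# H))))" using M by simp
  finally have *: "t * real (card (?D \<inter> ?C)) \<le> (\<Sum>y\<in>M. real (card (M \<inter> ((y \<otimes> g) <# H))))" .
  have "\<exists>y\<in>M. t * real (card (?D \<inter> ?C)) \<le> real (card M) * real (card (M \<inter> ((y \<otimes> g) <# H)))"
  proof (rule ccontr)
    assume "\<not> ?thesis"
    then have "(\<Sum>y\<in>M. real (card M) * real (card (M \<inter> ((y \<otimes> g) <# H)))) < (\<Sum>y\<in>M. t * real (card (?D \<inter> ?C)))"
      using M by (intro sum_strict_mono) (auto simp: not_le)
    then have "real (card M) * (\<Sum>y\<in>M. real (card (M \<inter> ((y \<otimes> g) <# H)))) < real (card M) * (t * real (card (?D \<inter> ?C)))"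
      by (simp add: sum_distrib_left)
    then have "(\<Sum>y\<in>M. real (card (M \<inter> ((y \<otimes> g) <# H)))) < t * real (card (?D \<inter> ?C))"
      by (rule mult_left_less_imp_less) auto
    with * show False by simp
  qed
  then show ?thesis using M g by blast
qed

subsection \<open>Quotient convolutions of weights\<close>

definition prob_weight :: "'a set \<Rightarrow> ('a \<Rightarrow> real) \<Rightarrow> bool" where
  "prob_weight S w \<longleftrightarrow> finite S \<and> S \<subseteq> carrier G \<and> (\<forall>x\<in>S. 0 \<le> w x) \<and> (\<Sum>x\<in>S. w x) = 1"

definition qsupp :: "'a set \<Rightarrow> 'a set" where
  "qsupp S = (\<lambda>(a, b). inv a \<otimes> b) ` (S \<times> S)"

definition qconv :: "'a set \<Rightarrow> ('a \<Rightarrow> real) \<Rightarrow> 'a \<Rightarrow> real" where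
  "qconv S w x = (\<Sum>p\<in>{p \<in> S \<times> S. (\<lambda>(a, b). inv a \<otimes> b) p = x}. w (fst p) * w (snd p))"

text \<open>The expectation of \<open>h\<close> under the law of a^-1 b. Total mass, coset mass,
  overlap and energy of a convolution are all obtained by choosing \<open>h\<close>.\<close>

lemma sum_qconv_mult:
  assumes "finite S"
  shows "(\<Sum>x\<in>qsupp S. qconv S w x * h x) = (\<Sum>a\<in>S. \<Sum>b\<in>S. w a * w b * h (inv a \<otimes> b))"
proof -
  have "(\<Sum>a\<in>S. \<Sum>b\<in>S. w a * w b * h (inv a \<otimes> b))
      = (\<Sum>p\<in>S \<times> S. w (fst p) * w (snd p) * h ((\<lambda>(a, b). inv a \<otimes> b) p))"
    by (simp add: sum.cartesian_product case_prod_unfold)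
  also have "\<dots> = (\<Sum>x\<in>qsupp S. \<Sum>p\<in>{p \<in> S \<times> S. (\<lambda>(a, b). inv a \<otimes> b) p = x}.
      w (fst p) * w (snd p) * h ((\<lambda>(a, b). inv a \<otimes> b) p))"
    unfolding qsupp_def using assms by (intro sum.image_gen) auto
  also have "\<dots> = (\<Sum>x\<in>qsupp S. qconv S w x * h x)"
    unfolding qconv_def sum_distrib_right by (intro sum.cong refl) auto
  finally show ?thesis by simp
qed

lemma qconv_nonneg: "prob_weight S w \<Longrightarrow> 0 \<le> qconv S w x"
  unfolding qconv_def prob_weight_def by (intro sum_nonneg) auto

lemma prob_weight_qconv:
  assumes "prob_weight S w"
  shows "prob_weight (qsupp S) (qconv S w)"
proof -
  have S: "finite S" "S \<subseteq> carrier G" "(\<Sum>x\<in>S. w x) = 1" using assms by (auto simp: prob_weight_def)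
  have "(\<Sum>x\<in>qsupp S. qconv S w x) = (\<Sum>a\<in>S. w a) * (\<Sum>b\<in>S. w b)"
    using sum_qconv_mult[OF S(1), of w "\<lambda>_. 1"] by (simp add: sum_product)
  then show ?thesis using S qconv_nonneg[OF assms] by (auto simp: prob_weight_def qsupp_def)
qed

text \<open>Both projections of the fibre over \<open>x\<close> are injective, so 2 a b <= a^2 + b^2
  bounds the sum by the energy of \<open>w\<close>, used once for each coordinate.\<close>

lemma qconv_le:
  assumes "prob_weight S w"
  shows "qconv S w x \<le> (\<Sum>a\<in>S. (w a)\<^sup>2)"
proof -
  let ?P = "{p \<in> S \<times> S. (\<lambda>(a, b). inv a \<otimes> b) p = x}"
  have S: "finite S" "S \<subseteq> carrier G" using assms by (auto simp: prob_weight_def)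
  have i1: "inj_on fst ?P" and i2: "inj_on snd ?P"
    using S(2) by (auto simp: inj_on_def subset_iff)
  have "w (fst p) * w (snd p) \<le> ((w (fst p))\<^sup>2 + (w (snd p))\<^sup>2) / 2" for p
    using sum_squares_bound[of "w (fst p)" "w (snd p)"] by simp
  then have "qconv S w x \<le> (\<Sum>p\<in>?P. ((w (fst p))\<^sup>2 + (w (snd p))\<^sup>2) / 2)"
    unfolding qconv_def by (intro sum_mono)
  also have "\<dots> = ((\<Sum>a\<in>fst ` ?P. (w a)\<^sup>2) + (\<Sum>a\<in>snd ` ?P. (w a)\<^sup>2)) / 2"
    by (simp add: sum.reindex[OF i1] sum.reindex[OF i2] sum_divide_distrib[symmetric] sum.distrib)
  also have "\<dots> \<le> ((\<Sum>a\<in>S. (w a)\<^sup>2) + (\<Sum>a\<in>S. (w a)\<^sup>2)) / 2"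
    using S(1) by (intro divide_right_mono add_mono sum_mono2) auto
  finally show ?thesis by simp
qed

text \<open>The bound is uniform over all cosets of \<open>H\<close>, hence it iterates. It is used
  contrapositively, to bring a coset that is heavy after several steps back to
  \<open>A\<close>.\<close>

lemma qconv_coset_le:
  assumes w: "prob_weight S w" and H: "H \<subseteq> carrier G"
    and \<kappa>: "\<And>g. g \<in> carrier G \<Longrightarrow> (\<Sum>x\<in>S \<inter> (g <# H). w x) \<le> \<kappa>" and g: "g \<in> carrier G"
  shows "(\<Sum>x\<in>qsupp S \<inter> (g <# H). qconv S w x) \<le> \<kappa>"
proof -
  have S: "finite S" "S \<subseteq> carrier G" "\<And>x. x \<in> S \<Longrightarrow> 0 \<le> w x" "(\<Sum>x\<in>S. w x) = 1"
    using w by (auto simp: prob_weight_def)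
  have fq: "finite (qsupp S)" using S by (simp add: qsupp_def)
  let ?h = "\<lambda>x. if x \<in> g <# H then 1 else 0 :: real"
  have eq: "inv a \<otimes> b \<in> g <# H \<longleftrightarrow> b \<in> (a \<otimes> g) <# H" if "a \<in> S" "b \<in> S" for a b
  proof -
    have car: "a \<in> carrier G" "b \<in> carrier G" using that S by auto
    have "inv a \<otimes> b = g \<otimes> h \<longleftrightarrow> b = a \<otimes> g \<otimes> h" if "h \<in> H" for h
    proof -
      have "h \<in> carrier G" using that H by auto
      then show ?thesis using car g by (metis inv_solve_left m_assoc m_closed)
    qed
    then show ?thesis by (auto simp: l_coset_def)
  qed
  have "(\<Sum>x\<in>qsupp S \<inter> (g <# H). qconv S w x) = (\<Sum>x\<in>qsupp S. qconv S w x * ?h x)"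
    using fq by (simp add: sum.inter_restrict if_distrib cong: if_cong)
  also have "\<dots> = (\<Sum>a\<in>S. \<Sum>b\<in>S. w a * w b * ?h (inv a \<otimes> b))"
    by (rule sum_qconv_mult[OF S(1)])
  also have "\<dots> = (\<Sum>a\<in>S. w a * (\<Sum>b\<in>S. if b \<in> (a \<otimes> g) <# H then w b else 0))"
    unfolding sum_distrib_left by (intro sum.cong refl) (simp add: eq)
  also have "\<dots> = (\<Sum>a\<in>S. w a * (\<Sum>b\<in>S \<inter> ((a \<otimes> g) <# H). w b))"
    using S(1) by (simp add: sum.inter_restrict)
  also have "\<dots> \<le> (\<Sum>a\<in>S. w a * \<kappa>)"
    using S g by (intro sum_mono mult_left_mono \<kappa>) auto
  also have "\<dots> = \<kappa>" using S(4) by (simp add: sum_distrib_right[symmetric])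
  finally show ?thesis .
qed

text \<open>Cauchy-Schwarz over the points of \<open>Y\<close>, with the overlap written as a sum of
  indicators. A point of Y, aY and bY is the image under a of a point of Y and (a^-1 b)Y.\<close>

lemma overlap_qconv_ge:
  fixes act :: "'a \<Rightarrow> 'x \<Rightarrow> 'x"
  assumes w: "prob_weight S w" and Y: "finite Y" "Y \<subseteq> E"
    and inj: "\<And>g. g \<in> carrier G \<Longrightarrow> inj_on (act g) E"
    and closed: "\<And>g x. g \<in> carrier G \<Longrightarrow> x \<in> E \<Longrightarrow> act g x \<in> E"
    and comp: "\<And>g h x. g \<in> carrier G \<Longrightarrow> h \<in> carrier G \<Longrightarrow> x \<in> E \<Longrightarrow> act (g \<otimes> h) x = act g (act h x)"
  shows "(\<Sum>g\<in>S. w g * real (card (Y \<inter> act g ` Y)))\<^sup>2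
    \<le> real (card Y) * (\<Sum>g\<in>qsupp S. qconv S w g * real (card (Y \<inter> act g ` Y)))"
proof -
  have S: "finite S" "S \<subseteq> carrier G" "\<And>x. x \<in> S \<Longrightarrow> 0 \<le> w x"
    using w by (auto simp: prob_weight_def)
  let ?i = "\<lambda>a y. if y \<in> act a ` Y then 1 else 0 :: real"
  have card_sum: "real (card (Y \<inter> act a ` Y)) = (\<Sum>y\<in>Y. ?i a y)" for a
    using Y by (simp add: sum.If_cases)
  have ov: "(\<Sum>y\<in>Y. ?i a y * ?i b y) \<le> real (card (Y \<inter> act (inv a \<otimes> b) ` Y))"
    if ab: "a \<in> S" "b \<in> S" for a b
  proof -
    have car: "a \<in> carrier G" "b \<in> carrier G" using ab S by auto
    have aab: "act a (act (inv a \<otimes> b) y) = act b y" if "y \<in> Y" for y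
      using that Y car comp[of a "inv a \<otimes> b" y] by (auto simp: m_assoc[symmetric])
    have "(\<Sum>y\<in>Y. ?i a y * ?i b y) = real (card (Y \<inter> act a ` Y \<inter> act b ` Y))"
    proof -
      have "(\<Sum>y\<in>Y. ?i a y * ?i b y) = (\<Sum>y\<in>Y. if y \<in> act a ` Y \<inter> act b ` Y then 1 else 0)"
        by (intro sum.cong refl) auto
      also have "\<dots> = real (card (Y \<inter> (act a ` Y \<inter> act b ` Y)))"
        using Y by (simp add: sum.If_cases Int_def)
      finally show ?thesis by (simp add: Int_assoc)
    qed
    also have "\<dots> \<le> real (card (act a ` (Y \<inter> act (inv a \<otimes> b) ` Y)))"
    proof (intro of_nat_mono card_mono)
      show "Y \<inter> act a ` Y \<inter> act b ` Y \<subseteq> act a ` (Y \<inter> act (inv a \<otimes> b) ` Y)"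
      proof
        fix z assume z: "z \<in> Y \<inter> act a ` Y \<inter> act b ` Y"
        then obtain x y where xy: "x \<in> Y" "y \<in> Y" "z = act a x" "z = act b y" by auto
        then have "act a x = act a (act (inv a \<otimes> b) y)" using aab by simp
        then have "x = act (inv a \<otimes> b) y"
          using inj[OF car(1)] xy Y car closed[of "inv a \<otimes> b" y] by (auto dest: inj_onD)
        then show "z \<in> act a ` (Y \<inter> act (inv a \<otimes> b) ` Y)" using xy by auto
      qed
    qed (use Y in auto)
    also have "\<dots> \<le> real (card (Y \<inter> act (inv a \<otimes> b) ` Y))"
      using Y by (intro of_nat_mono card_image_le) auto
    finally show ?thesis .
  qed
  have "(\<Sum>g\<in>S. w g * real (card (Y \<inter> act g ` Y))) = (\<Sum>y\<in>Y. 1 * (\<Sum>a\<in>S. w a * ?i a y))"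
    unfolding card_sum sum_distrib_left by (subst sum.swap) simp
  then have "(\<Sum>g\<in>S. w g * real (card (Y \<inter> act g ` Y)))\<^sup>2
      \<le> (\<Sum>y\<in>Y. 1\<^sup>2) * (\<Sum>y\<in>Y. (\<Sum>a\<in>S. w a * ?i a y)\<^sup>2)"
    using Cauchy_Schwarz_sum[of "\<lambda>_. 1" "\<lambda>y. \<Sum>a\<in>S. w a * ?i a y" Y] by simp
  also have "(\<Sum>y\<in>Y. (\<Sum>a\<in>S. w a * ?i a y)\<^sup>2) = (\<Sum>y\<in>Y. \<Sum>a\<in>S. \<Sum>b\<in>S. w a * w b * (?i a y * ?i b y))"
    unfolding power2_eq_square sum_product by (intro sum.cong refl) (simp add: mult.assoc mult.left_commute)
  also have "\<dots> = (\<Sum>a\<in>S. \<Sum>b\<in>S. w a * w b * (\<Sum>y\<in>Y. ?i a y * ?i b y))"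
    unfolding sum_distrib_left by (subst sum.swap) (intro sum.cong refl sum.swap)
  also have "\<dots> \<le> (\<Sum>a\<in>S. \<Sum>b\<in>S. w a * w b * real (card (Y \<inter> act (inv a \<otimes> b) ` Y)))"
    using S ov by (intro sum_mono mult_left_mono) auto
  also have "\<dots> = (\<Sum>g\<in>qsupp S. qconv S w g * real (card (Y \<inter> act g ` Y)))"
    by (rule sum_qconv_mult[OF S(1), symmetric])
  finally show ?thesis by (simp add: mult_left_mono)
qed

lemma card_lcoll_le:
  assumes "A \<subseteq> carrier G" "finite A"
  shows "card (lcoll A) \<le> card A ^ 3"
proof -
  have "card (lcoll A) \<le> card (A \<times> A \<times> A)"
    by (rule card_inj_on_le[where f = "\<lambda>((a, b), (c, d)). (a, b, c)"])
       (use assms in \<open>auto simp: inj_on_def lcoll_def subset_iff\<close>)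
  then show ?thesis by (simp add: card_cartesian_product power3_eq_cube)
qed

text \<open>Three entries of a collision determine the fourth, so \<open>proj\<close> can drop an
  entry of weight at most \<tau> injectively. What remains is part of the product of three total
  masses, each equal to 1.\<close>

lemma sum_lcoll_le:
  fixes u :: "'a \<Rightarrow> real"
  assumes S: "finite S" "S \<subseteq> carrier G" and u: "\<And>x. x \<in> S \<Longrightarrow> 0 \<le> u x"
    and Q: "Q \<subseteq> lcoll S" and proj: "proj ` Q \<subseteq> S \<times> S \<times> S" "inj_on proj Q"
    and le: "\<And>q. q \<in> Q \<Longrightarrow> (\<lambda>((a, b), (c, d)). u a * u b * u c * u d) q
      \<le> \<tau> * (\<lambda>(a, b, c). u a * u b * u c) (proj q)" and \<tau>: "0 \<le> \<tau>" and mass: "(\<Sum>x\<in>S. u x) = 1"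
  shows "(\<Sum>q\<in>Q. (\<lambda>((a, b), (c, d)). u a * u b * u c * u d) q) \<le> \<tau>"
proof -
  have "(\<Sum>q\<in>Q. (\<lambda>((a, b), (c, d)). u a * u b * u c * u d) q)
      \<le> (\<Sum>q\<in>Q. \<tau> * (\<lambda>(a, b, c). u a * u b * u c) (proj q))"
    by (intro sum_mono le)
  also have "\<dots> = \<tau> * (\<Sum>r\<in>proj ` Q. (\<lambda>(a, b, c). u a * u b * u c) r)"
    by (simp add: sum_distrib_left sum.reindex[OF proj(2)])
  also have "\<dots> \<le> \<tau> * (\<Sum>r\<in>S \<times> S \<times> S. (\<lambda>(a, b, c). u a * u b * u c) r)"
    using S u proj \<tau> by (intro mult_left_mono sum_mono2) auto
  also have "(\<Sum>r\<in>S \<times> S \<times> S. (\<lambda>(a, b, c). u a * u b * u c) r)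
      = (\<Sum>a\<in>S. u a) * ((\<Sum>b\<in>S. u b) * (\<Sum>c\<in>S. u c))"
    by (simp add: sum_product sum.cartesian_product case_prod_unfold mult.assoc)
  finally show ?thesis by (simp add: mass)
qed

text \<open>This identity converts the later of two comparable energies into collisions of the
  weight between them.\<close>

lemma sum_qconv_square_eq:
  assumes "finite S"
  shows "(\<Sum>x\<in>qsupp S. (qconv S w x)\<^sup>2) = (\<Sum>q\<in>lcoll S. (\<lambda>((a, b), (c, d)). w a * w b * w c * w d) q)"
proof -
  have lc: "lcoll S = (SIGMA p:S \<times> S. {q \<in> S \<times> S. (\<lambda>(a, b). inv a \<otimes> b) q = (\<lambda>(a, b). inv a \<otimes> b) p})"
    by (auto simp: lcoll_def)
  have "(\<Sum>x\<in>qsupp S. (qconv S w x)\<^sup>2) = (\<Sum>x\<in>qsupp S. qconv S w x * qconv S w x)"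
    by (simp add: power2_eq_square)
  also have "\<dots> = (\<Sum>a\<in>S. \<Sum>b\<in>S. w a * w b * qconv S w (inv a \<otimes> b))"
    by (rule sum_qconv_mult[OF assms])
  also have "\<dots> = (\<Sum>p\<in>S \<times> S. w (fst p) * w (snd p) * qconv S w ((\<lambda>(a, b). inv a \<otimes> b) p))"
    by (simp add: sum.cartesian_product case_prod_unfold)
  also have "\<dots> = (\<Sum>p\<in>S \<times> S. \<Sum>q\<in>{q \<in> S \<times> S. (\<lambda>(a, b). inv a \<otimes> b) q = (\<lambda>(a, b). inv a \<otimes> b) p}.
      (\<lambda>((a, b), (c, d)). w a * w b * w c * w d) (p, q))"
    unfolding qconv_def sum_distrib_left by (intro sum.cong refl) (auto simp: mult.assoc)
  also have "\<dots> = (\<Sum>q\<in>lcoll S. (\<lambda>((a, b), (c, d)). w a * w b * w c * w d) q)"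
    unfolding lc using assms by (subst sum.Sigma) (auto intro!: sum.cong)
  finally show ?thesis .
qed

text \<open>The four families of collisions with a light entry cost at most s / (8 K) each, together
  half of the available s / K. A collision inside \<open>A\<close> weighs at most s^4. The bound on
  the size of \<open>A\<close> is Markov's inequality.\<close>

lemma level_set_energy:
  fixes s K :: real
  assumes w: "prob_weight S w" and le: "\<And>x. x \<in> S \<Longrightarrow> w x \<le> s" and s: "0 < s" and K: "1 \<le> K"
    and flat: "s \<le> K * (\<Sum>x\<in>qsupp S. (qconv S w x)\<^sup>2)"
  defines "A \<equiv> {x \<in> S. s / (8 * K) \<le> w x}"
  shows "1 \<le> 2 * K * s ^ 3 * real (card (lcoll A))" "real (card A) * s \<le> 8 * K"
proof -
  have S: "finite S" "S \<subseteq> carrier G" "\<And>x. x \<in> S \<Longrightarrow> 0 \<le> w x" "(\<Sum>x\<in>S. w x) = 1"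
    using w by (auto simp: prob_weight_def)
  define \<tau> where "\<tau> = s / (8 * K)"
  have \<tau>: "0 \<le> \<tau>" using s K by (simp add: \<tau>_def)
  let ?W = "\<lambda>((a, b), (c, d)). w a * w b * w c * w d"
  define Q1 where "Q1 = {((a, b), (c, d)). ((a, b), (c, d)) \<in> lcoll S \<and> w a < \<tau>}"
  define Q2 where "Q2 = {((a, b), (c, d)). ((a, b), (c, d)) \<in> lcoll S \<and> w b < \<tau>}"
  define Q3 where "Q3 = {((a, b), (c, d)). ((a, b), (c, d)) \<in> lcoll S \<and> w c < \<tau>}"
  define Q4 where "Q4 = {((a, b), (c, d)). ((a, b), (c, d)) \<in> lcoll S \<and> w d < \<tau>}"
  have fS: "finite (lcoll S)"
    by (rule finite_subset[of _ "(S \<times> S) \<times> (S \<times> S)"]) (use S in \<open>auto simp: lcoll_def\<close>)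
  have AS: "A \<subseteq> S" by (auto simp: A_def)
  have fA: "finite (lcoll A)"
    by (rule finite_subset[OF _ fS]) (use AS in \<open>auto simp: lcoll_def\<close>)
  have sub: "Q1 \<subseteq> lcoll S" "Q2 \<subseteq> lcoll S" "Q3 \<subseteq> lcoll S" "Q4 \<subseteq> lcoll S"
    by (auto simp: Q1_def Q2_def Q3_def Q4_def)
  have fQ: "finite Q1" "finite Q2" "finite Q3" "finite Q4"
    using sub fS finite_subset by blast+
  have cover: "lcoll S \<subseteq> lcoll A \<union> (Q1 \<union> (Q2 \<union> (Q3 \<union> Q4)))"
    unfolding Q1_def Q2_def Q3_def Q4_def by (auto simp: lcoll_def A_def \<tau>_def)
  have W0: "0 \<le> ?W q" if "q \<in> lcoll S" for q
    using that S(3) by (auto simp: lcoll_def)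
  have Qb: "(\<Sum>q\<in>Q1. ?W q) \<le> \<tau>" "(\<Sum>q\<in>Q2. ?W q) \<le> \<tau>" "(\<Sum>q\<in>Q3. ?W q) \<le> \<tau>" "(\<Sum>q\<in>Q4. ?W q) \<le> \<tau>"
  proof -
    note lemma_rule = sum_lcoll_le[OF S(1,2,3) _ _ _ _ \<tau> S(4)]
    have mono: "x * y \<le> \<tau> * y" if "x < \<tau>" "0 \<le> y" for x y :: real
      using that by (intro mult_right_mono) auto
    have mem: "a \<in> S" "b \<in> S" "c \<in> S" "d \<in> S" "inv a \<otimes> b = inv c \<otimes> d"
      if "((a, b), (c, d)) \<in> lcoll S" for a b c d
      using that by (auto simp: lcoll_def)
    have c1: "a = a'" if "inv a \<otimes> b = inv a' \<otimes> b" "a \<in> S" "a' \<in> S" "b \<in> S" for a a' b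
      using that S(2) by (metis inv_closed inv_inv r_cancel subset_iff)
    have c2: "b = b'" if "inv a \<otimes> b = inv a \<otimes> b'" "a \<in> S" "b \<in> S" "b' \<in> S" for a b b'
      using that S(2) by (metis inv_closed l_cancel subset_iff)
    show "(\<Sum>q\<in>Q1. ?W q) \<le> \<tau>"
    proof (rule lemma_rule[where proj = "\<lambda>((a, b), (c, d)). (b, c, d)"])
      show "inj_on (\<lambda>((a, b), (c, d)). (b, c, d)) Q1"
      proof (rule inj_onI)
        fix q q'
        assume *: "q \<in> Q1" "q' \<in> Q1" "(\<lambda>((a, b), (c, d)). (b, c, d)) q = (\<lambda>((a, b), (c, d)). (b, c, d)) q'"
        obtain a b c d where q: "q = ((a, b), (c, d))" by (metis surj_pair)
        obtain a' where q': "q' = ((a', b), (c, d))" using *(3) q by (cases q') auto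
        have m: "((a, b), (c, d)) \<in> lcoll S" "((a', b), (c, d)) \<in> lcoll S"
          using *(1,2) q q' sub(1) by auto
        from mem[OF m(1)] mem[OF m(2)] have "a = a'" by (intro c1[of a b "a'"]) auto
        then show "q = q'" using q q' by simp
      qed
      fix q assume "q \<in> Q1"
      then obtain a b c d where q: "q = ((a, b), (c, d))" "w a < \<tau>" "((a, b), (c, d)) \<in> lcoll S"
        by (auto simp: Q1_def)
      have "w a * (w b * w c * w d) \<le> \<tau> * (w b * w c * w d)"
        using mem[OF q(3)] S(3) q(2) by (intro mono mult_nonneg_nonneg) auto
      then show "?W q \<le> \<tau> * (\<lambda>(a, b, c). w a * w b * w c) ((\<lambda>((a, b), (c, d)). (b, c, d)) q)"
        using q by (simp add: ac_simps)
    qed (use sub mem in \<open>fastforce+\<close>)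
    show "(\<Sum>q\<in>Q2. ?W q) \<le> \<tau>"
    proof (rule lemma_rule[where proj = "\<lambda>((a, b), (c, d)). (a, c, d)"])
      show "inj_on (\<lambda>((a, b), (c, d)). (a, c, d)) Q2"
      proof (rule inj_onI)
        fix q q'
        assume *: "q \<in> Q2" "q' \<in> Q2" "(\<lambda>((a, b), (c, d)). (a, c, d)) q = (\<lambda>((a, b), (c, d)). (a, c, d)) q'"
        obtain a b c d where q: "q = ((a, b), (c, d))" by (metis surj_pair)
        obtain b' where q': "q' = ((a, b'), (c, d))" using *(3) q by (cases q') auto
        have m: "((a, b), (c, d)) \<in> lcoll S" "((a, b'), (c, d)) \<in> lcoll S"
          using *(1,2) q q' sub(2) by auto
        from mem[OF m(1)] mem[OF m(2)] have "b = b'" by (intro c2[of a b "b'"]) auto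
        then show "q = q'" using q q' by simp
      qed
      fix q assume "q \<in> Q2"
      then obtain a b c d where q: "q = ((a, b), (c, d))" "w b < \<tau>" "((a, b), (c, d)) \<in> lcoll S"
        by (auto simp: Q2_def)
      have "w b * (w a * w c * w d) \<le> \<tau> * (w a * w c * w d)"
        using mem[OF q(3)] S(3) q(2) by (intro mono mult_nonneg_nonneg) auto
      then show "?W q \<le> \<tau> * (\<lambda>(a, b, c). w a * w b * w c) ((\<lambda>((a, b), (c, d)). (a, c, d)) q)"
        using q by (simp add: ac_simps)
    qed (use sub mem in \<open>fastforce+\<close>)
    show "(\<Sum>q\<in>Q3. ?W q) \<le> \<tau>"
    proof (rule lemma_rule[where proj = "\<lambda>((a, b), (c, d)). (a, b, d)"])
      show "inj_on (\<lambda>((a, b), (c, d)). (a, b, d)) Q3"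
      proof (rule inj_onI)
        fix q q'
        assume *: "q \<in> Q3" "q' \<in> Q3" "(\<lambda>((a, b), (c, d)). (a, b, d)) q = (\<lambda>((a, b), (c, d)). (a, b, d)) q'"
        obtain a b c d where q: "q = ((a, b), (c, d))" by (metis surj_pair)
        obtain c' where q': "q' = ((a, b), (c', d))" using *(3) q by (cases q') auto
        have m: "((a, b), (c, d)) \<in> lcoll S" "((a, b), (c', d)) \<in> lcoll S"
          using *(1,2) q q' sub(3) by auto
        from mem[OF m(1)] mem[OF m(2)] have "c = c'" by (intro c1[of c d "c'"]) auto
        then show "q = q'" using q q' by simp
      qed
      fix q assume "q \<in> Q3"
      then obtain a b c d where q: "q = ((a, b), (c, d))" "w c < \<tau>" "((a, b), (c, d)) \<in> lcoll S"
        by (auto simp: Q3_def)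
      have "w c * (w a * w b * w d) \<le> \<tau> * (w a * w b * w d)"
        using mem[OF q(3)] S(3) q(2) by (intro mono mult_nonneg_nonneg) auto
      then show "?W q \<le> \<tau> * (\<lambda>(a, b, c). w a * w b * w c) ((\<lambda>((a, b), (c, d)). (a, b, d)) q)"
        using q by (simp add: ac_simps)
    qed (use sub mem in \<open>fastforce+\<close>)
    show "(\<Sum>q\<in>Q4. ?W q) \<le> \<tau>"
    proof (rule lemma_rule[where proj = "\<lambda>((a, b), (c, d)). (a, b, c)"])
      show "inj_on (\<lambda>((a, b), (c, d)). (a, b, c)) Q4"
      proof (rule inj_onI)
        fix q q'
        assume *: "q \<in> Q4" "q' \<in> Q4" "(\<lambda>((a, b), (c, d)). (a, b, c)) q = (\<lambda>((a, b), (c, d)). (a, b, c)) q'"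
        obtain a b c d where q: "q = ((a, b), (c, d))" by (metis surj_pair)
        obtain d' where q': "q' = ((a, b), (c, d'))" using *(3) q by (cases q') auto
        have m: "((a, b), (c, d)) \<in> lcoll S" "((a, b), (c, d')) \<in> lcoll S"
          using *(1,2) q q' sub(4) by auto
        from mem[OF m(1)] mem[OF m(2)] have "d = d'" by (intro c2[of c d "d'"]) auto
        then show "q = q'" using q q' by simp
      qed
      fix q assume "q \<in> Q4"
      then obtain a b c d where q: "q = ((a, b), (c, d))" "w d < \<tau>" "((a, b), (c, d)) \<in> lcoll S"
        by (auto simp: Q4_def)
      have "w d * (w a * w b * w c) \<le> \<tau> * (w a * w b * w c)"
        using mem[OF q(3)] S(3) q(2) by (intro mono mult_nonneg_nonneg) auto
      then show "?W q \<le> \<tau> * (\<lambda>(a, b, c). w a * w b * w c) ((\<lambda>((a, b), (c, d)). (a, b, c)) q)"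
        using q by (simp add: ac_simps)
    qed (use sub mem in \<open>fastforce+\<close>)
  qed
  have un: "sum ?W (P \<union> P') \<le> sum ?W P + sum ?W P'"
    if "finite P" "finite P'" "P \<subseteq> lcoll S" "P' \<subseteq> lcoll S" for P P'
  proof -
    have "0 \<le> sum ?W (P \<inter> P')" using that W0 by (intro sum_nonneg) auto
    then show ?thesis using sum_Un[OF that(1,2), of ?W] by linarith
  qed
  have lA: "lcoll A \<subseteq> lcoll S" using AS by (auto simp: lcoll_def)
  have "s \<le> K * sum ?W (lcoll S)" using flat by (simp add: sum_qconv_square_eq[OF S(1)])
  then have "s / K \<le> sum ?W (lcoll S)" using K by (simp add: field_simps)
  also have "\<dots> \<le> sum ?W (lcoll A \<union> (Q1 \<union> (Q2 \<union> (Q3 \<union> Q4))))"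
    using fA fQ cover lA sub W0 by (intro sum_mono2) auto
  also have "\<dots> \<le> sum ?W (lcoll A) + (sum ?W Q1 + (sum ?W Q2 + (sum ?W Q3 + sum ?W Q4)))"
    using fA fQ lA sub
    by (intro order_trans[OF un] add_mono order_refl) auto
  also have "\<dots> \<le> sum ?W (lcoll A) + 4 * \<tau>" using Qb by linarith
  also have "4 * \<tau> = s / (2 * K)" by (simp add: \<tau>_def)
  also have "sum ?W (lcoll A) \<le> (\<Sum>q\<in>lcoll A. s ^ 4)"
  proof (intro sum_mono)
    fix q assume "q \<in> lcoll A"
    then obtain a b c d where q: "q = ((a, b), (c, d))" "a \<in> S" "b \<in> S" "c \<in> S" "d \<in> S"
      using AS by (cases q) (auto simp: lcoll_def subset_iff)
    then have "w a * w b * w c * w d \<le> s * s * s * s"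
      using S(3) le s by (intro mult_mono mult_nonneg_nonneg) auto
    then show "?W q \<le> s ^ 4" using q by (simp add: eval_nat_numeral mult.assoc)
  qed
  finally have "s / K - s / (2 * K) \<le> s ^ 4 * real (card (lcoll A))" by (simp add: mult.commute)
  moreover have "s / K - s / (2 * K) = s / (2 * K)" using K by (simp add: field_simps)
  ultimately have "s \<le> s ^ 4 * real (card (lcoll A)) * (2 * K)" using K by (simp add: pos_divide_le_eq)
  then have "s * 1 \<le> s * (2 * K * s ^ 3 * real (card (lcoll A)))"
    by (simp add: eval_nat_numeral algebra_simps)
  then show "1 \<le> 2 * K * s ^ 3 * real (card (lcoll A))" using s by (simp only: mult_le_cancel_left_pos)
  have "real (card A) * \<tau> = (\<Sum>x\<in>A. \<tau>)" by simp
  also have "\<dots> \<le> (\<Sum>x\<in>A. w x)" by (intro sum_mono) (auto simp: A_def \<tau>_def)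
  also have "\<dots> \<le> (\<Sum>x\<in>S. w x)" using AS S by (intro sum_mono2) auto
  finally show "real (card A) * s \<le> 8 * K" using S K by (simp add: \<tau>_def pos_divide_le_eq)
qed

end

subsection \<open>Pivots\<close>

definition abelian_subgroup :: "('a, 'm) monoid_scheme \<Rightarrow> 'a set \<Rightarrow> bool" where
  "abelian_subgroup G H \<longleftrightarrow> subgroup H G \<and> comm_group (G\<lparr>carrier := H\<rparr>)"

lemma (in group) abelian_subgroupI:
  assumes "subgroup H G" "\<And>x y. x \<in> H \<Longrightarrow> y \<in> H \<Longrightarrow> x \<otimes> y = y \<otimes> x"
  shows "abelian_subgroup G H"
proof -
  interpret H: group "G\<lparr>carrier := H\<rparr>"
    using assms(1) group_axioms by (rule subgroup.subgroup_is_group)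
  show ?thesis using assms H.group_comm_groupI by (auto simp: abelian_subgroup_def)
qed

text \<open>
  This is the only way in which the base field enters the pivot argument. The complex field satisfies it for every
  \<open>q\<close>, because a finite set of slopes cannot contain all multiples of \<open>v\<close>; the field with \<open>p\<close> elements satisfies it
  for \<open>q = p\<close>, because \<open>v\<close> generates its additive group.
\<close>
definition escapes :: "('a, 'm) ring_scheme \<Rightarrow> real \<Rightarrow> bool" where
  "escapes F q \<longleftrightarrow> (\<forall>U T v. finite U \<and> finite T \<and> U \<subseteq> carrier F \<and> T \<subseteq> carrier F \<and>
     v \<in> carrier F \<and> v \<noteq> \<zero>\<^bsub>F\<^esub> \<longrightarrow>
     (\<exists>n::nat. min (real (card U) * real (card T)) q
        \<le> 2 * real (card ((\<lambda>(u, t). u \<oplus>\<^bsub>F\<^esub> t \<otimes>\<^bsub>F\<^esub> ([n] \<cdot>\<^bsub>F\<^esub> v)) ` (U \<times> T)))))"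

context field
begin

text \<open>
  Call \<open>x\<close> a pivot if \<open>(u, t) \<mapsto> u \<oplus> t \<otimes> x\<close> is injective on \<open>U \<times> T\<close>. If \<open>x\<close> is not a pivot then
  \<open>(t2 \<ominus> t1) \<otimes> x = u1 \<ominus> u2\<close> for some \<open>t1 \<noteq> t2\<close>, so multiplication by \<open>t2 \<ominus> t1\<close> turns
  \<open>u \<oplus> t \<otimes> (x \<oplus> w)\<close> into an expression in \<open>U\<close>, \<open>T\<close> and \<open>w\<close> alone. Walking along the multiples of \<open>v\<close>
  from the non-pivot \<open>\<zero>\<close>, one either reaches a large image at a non-pivot, or the first pivot.
\<close>
lemma pivot:
  assumes esc: "escapes R q" and fin: "finite U" "finite T" and sub: "U \<subseteq> carrier R" "T \<subseteq> carrier R"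
    and v: "v \<in> U" "v \<noteq> \<zero>" and T: "r1 \<in> T" "r2 \<in> T" "r1 \<noteq> r2"
  obtains t1 t2 u1 u2 w where "t1 \<in> T" "t2 \<in> T" "u1 \<in> U" "u2 \<in> U" "w = \<zero> \<or> w = v"
    "min (real (card U) * real (card T)) q \<le> 2 * real (card
      ((\<lambda>(u, t). ((t2 \<ominus> t1) \<otimes> u \<oplus> t \<otimes> (u1 \<ominus> u2)) \<oplus> t \<otimes> ((t2 \<ominus> t1) \<otimes> w)) ` (U \<times> T)))"
proof -
  note result = that
  \<comment> \<open>\<open>P x\<close> says that \<open>x\<close> is not a pivot, and its witnesses
    are what eliminates \<open>x\<close> later.\<close>
  define P where "P x \<longleftrightarrow> (\<exists>t1\<in>T. \<exists>t2\<in>T. \<exists>u1\<in>U. \<exists>u2\<in>U. t1 \<noteq> t2 \<and> (t2 \<ominus> t1) \<otimes> x = u1 \<ominus> u2)" for x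
  define f where "f x = (\<lambda>(u, t). u \<oplus> t \<otimes> x)" for x
  have vc: "v \<in> carrier R" using v sub by auto
  have inj: "inj_on (f x) (U \<times> T)" if "\<not> P x" "x \<in> carrier R" for x
  proof (rule inj_onI, clarsimp simp: f_def)
    fix u t u' t' assume *: "u \<in> U" "t \<in> T" "u' \<in> U" "t' \<in> T" "u \<oplus> t \<otimes> x = u' \<oplus> t' \<otimes> x"
    have car: "u \<in> carrier R" "t \<in> carrier R" "u' \<in> carrier R" "t' \<in> carrier R" using * sub by auto
    have "(t' \<ominus> t) \<otimes> x = (u' \<oplus> t' \<otimes> x) \<ominus> u' \<ominus> t \<otimes> x"
      using car that(2) by algebra
    also have "\<dots> = u \<ominus> u'" unfolding *(5)[symmetric] using car that(2) by algebra
    finally have "t = t'" using that(1) * by (auto simp: P_def)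
    then show "u = u' \<and> t = t'" using *(5) car that(2) by simp
  qed
  \<comment> \<open>Scaling by the nonzero t2 - t1 preserves the size of the image at
    \<open>x \<oplus> w\<close> and replaces \<open>x\<close> by a difference from \<open>U\<close>;
    this yields the expression in the conclusion.\<close>
  have main: thesis if x: "x \<in> carrier R" "P x" and w: "w = \<zero> \<or> w = v"
    and big: "min (real (card U) * real (card T)) q \<le> 2 * real (card (f (x \<oplus> w) ` (U \<times> T)))" for x w
  proof -
    have wc: "w \<in> carrier R" using w vc by auto
    obtain t1 t2 u1 u2 where *: "t1 \<in> T" "t2 \<in> T" "u1 \<in> U" "u2 \<in> U" "t1 \<noteq> t2"
      "(t2 \<ominus> t1) \<otimes> x = u1 \<ominus> u2"
      using x(2) unfolding P_def by blast
    have car: "t1 \<in> carrier R" "t2 \<in> carrier R" "u1 \<in> carrier R" "u2 \<in> carrier R" using * sub by auto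
    have ne: "t2 \<ominus> t1 \<noteq> \<zero>" using *(5) car by (metis r_right_minus_eq)
    have "((t2 \<ominus> t1) \<otimes> u \<oplus> t \<otimes> (u1 \<ominus> u2)) \<oplus> t \<otimes> ((t2 \<ominus> t1) \<otimes> w) = (t2 \<ominus> t1) \<otimes> (u \<oplus> t \<otimes> (x \<oplus> w))"
      if "u \<in> carrier R" "t \<in> carrier R" for u t
      unfolding *(6)[symmetric] using that car wc x(1) by algebra
    then have "(\<lambda>(u, t). ((t2 \<ominus> t1) \<otimes> u \<oplus> t \<otimes> (u1 \<ominus> u2)) \<oplus> t \<otimes> ((t2 \<ominus> t1) \<otimes> w)) ` (U \<times> T)
        = (\<lambda>y. (t2 \<ominus> t1) \<otimes> y) ` f (x \<oplus> w) ` (U \<times> T)"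
      unfolding image_image using sub by (intro image_cong refl) (auto simp: f_def)
    also have "card \<dots> = card (f (x \<oplus> w) ` (U \<times> T))"
    proof (rule card_image, rule inj_onI)
      fix y z assume yz: "y \<in> f (x \<oplus> w) ` (U \<times> T)" "z \<in> f (x \<oplus> w) ` (U \<times> T)"
        "(t2 \<ominus> t1) \<otimes> y = (t2 \<ominus> t1) \<otimes> z"
      have "y \<in> carrier R" "z \<in> carrier R" using yz(1,2) sub x wc by (auto simp: f_def)
      then show "y = z" using yz(3) ne car m_lcancel by simp
    qed
    finally have "card ((\<lambda>(u, t). ((t2 \<ominus> t1) \<otimes> u \<oplus> t \<otimes> (u1 \<ominus> u2)) \<oplus> t \<otimes> ((t2 \<ominus> t1) \<otimes> w)) ` (U \<times> T))
      = card (f (x \<oplus> w) ` (U \<times> T))" .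
    with result[OF *(1-4) w] big show thesis by simp
  qed
  obtain n :: nat where n: "min (real (card U) * real (card T)) q \<le> 2 * real (card (f ([n] \<cdot> v) ` (U \<times> T)))"
    using esc fin sub v(2) vc unfolding escapes_def f_def by blast
  show thesis
  proof (cases "P ([n] \<cdot> v)")
    case True
    then show thesis using n vc by (intro main[of "[n] \<cdot> v" \<zero>]) auto
  next
    case False
    \<comment> \<open>Now the large image sits at a pivot. As 0 is not a pivot, some consecutive
      multiples pass from a non-pivot to a pivot. At the pivot the map is injective, and
      \<open>w = v\<close> accounts for the last step.\<close>
    have "P ([(0::nat)] \<cdot> v)"
    proof -
      have "(r2 \<ominus> r1) \<otimes> ([(0::nat)] \<cdot> v) = v \<ominus> v"
        using T sub vc by (auto simp: subset_iff a_minus_def r_neg)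
      then show ?thesis using T v unfolding P_def by blast
    qed
    with False obtain m where m: "P ([m] \<cdot> v)" "\<not> P ([Suc m] \<cdot> v)"
      using nat_induct[of "\<lambda>k. P ([k] \<cdot> v)" n] by blast
    have S: "[Suc m] \<cdot> v = [m] \<cdot> v \<oplus> v" using vc by (simp add: add.nat_pow_Suc)
    have "card (f ([m] \<cdot> v \<oplus> v) ` (U \<times> T)) = card (U \<times> T)"
      using m(2) vc S by (intro card_image inj) auto
    then have "real (card (f ([m] \<cdot> v \<oplus> v) ` (U \<times> T))) = real (card U) * real (card T)"
      by (simp add: card_cartesian_product)
    moreover have "min (real (card U) * real (card T)) q \<le> 2 * (real (card U) * real (card T))"
      by (intro min.coboundedI1) simp
    ultimately show thesis
      using m(1) vc by (intro main[of "[m] \<cdot> v" v]) auto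
  qed
qed

end

subsection \<open>The affine group\<close>

locale affine_group = field R for R (structure)
begin

sublocale A: group "Aff R"
  by (rule group_Aff) unfold_locales

abbreviation amult (infixl "\<star>" 70) where "g \<star> h \<equiv> g \<otimes>\<^bsub>Aff R\<^esub> h"
abbreviation ainv where "ainv g \<equiv> inv\<^bsub>Aff R\<^esub> g"

text \<open>Elements of the group are functions, so the linear coefficient is read off from the
  values at 0 and 1; the constant coefficient is the value at 0.\<close>

definition slope :: "('a \<Rightarrow> 'a) \<Rightarrow> 'a" where
  "slope g = g \<one> \<ominus> g \<zero>"

lemma Aff_cases:
  assumes "g \<in> carrier (Aff R)"
  obtains a b where "g = affine_map R a b" "a \<in> carrier R" "b \<in> carrier R" "a \<noteq> \<zero>"
  using assms by (auto simp: Aff_def)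

lemma affine_map_mem: "a \<in> carrier R \<Longrightarrow> b \<in> carrier R \<Longrightarrow> a \<noteq> \<zero> \<Longrightarrow> affine_map R a b \<in> carrier (Aff R)"
  by (auto simp: Aff_def)

lemma slope_affine_map [simp]: "a \<in> carrier R \<Longrightarrow> b \<in> carrier R \<Longrightarrow> slope (affine_map R a b) = a"
  by (simp add: slope_def affine_map_def a_minus_def a_assoc r_neg)

lemma affine_map_zero [simp]: "a \<in> carrier R \<Longrightarrow> b \<in> carrier R \<Longrightarrow> affine_map R a b \<zero> = b"
  by (simp add: affine_map_def)

lemma affine_map_mult:
  assumes "a \<in> carrier R" "b \<in> carrier R" "c \<in> carrier R" "d \<in> carrier R" "a \<noteq> \<zero>" "c \<noteq> \<zero>"
  shows "affine_map R a b \<star> affine_map R c d = affine_map R (a \<otimes> c) (a \<otimes> d \<oplus> b)"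
  using assms affine_map_in_Bij[OF field_axioms] compose_affine_map[OF field_axioms]
  by (simp add: Aff_def BijGroup_def)

lemma Aff_eq_affine_map:
  assumes "g \<in> carrier (Aff R)"
  shows "g = affine_map R (slope g) (g \<zero>)"
  using assms by (auto elim: Aff_cases)

lemma Aff_closed: "g \<in> carrier (Aff R) \<Longrightarrow> x \<in> carrier R \<Longrightarrow> g x \<in> carrier R"
  by (auto elim!: Aff_cases simp: affine_map_def)

lemma Aff_apply:
  assumes "g \<in> carrier (Aff R)" "x \<in> carrier R"
  shows "g x = slope g \<otimes> x \<oplus> g \<zero>"
proof -
  have "g x = affine_map R (slope g) (g \<zero>) x" using Aff_eq_affine_map[OF assms(1)] by (rule fun_cong)
  then show ?thesis using assms(2) by (simp add: affine_map_def)
qed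

lemma Aff_inj_on:
  assumes "g \<in> carrier (Aff R)"
  shows "inj_on g (carrier R)"
proof -
  obtain a b where "g = affine_map R a b" "a \<in> carrier R" "b \<in> carrier R" "a \<noteq> \<zero>"
    using assms by (rule Aff_cases)
  then have "g \<in> Bij (carrier R)" using affine_map_in_Bij[OF field_axioms] by simp
  then show ?thesis by (simp add: Bij_def bij_betw_def)
qed

lemma slope_closed: "g \<in> carrier (Aff R) \<Longrightarrow> slope g \<in> carrier R"
  and slope_nonzero: "g \<in> carrier (Aff R) \<Longrightarrow> slope g \<noteq> \<zero>"
  by (auto elim: Aff_cases)

lemma Aff_eqI:
  assumes "g \<in> carrier (Aff R)" "h \<in> carrier (Aff R)" "slope g = slope h" "g \<zero> = h \<zero>"
  shows "g = h"
proof -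
  have "g = affine_map R (slope g) (g \<zero>)" by (rule Aff_eq_affine_map[OF assms(1)])
  also have "\<dots> = affine_map R (slope h) (h \<zero>)" unfolding assms(3,4) ..
  also have "\<dots> = h" by (rule Aff_eq_affine_map[OF assms(2), symmetric])
  finally show ?thesis .
qed

lemma slope_mult:
  assumes "g \<in> carrier (Aff R)" "h \<in> carrier (Aff R)"
  shows "slope (g \<star> h) = slope g \<otimes> slope h"
proof -
  obtain a b where g: "g = affine_map R a b" "a \<in> carrier R" "b \<in> carrier R" "a \<noteq> \<zero>"
    using assms(1) by (rule Aff_cases)
  obtain c d where h: "h = affine_map R c d" "c \<in> carrier R" "d \<in> carrier R" "c \<noteq> \<zero>"
    using assms(2) by (rule Aff_cases)
  from g h show ?thesis by (simp add: affine_map_mult)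
qed

lemma mult_apply:
  assumes "g \<in> carrier (Aff R)" "h \<in> carrier (Aff R)" "x \<in> carrier R"
  shows "(g \<star> h) x = g (h x)"
proof -
  have "g \<in> Bij (carrier R)" "h \<in> Bij (carrier R)"
    using assms affine_map_in_Bij[OF field_axioms] by (auto elim!: Aff_cases)
  then show ?thesis using assms(3) by (simp add: Aff_def BijGroup_def compose_def)
qed

lemma one_Aff: "\<one>\<^bsub>Aff R\<^esub> = affine_map R \<one> \<zero>"
  by (auto simp: Aff_def BijGroup_def affine_map_def)

lemma slope_one [simp]: "slope \<one>\<^bsub>Aff R\<^esub> = \<one>"
  by (simp add: one_Aff)

lemma one_apply: "x \<in> carrier R \<Longrightarrow> \<one>\<^bsub>Aff R\<^esub> x = x"
  by (simp add: one_Aff affine_map_def)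

lemma slope_inv_mult:
  assumes "g \<in> carrier (Aff R)" "h \<in> carrier (Aff R)" "slope g = slope h"
  shows "slope (ainv g \<star> h) = \<one>" "slope (g \<star> ainv h) = \<one>"
proof -
  have "slope (ainv g) \<otimes> slope g = \<one>"
    using assms(1) slope_mult[of "ainv g" g] by simp
  then show "slope (ainv g \<star> h) = \<one>" using assms by (simp add: slope_mult)
  have "slope h \<otimes> slope (ainv h) = \<one>"
    using assms(2) slope_mult[of h "ainv h"] by simp
  then show "slope (g \<star> ainv h) = \<one>" using assms by (simp add: slope_mult)
qed

definition transl :: "'a \<Rightarrow> 'a \<Rightarrow> 'a" where
  "transl u = affine_map R \<one> u"

lemma transl_mem: "u \<in> carrier R \<Longrightarrow> transl u \<in> carrier (Aff R)"
  by (simp add: transl_def affine_map_mem)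

lemma slope_transl [simp]: "u \<in> carrier R \<Longrightarrow> slope (transl u) = \<one>"
  by (simp add: transl_def)

lemma transl_zero [simp]: "u \<in> carrier R \<Longrightarrow> transl u \<zero> = u"
  by (simp add: transl_def)

lemma eq_transl:
  assumes "g \<in> carrier (Aff R)" "slope g = \<one>"
  shows "g = transl (g \<zero>)"
  using Aff_eq_affine_map[OF assms(1)] unfolding assms(2) transl_def .

lemma transl_add: "u \<in> carrier R \<Longrightarrow> w \<in> carrier R \<Longrightarrow> transl u \<star> transl w = transl (u \<oplus> w)"
  by (simp add: transl_def affine_map_mult a_comm)

lemma transl_minus: "u \<in> carrier R \<Longrightarrow> ainv (transl u) = transl (\<ominus> u)"
  by (rule A.inv_equality) (auto simp: transl_add transl_mem l_neg one_Aff[folded transl_def])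

lemma conj_transl:
  assumes "g \<in> carrier (Aff R)" "u \<in> carrier R"
  shows "g \<star> transl u \<star> ainv g = transl (slope g \<otimes> u)"
proof -
  obtain a b where g: "g = affine_map R a b" "a \<in> carrier R" "b \<in> carrier R" "a \<noteq> \<zero>"
    using assms(1) by (rule Aff_cases)
  have "g \<star> transl u = transl (slope g \<otimes> u) \<star> g"
    using g assms(2) by (simp add: transl_def affine_map_mult a_comm)
  then show ?thesis
    using assms by (simp add: A.m_assoc transl_mem slope_closed)
qed

definition transl_group :: "('a \<Rightarrow> 'a) set" where
  "transl_group = {g \<in> carrier (Aff R). slope g = \<one>}"

lemma abelian_transl_group: "abelian_subgroup (Aff R) transl_group"
proof (rule A.abelian_subgroupI)
  show "subgroup transl_group (Aff R)"
  proof (rule A.subgroupI)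
    fix g assume g: "g \<in> transl_group"
    then have "slope (ainv g \<star> \<one>\<^bsub>Aff R\<^esub>) = \<one>"
      by (intro slope_inv_mult(1)) (auto simp: transl_group_def)
    then show "ainv g \<in> transl_group" using g by (simp add: transl_group_def)
  next
    have "\<one>\<^bsub>Aff R\<^esub> \<in> transl_group" by (simp add: transl_group_def)
    then show "transl_group \<noteq> {}" by blast
  qed (auto simp: transl_group_def slope_mult)
  fix g h assume "g \<in> transl_group" "h \<in> transl_group"
  then have *: "g = transl (g \<zero>)" "h = transl (h \<zero>)" "g \<zero> \<in> carrier R" "h \<zero> \<in> carrier R"
    using Aff_closed unfolding transl_group_def by (blast intro: eq_transl)+
  have "transl (g \<zero>) \<star> transl (h \<zero>) = transl (h \<zero>) \<star> transl (g \<zero>)"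
    using *(3,4) by (simp add: transl_add a_comm)
  then show "g \<star> h = h \<star> g" by (simp only: *(1)[symmetric] *(2)[symmetric])
qed

definition stab :: "'a \<Rightarrow> ('a \<Rightarrow> 'a) set" where
  "stab c = {g \<in> carrier (Aff R). g c = c}"

lemma abelian_stab:
  assumes c: "c \<in> carrier R"
  shows "abelian_subgroup (Aff R) (stab c)"
proof (rule A.abelian_subgroupI)
  show "subgroup (stab c) (Aff R)"
  proof (rule A.subgroupI)
    fix g assume g: "g \<in> stab c"
    then have "(ainv g \<star> g) c = ainv g c" using c by (simp only: mult_apply stab_def A.inv_closed mem_Collect_eq)
    then show "ainv g \<in> stab c" using g c by (simp add: stab_def one_apply)
  next
    have "\<one>\<^bsub>Aff R\<^esub> \<in> stab c" using c by (simp add: stab_def one_apply)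
    then show "stab c \<noteq> {}" by blast
  qed (use c in \<open>auto simp: stab_def mult_apply\<close>)
  fix g h assume gh: "g \<in> stab c" "h \<in> stab c"
  have zero: "g \<zero> = c \<ominus> slope g \<otimes> c" if "g \<in> stab c" for g
  proof -
    have gc: "g \<in> carrier (Aff R)" "g \<zero> \<in> carrier R" "slope g \<in> carrier R"
      using that c Aff_closed slope_closed by (auto simp: stab_def)
    have "slope g \<otimes> c \<oplus> g \<zero> = c" using that c Aff_apply[OF gc(1) c] by (simp add: stab_def)
    then have "c \<ominus> slope g \<otimes> c = (slope g \<otimes> c \<oplus> g \<zero>) \<ominus> slope g \<otimes> c" by simp
    also have "\<dots> = g \<zero>" using gc c by algebra
    finally show ?thesis by simp
  qed
  have car: "g \<in> carrier (Aff R)" "h \<in> carrier (Aff R)" "slope g \<in> carrier R" "slope h \<in> carrier R"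
    using gh slope_closed by (auto simp: stab_def)
  have st: "g \<star> h \<in> stab c" "h \<star> g \<in> stab c" using gh c by (auto simp: stab_def mult_apply)
  have "slope (g \<star> h) = slope (h \<star> g)" using car by (simp add: slope_mult m_comm)
  then show "g \<star> h = h \<star> g"
    using car zero[OF st(1)] zero[OF st(2)] by (intro Aff_eqI) auto
qed

text \<open>A map x -> a x + b with a different from 1 has the unique fixed point b / (1 - a), and a
  map commuting with it permutes its fixed points.\<close>

lemma commuting_imp_stab:
  assumes g: "g \<in> carrier (Aff R)" "slope g \<noteq> \<one>"
  obtains c where "c \<in> carrier R" "\<And>h. h \<in> carrier (Aff R) \<Longrightarrow> g \<star> h = h \<star> g \<Longrightarrow> h \<in> stab c"
proof -
  define a where "a = slope g"
  define b where "b = g \<zero>"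
  have ab: "a \<in> carrier R" "b \<in> carrier R" "a \<noteq> \<one>"
    using g slope_closed Aff_closed by (auto simp: a_def b_def)
  have ne: "\<one> \<ominus> a \<noteq> \<zero>" using ab by (metis one_closed r_right_minus_eq)
  then have u: "\<one> \<ominus> a \<in> Units R" using ab field_Units by auto
  define c where "c = inv (\<one> \<ominus> a) \<otimes> b"
  have c: "c \<in> carrier R" using u ab by (simp add: c_def)
  have bc: "(\<one> \<ominus> a) \<otimes> c = b" using u ab by (simp add: c_def m_assoc[symmetric])
  have gx: "g x = a \<otimes> x \<oplus> b" if "x \<in> carrier R" for x
    using that g Aff_apply by (simp add: a_def b_def)
  have fix_c: "g c = c" unfolding gx[OF c] bc[symmetric] using ab c by algebra
  have uniq: "x = c" if x: "x \<in> carrier R" "g x = x" for x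
  proof -
    have "(\<one> \<ominus> a) \<otimes> x = (a \<otimes> x \<oplus> b) \<ominus> a \<otimes> x"
      using x gx[OF x(1)] ab by (simp add: a_minus_def l_distr l_minus)
    also have "\<dots> = b" using x ab by algebra
    finally show ?thesis using m_lcancel[OF ne, of x c] bc c x ab by simp
  qed
  have "h \<in> stab c" if h: "h \<in> carrier (Aff R)" "g \<star> h = h \<star> g" for h
  proof -
    have "g (h c) = (g \<star> h) c" using h(1) g c by (simp only: mult_apply)
    also have "\<dots> = h (g c)" unfolding h(2) using h(1) g c by (simp only: mult_apply)
    finally have "g (h c) = h (g c)" .
    then have "g (h c) = h c" unfolding fix_c .
    then have "h c = c" by (rule uniq[OF Aff_closed[OF h(1) c]])
    then show ?thesis using h by (simp add: stab_def)
  qed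
  with c that show thesis by blast
qed


text \<open>Unless \<open>D\<close> lies in one abelian subgroup, the pivot argument places at least
  half of min(|D|, q) translations in the 36-fold product set. Multiplied by one element of each
  slope they stay distinct within the 37-fold one, so there are at most 2 K^2 slopes. The most
  frequent slope gives a coset of the translations.\<close>

lemma abelian_coset_of_small_growth:
  fixes K q :: real
  assumes D: "D \<subseteq> carrier (Aff R)" "finite D" "\<one>\<^bsub>Aff R\<^esub> \<in> D" and Dinv: "\<And>x. x \<in> D \<Longrightarrow> ainv x \<in> D"
    and K: "1 \<le> K" and growth: "real (card (A.setpow D 37)) \<le> K * real (card D)"
    and q: "real (card D) \<le> K * q" and esc: "escapes R q"
  shows "\<exists>g H. g \<in> carrier (Aff R) \<and> abelian_subgroup (Aff R) H \<and>
    real (card D) \<le> 2 * K\<^sup>2 * real (card (D \<inter> (g <#\<^bsub>Aff R\<^esub> H)))"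
proof -
  have whole: ?thesis if "abelian_subgroup (Aff R) H" "D \<subseteq> H" for H
  proof -
    have "H \<subseteq> carrier (Aff R)" using that(1) by (auto simp: abelian_subgroup_def subgroup_def)
    then have "D \<inter> (\<one>\<^bsub>Aff R\<^esub> <#\<^bsub>Aff R\<^esub> H) = D" using that(2) by (auto simp: A.lcos_mult_one)
    moreover have "1 \<le> K\<^sup>2" using K by simp
    then have "real (card D) * 1 \<le> real (card D) * (2 * K\<^sup>2)" by (intro mult_left_mono) linarith+
    ultimately show ?thesis using that(1) by (intro exI[of _ "\<one>\<^bsub>Aff R\<^esub>"] exI[of _ H]) (auto simp: mult.commute)
  qed
  define P where "P n = A.setpow D n" for n
  have Pc: "P n \<subseteq> carrier (Aff R)" for n using A.setpow_closed[OF D(1)] by (simp add: P_def)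
  have Pf: "finite (P n)" for n using A.finite_setpow[OF D(2)] by (simp add: P_def)
  have Pmono: "P m \<subseteq> P n" if "m \<le> n" for m n using A.setpow_mono[OF D(1,3) that] by (simp add: P_def)
  have Pmult: "x \<star> y \<in> P k" if "x \<in> P m" "y \<in> P n" "k = m + n" for x y k m n
    using A.mult_mem_setpow[OF D(1)] that by (simp add: P_def)
  have Pinv: "ainv x \<in> P n" if "x \<in> P n" for x n
    using A.inv_mem_setpow[OF D(1) Dinv] that by (simp add: P_def)
  have DP: "x \<in> P 1" if "x \<in> D" for x using A.mem_setpow_1[OF D(1) that] by (simp add: P_def)
  define W where "W n = {u \<in> carrier R. transl u \<in> P n}" for n
  define T where "T = slope ` D"
  have T: "finite T" "T \<subseteq> carrier R" using D slope_closed by (auto simp: T_def)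
  have Wc: "W n \<subseteq> carrier R" for n by (auto simp: W_def)
  have Wf: "finite (W n)" for n
  proof (rule finite_subset)
    show "W n \<subseteq> (\<lambda>g. g \<zero>) ` P n" by (auto simp: W_def intro!: rev_image_eqI)
  qed (simp add: Pf)
  have Wadd: "x \<oplus> y \<in> W k" if "x \<in> W m" "y \<in> W n" "k = m + n" for x y k m n
    using that Pmult[of "transl x" m "transl y" n k] by (auto simp: W_def transl_add)
  have Wneg: "\<ominus> x \<in> W n" if "x \<in> W n" for x n
    using that Pinv[of "transl x" n] by (auto simp: W_def transl_minus)
  \<comment> \<open>Conjugation multiplies a translation by the slope, at the price of two factors
    from \<open>D\<close>.\<close>
  have Wmul: "t \<otimes> x \<in> W (n + 2)" if tx: "t \<in> T" "x \<in> W n" for t x n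
  proof -
    obtain h where h: "h \<in> D" "t = slope h" using tx by (auto simp: T_def)
    have "h \<star> transl x \<star> ainv h \<in> P (n + 2)"
      using that h DP[OF h(1)] Pinv[OF DP[OF h(1)]]
      by (intro Pmult[of _ "n + 1" _ 1] Pmult[of _ 1 _ n]) (auto simp: W_def)
    then show ?thesis using that h D slope_closed by (auto simp: W_def conj_transl subset_iff)
  qed
  have transl_quot: "x \<star> ainv y = transl ((x \<star> ainv y) \<zero>)" "(x \<star> ainv y) \<zero> \<in> W 2"
    if "x \<in> D" "y \<in> D" "slope x = slope y" for x y
  proof -
    have car: "x \<in> carrier (Aff R)" "y \<in> carrier (Aff R)" using that D by auto
    have "slope (x \<star> ainv y) = \<one>" using car that by (intro slope_inv_mult(2))
    then show e: "x \<star> ainv y = transl ((x \<star> ainv y) \<zero>)"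
      using car by (intro eq_transl) auto
    have "x \<star> ainv y \<in> P 2"
      using DP[OF that(1)] Pinv[OF DP[OF that(2)]] by (intro Pmult[of _ 1 _ 1]) auto
    then have "transl ((x \<star> ainv y) \<zero>) \<in> P 2" by (simp only: e[symmetric])
    moreover have "(x \<star> ainv y) \<zero> \<in> carrier R" using car by (intro Aff_closed[of "x \<star> ainv y"]) auto
    ultimately show "(x \<star> ainv y) \<zero> \<in> W 2" by (simp add: W_def)
  qed
  define sec where "sec t = (SOME d. d \<in> D \<and> slope d = t)" for t
  have sec: "sec t \<in> D \<and> slope (sec t) = t" if "t \<in> T" for t
  proof -
    have "\<exists>d. d \<in> D \<and> slope d = t" using that by (auto simp: T_def)
    from someI_ex[OF this] show ?thesis by (simp add: sec_def)
  qed
  \<comment> \<open>In a product of a translation and the chosen element of slope \<open>t\<close>,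
    the slope reveals \<open>t\<close>, and cancellation reveals the translation.\<close>
  have N: "card (W 36) * card T \<le> card (P 37)"
  proof -
    have "inj_on (\<lambda>(u, t). transl u \<star> sec t) (W 36 \<times> T)"
    proof (rule inj_onI, clarsimp)
      fix u t u' t' assume *: "u \<in> W 36" "t \<in> T" "u' \<in> W 36" "t' \<in> T" "transl u \<star> sec t = transl u' \<star> sec t'"
      have car: "u \<in> carrier R" "u' \<in> carrier R" "sec t \<in> carrier (Aff R)" "sec t' \<in> carrier (Aff R)"
        using * sec D by (auto simp: W_def)
      have "slope (transl u \<star> sec t) = slope (transl u' \<star> sec t')" using *(5) by simp
      then have tt: "t = t'" using car sec *(2,4) T(2) by (simp add: slope_mult transl_mem subset_iff)
      then have "transl u = transl u'" using *(5) car transl_mem by (simp add: A.r_cancel)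
      then show "u = u' \<and> t = t'" using tt car by (metis transl_zero)
    qed
    moreover have "(\<lambda>(u, t). transl u \<star> sec t) ` (W 36 \<times> T) \<subseteq> P 37"
      using sec DP by (auto simp: W_def intro!: Pmult[of _ 36 _ 1])
    ultimately show ?thesis
      using card_inj_on_le[of _ "W 36 \<times> T" "P 37"] Pf by (simp add: card_cartesian_product)
  qed
  \<comment> \<open>An element is determined by its slope and by the translation that leads to it
    from the chosen element of that slope.\<close>
  have U: "card D \<le> card (W 4) * card T"
  proof -
    have "inj_on (\<lambda>d. ((d \<star> ainv (sec (slope d))) \<zero>, slope d)) D"
    proof (rule inj_onI)
      fix x y assume xy: "x \<in> D" "y \<in> D"
        "((x \<star> ainv (sec (slope x))) \<zero>, slope x) = ((y \<star> ainv (sec (slope y))) \<zero>, slope y)"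
      then have *: "x \<in> D" "y \<in> D" "(x \<star> ainv (sec (slope x))) \<zero> = (y \<star> ainv (sec (slope x))) \<zero>"
        "slope x = slope y" by auto
      have tx: "slope x \<in> T" using * by (auto simp: T_def)
      have s: "sec (slope x) \<in> D" "slope (sec (slope x)) = slope x" using sec[OF tx] by auto
      have "x \<star> ainv (sec (slope x)) = y \<star> ainv (sec (slope x))"
        using transl_quot(1)[of x "sec (slope x)"] transl_quot(1)[of y "sec (slope x)"] * s by metis
      then show "x = y" using * s D by (auto simp: A.r_cancel subset_iff)
    qed
    moreover have "(\<lambda>d. ((d \<star> ainv (sec (slope d))) \<zero>, slope d)) ` D \<subseteq> W 4 \<times> T"
    proof clarsimp
      fix d assume d: "d \<in> D"
      then have "slope d \<in> T" by (auto simp: T_def)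
      then show "(d \<star> ainv (sec (slope d))) \<zero> \<in> W 4 \<and> slope d \<in> T"
        using transl_quot(2)[of d "sec (slope d)"] sec d Pmono[of 2 4] by (auto simp: W_def)
    qed
    ultimately show ?thesis
      using card_inj_on_le[of _ D "W 4 \<times> T"] Wf T(1) by (simp add: card_cartesian_product)
  qed
  have "D \<noteq> {}" using D(3) by auto
  then have cD: "0 < real (card D)" using D(2) by (simp add: card_gt_0_iff)
  show ?thesis
  proof (cases "T \<subseteq> {\<one>}")
    case True
    then have "D \<subseteq> transl_group" using D(1) by (auto simp: T_def transl_group_def)
    then show ?thesis using whole abelian_transl_group by blast
  next
    case T_ne: False
    then obtain g where g: "g \<in> D" "slope g \<noteq> \<one>" by (auto simp: T_def)
    show ?thesis
    proof (cases "W 4 \<subseteq> {\<zero>}")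
      case True
      \<comment> \<open>The index 4 is the length of g h (h g)^-1, which is always a translation. If
        \<open>W 4\<close> is trivial, all of \<open>D\<close> commutes with the non-translation
        \<open>g\<close> and so fixes its fixed point.\<close>
      have comm: "g \<star> h = h \<star> g" if h: "h \<in> D" for h
      proof -
        have car: "g \<in> carrier (Aff R)" "h \<in> carrier (Aff R)" using g h D by auto
        define k where "k = g \<star> h \<star> ainv (h \<star> g)"
        have kc: "k \<in> carrier (Aff R)" using car by (simp add: k_def)
        have "slope (g \<star> h) = slope (h \<star> g)" using car slope_closed by (simp add: slope_mult m_comm)
        then have "slope k = \<one>" unfolding k_def using car by (intro slope_inv_mult(2)) auto
        with kc have kt: "k = transl (k \<zero>)" by (rule eq_transl)
        have "g \<star> h \<in> P 2" "h \<star> g \<in> P 2" using DP[OF g(1)] DP[OF h] by (auto intro: Pmult[of _ 1 _ 1])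
        then have "k \<in> P 4" unfolding k_def by (intro Pmult[of "g \<star> h" 2 "ainv (h \<star> g)" 2] Pinv) auto
        then have "transl (k \<zero>) \<in> P 4" by (simp only: kt[symmetric])
        then have "k \<zero> \<in> W 4" using Aff_closed[OF kc] by (simp add: W_def)
        then have "k \<zero> = \<zero>" using True by auto
        then have "transl (k \<zero>) = \<one>\<^bsub>Aff R\<^esub>" by (simp add: transl_def one_Aff)
        then have "k = \<one>\<^bsub>Aff R\<^esub>" by (simp only: kt[symmetric])
        then have "k \<star> (h \<star> g) = h \<star> g" using car by simp
        then show ?thesis using car by (simp add: k_def A.m_assoc)
      qed
      obtain c where c: "c \<in> carrier R" "\<And>h. h \<in> carrier (Aff R) \<Longrightarrow> g \<star> h = h \<star> g \<Longrightarrow> h \<in> stab c"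
        using commuting_imp_stab g D by blast
      then have "D \<subseteq> stab c" using comm D by auto
      then show ?thesis using whole abelian_stab[OF c(1)] by blast
    next
      case False
      then obtain v where v: "v \<in> W 4" "v \<noteq> \<zero>" by auto
      have T1: "\<one> \<in> T" "slope g \<in> T" using D(3) g(1) by (force simp: T_def)+
      obtain t1 t2 u1 u2 w where tu: "t1 \<in> T" "t2 \<in> T" "u1 \<in> W 4" "u2 \<in> W 4" "w = \<zero> \<or> w = v"
        and big: "min (real (card (W 4)) * real (card T)) q \<le> 2 * real (card
          ((\<lambda>(u, t). ((t2 \<ominus> t1) \<otimes> u \<oplus> t \<otimes> (u1 \<ominus> u2)) \<oplus> t \<otimes> ((t2 \<ominus> t1) \<otimes> w)) ` (W 4 \<times> T)))"
        by (rule pivot[OF esc Wf T(1) Wc T(2) v T1 g(2)[symmetric]])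
      have "transl \<zero> \<in> P 0" by (simp add: P_def one_Aff transl_def)
      then have w: "w \<in> W 4" using tu(5) v(1) Pmono[of 0 4] by (auto simp: W_def)
      have diff: "(t2 \<ominus> t1) \<otimes> u \<in> W 12" if "u \<in> W 4" for u
      proof -
        have "u \<in> carrier R" using that Wc by auto
        then have "(t2 \<ominus> t1) \<otimes> u = t2 \<otimes> u \<oplus> \<ominus> (t1 \<otimes> u)"
          using tu T(2) by (auto simp: a_minus_def l_distr l_minus subset_iff)
        then show ?thesis
          using Wadd[OF Wmul[OF tu(2) that] Wneg[OF Wmul[OF tu(1) that]], of 12] by simp
      qed
      \<comment> \<open>36 = 12 + 10 + 14: a difference of slopes acting on \<open>W 4\<close> costs
        2 * 6, a slope acting on a difference from \<open>W 4\<close> costs 8 + 2, and a further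
        slope acting on the first kind costs 12 + 2.\<close>
      have "((t2 \<ominus> t1) \<otimes> u \<oplus> t \<otimes> (u1 \<ominus> u2)) \<oplus> t \<otimes> ((t2 \<ominus> t1) \<otimes> w) \<in> W 36"
        if "u \<in> W 4" "t \<in> T" for u t
      proof (rule Wadd[of _ 22 _ 14], rule Wadd[of _ 12 _ 10])
        show "(t2 \<ominus> t1) \<otimes> u \<in> W 12" by (rule diff) fact
        have "u1 \<ominus> u2 \<in> W 8" unfolding a_minus_def using tu by (intro Wadd[of _ 4 _ 4] Wneg) auto
        then show "t \<otimes> (u1 \<ominus> u2) \<in> W 10" using Wmul[OF that(2), of _ 8] by simp
        show "t \<otimes> ((t2 \<ominus> t1) \<otimes> w) \<in> W 14" using Wmul[OF that(2) diff[OF w]] by simp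
      qed auto
      then have "card ((\<lambda>(u, t). ((t2 \<ominus> t1) \<otimes> u \<oplus> t \<otimes> (u1 \<ominus> u2)) \<oplus> t \<otimes> ((t2 \<ominus> t1) \<otimes> w)) ` (W 4 \<times> T))
          \<le> card (W 36)"
        using Wf by (intro card_mono) auto
      with big have "min (real (card (W 4)) * real (card T)) q \<le> 2 * real (card (W 36))" by linarith
      moreover have "real (card D) \<le> real (card (W 4)) * real (card T)"
        using U by (metis of_nat_le_iff of_nat_mult)
      ultimately have "min (real (card D)) q \<le> 2 * real (card (W 36))" by linarith
      from mult_right_mono[OF this, of "real (card T)"]
      have "min (real (card D)) q * real (card T) \<le> 2 * (real (card (W 36)) * real (card T))" by simp
      moreover have "real (card (W 36)) * real (card T) \<le> K * real (card D)"
        using N growth unfolding P_def by (metis of_nat_le_iff of_nat_mult order_trans)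
      ultimately have mT: "min (real (card D)) q * real (card T) \<le> 2 * K * real (card D)" by linarith
      \<comment> \<open>By the hypothesis on \<open>q\<close>, one more factor \<open>K\<close>
        replaces min(|D|, q) by |D|; this is why \<open>K\<close> enters squared.\<close>
      have "1 * real (card D) \<le> K * real (card D)" using K by (intro mult_right_mono) auto
      then have "real (card D) \<le> K * min (real (card D)) q" using q by (simp add: min_def)
      from mult_right_mono[OF this, of "real (card T)"]
      have "real (card D) * real (card T) \<le> K * (min (real (card D)) q * real (card T))" by (simp add: mult.assoc)
      also have "\<dots> \<le> K * (2 * K * real (card D))" using mT K by (intro mult_left_mono) auto
      finally have "real (card D) * real (card T) \<le> real (card D) * (2 * K\<^sup>2)"
        by (simp add: power2_eq_square algebra_simps)
      then have cT: "real (card T) \<le> 2 * K\<^sup>2" using cD by simp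
      have "\<exists>t\<in>T. real (card D) \<le> real (card T) * real (card {d \<in> D. slope d = t})"
      proof (rule ccontr)
        assume "\<not> ?thesis"
        then have "(\<Sum>t\<in>T. real (card T) * real (card {d \<in> D. slope d = t})) < (\<Sum>t\<in>T. real (card D))"
          using T(1) T1 by (intro sum_strict_mono) (auto simp: not_le)
        moreover have "(\<Sum>t\<in>T. real (card {d \<in> D. slope d = t})) = real (card D)"
          using sum.image_gen[OF D(2), of "\<lambda>_. 1 :: real" slope] by (simp add: T_def)
        ultimately show False by (simp add: sum_distrib_left[symmetric])
      qed
      then obtain t where t: "t \<in> T" "real (card D) \<le> real (card T) * real (card {d \<in> D. slope d = t})"
        by blast
      have st: "sec t \<in> carrier (Aff R)" "slope (sec t) = t" using sec[OF t(1)] D by auto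
      have "{d \<in> D. slope d = t} \<subseteq> D \<inter> (sec t <#\<^bsub>Aff R\<^esub> transl_group)"
      proof
        fix d assume d: "d \<in> {d \<in> D. slope d = t}"
        then have dc: "d \<in> carrier (Aff R)" using D by auto
        have "slope (ainv (sec t) \<star> d) = \<one>" using d dc st by (intro slope_inv_mult(1)) auto
        then have "ainv (sec t) \<star> d \<in> transl_group" using dc st by (simp add: transl_group_def)
        moreover have "d = sec t \<star> (ainv (sec t) \<star> d)" using dc st by (simp add: A.m_assoc[symmetric])
        ultimately show "d \<in> D \<inter> (sec t <#\<^bsub>Aff R\<^esub> transl_group)" using d by (auto simp: l_coset_def)
      qed
      then have "real (card {d \<in> D. slope d = t}) \<le> real (card (D \<inter> (sec t <#\<^bsub>Aff R\<^esub> transl_group)))"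
        using D(2) by (intro of_nat_mono card_mono) auto
      then have "real (card D) \<le> 2 * K\<^sup>2 * real (card (D \<inter> (sec t <#\<^bsub>Aff R\<^esub> transl_group)))"
        using t(2) cT by (meson mult_mono' of_nat_0_le_iff order_trans)
      then show ?thesis using st(1) abelian_transl_group by blast
    qed
  qed
qed

end

subsection \<open>Energy and overlaps in the affine group\<close>

lemma card_offdiag:
  assumes "finite Z"
  shows "real (card {(y, y'). y \<in> Z \<and> y' \<in> Z \<and> y \<noteq> y'}) = (real (card Z))\<^sup>2 - real (card Z)"
proof -
  have "card (Z \<times> Z) = card ({(y, y'). y \<in> Z \<and> y' \<in> Z \<and> y \<noteq> y'} \<union> (\<lambda>y. (y, y)) ` Z)"
    by (rule arg_cong[where f = card]) auto
  also have "\<dots> = card {(y, y'). y \<in> Z \<and> y' \<in> Z \<and> y \<noteq> y'} + card ((\<lambda>y. (y, y)) ` Z)"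
  proof (rule card_Un_disjoint)
    show "finite {(y, y'). y \<in> Z \<and> y' \<in> Z \<and> y \<noteq> y'}"
      by (rule finite_subset[of _ "Z \<times> Z"]) (use assms in auto)
  qed (use assms in auto)
  also have "card ((\<lambda>y. (y, y)) ` Z) = card Z" by (rule card_image) (auto simp: inj_on_def)
  finally have "card Z * card Z = card {(y, y'). y \<in> Z \<and> y' \<in> Z \<and> y \<noteq> y'} + card Z"
    by (simp add: card_cartesian_product)
  from arg_cong[OF this, of real] show ?thesis by (simp add: power2_eq_square)
qed

context affine_group
begin

text \<open>The popular left quotients of the set \<open>M\<close> from Balog-Szemeredi-Gowers
  satisfy the growth hypothesis, and \<open>popular_quotients_coset\<close> carries the coset found
  there back to \<open>M\<close> and so to \<open>A\<close>.\<close>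

lemma abelian_coset_of_large_energy:
  fixes L q :: real
  assumes A: "A \<subseteq> carrier (Aff R)" "finite A" "A \<noteq> {}" and L: "1 \<le> L"
    and energy: "real (card A) ^ 3 \<le> L * real (card (A.rcoll A))"
    and q: "real (card A) \<le> L * q" and esc: "escapes R q"
  shows "\<exists>g H. g \<in> carrier (Aff R) \<and> abelian_subgroup (Aff R) H \<and>
    real (card A) \<le> (2 ^ 24 * L ^ 10) ^ 231 * real (card (A \<inter> (g <#\<^bsub>Aff R\<^esub> H)))"
proof -
  define L1 where "L1 = 2 ^ 24 * L ^ 10"
  obtain M where M: "M \<subseteq> A" "real (card A) \<le> 8 * L * real (card M)"
    "real (card (M <#>\<^bsub>Aff R\<^esub> m_inv (Aff R) ` M)) \<le> L1 * real (card M)"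
    using A.balog_szemeredi_gowers[OF A L energy] unfolding L1_def by blast
  have L10: "1 \<le> L ^ 10" using L by simp
  have "L * 1 \<le> L * L ^ 9" using L by (intro mult_left_mono) auto
  then have LL: "64 * L \<le> L1" using L10 by (simp add: L1_def power_Suc[symmetric])
  have L1: "64 \<le> L1" "0 < L1" using LL L by linarith+
  define m where "m = real (card M)"
  have "M \<noteq> {}"
  proof
    assume "M = {}"
    then have "card A = 0" using M(2) by simp
    then show False using A by simp
  qed
  have Mf: "finite M" "M \<subseteq> carrier (Aff R)" using M A finite_subset by blast+
  have m: "0 < m" using \<open>M \<noteq> {}\<close> Mf by (simp add: m_def card_gt_0_iff)
  define t where "t = m / (2 * L1)"
  have t: "0 < t" using m L1 by (simp add: t_def)
  define D where "D = A.popular_quotients M t"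
  have Dc: "D \<subseteq> carrier (Aff R)" by (auto simp: D_def A.popular_quotients_def)
  have Df: "finite D" using A.finite_popular_quotients[OF Mf(1) t] by (simp add: D_def)
  have "m / (2 * L1) \<le> m / 1" using m L1 by (intro divide_left_mono) auto
  then have D1: "\<one>\<^bsub>Aff R\<^esub> \<in> D"
    unfolding D_def by (intro A.one_mem_popular_quotients Mf) (simp add: t_def m_def)
  have Dinv: "ainv x \<in> D" if "x \<in> D" for x
    using A.inv_mem_popular_quotients[OF Mf(2)] that by (simp add: D_def)
  have mD: "m \<le> 2 * L1 * real (card D)"
    using A.card_popular_quotients_ge[OF Mf(2,1) \<open>M \<noteq> {}\<close> L1(2) M(3)] by (simp add: m_def D_def t_def)
  \<comment> \<open>38 = 37 + 1: the growth estimate compares the 37-fold product set with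
    \<open>M\<close>, and one more factor compares \<open>M\<close> with \<open>D\<close>.\<close>
  define Q where "Q = (2 * L1\<^sup>2) ^ 38"
  have base: "2 * L1 \<le> 2 * L1\<^sup>2" "1 \<le> 2 * L1\<^sup>2"
  proof -
    have "1 * L1 \<le> L1 * L1" using L1 by (intro mult_right_mono) auto
    then have "L1 \<le> L1\<^sup>2" by (simp add: power2_eq_square)
    then show "2 * L1 \<le> 2 * L1\<^sup>2" "1 \<le> 2 * L1\<^sup>2" using L1 by linarith+
  qed
  have Q1: "1 \<le> Q" unfolding Q_def using base(2) by (rule one_le_power)
  have growth: "real (card (A.setpow D 37)) \<le> Q * real (card D)"
  proof -
    have "real (card (A.setpow D 37)) \<le> (real (card (M <#>\<^bsub>Aff R\<^esub> m_inv (Aff R) ` M)) / t) ^ 37 * m"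
      using A.card_setpow_popular_quotients_le[OF Mf(2,1) \<open>M \<noteq> {}\<close> t] by (simp add: D_def m_def)
    also have "\<dots> \<le> (2 * L1\<^sup>2) ^ 37 * m"
    proof (intro mult_right_mono power_mono)
      have "real (card (M <#>\<^bsub>Aff R\<^esub> m_inv (Aff R) ` M)) / t \<le> L1 * m / t"
        using M(3) t by (intro divide_right_mono) (auto simp: m_def)
      also have "\<dots> = 2 * L1\<^sup>2" using m L1 by (simp add: t_def power2_eq_square)
      finally show "real (card (M <#>\<^bsub>Aff R\<^esub> m_inv (Aff R) ` M)) / t \<le> 2 * L1\<^sup>2" .
    qed (use m t in auto)
    also have "\<dots> \<le> (2 * L1\<^sup>2) ^ 37 * (2 * L1\<^sup>2 * real (card D))"
    proof (rule mult_left_mono)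
      have "2 * L1 * real (card D) \<le> 2 * L1\<^sup>2 * real (card D)" using base(1) by (rule mult_right_mono) simp
      then show "m \<le> 2 * L1\<^sup>2 * real (card D)" using mD by linarith
    qed (use base in auto)
    also have "\<dots> = (2 * L1\<^sup>2) ^ Suc 37 * real (card D)" by (simp only: power_Suc2 mult.assoc)
    also have "Suc 37 = 38" by simp
    finally show ?thesis unfolding Q_def .
  qed
  \<comment> \<open>Each element of \<open>D\<close> uses at least \<open>t\<close> of the pairs
    from \<open>M\<close>, so \<open>D\<close> has at most 2 L1 m elements and inherits the bound in
    terms of \<open>q\<close>.\<close>
  have Dq: "real (card D) \<le> Q * q"
  proof -
    have "t * real (card D) \<le> real (card (M \<times> M))"
      by (rule card_le_if_disjoint_reps[where R = "\<lambda>x. {p \<in> M \<times> M. (\<lambda>(y, z). ainv y \<star> z) p = x}"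
          and f = "\<lambda>(y, z). ainv y \<star> z"])
         (use Mf in \<open>auto simp: D_def A.popular_quotients_def\<close>)
    then have "m * real (card D) \<le> m * (2 * L1 * m)"
      using L1 by (simp add: t_def m_def card_cartesian_product field_simps)
    then have "real (card D) \<le> 2 * L1 * m" using m by simp
    also have "\<dots> \<le> 2 * L1 * (L * q)"
    proof (rule mult_left_mono)
      have "m \<le> real (card A)" using M(1) A by (auto simp: m_def intro: card_mono)
      then show "m \<le> L * q" using q by linarith
    qed (use L1 in auto)
    also have "\<dots> = 2 * L1 * L * q" by simp
    also have "\<dots> \<le> Q * q"
    proof (rule mult_right_mono)
      have "0 \<le> L * q" using q by linarith
      then show "0 \<le> q" using L by (simp add: zero_le_mult_iff)
      have "2 * L1 * L \<le> 2 * L1 * L1" using LL L L1 by (intro mult_left_mono) auto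
      also have "\<dots> = (2 * L1\<^sup>2) ^ 1" by (simp add: power2_eq_square)
      also have "\<dots> \<le> Q" unfolding Q_def using base(2) by (rule power_increasing[rotated]) simp
      finally show "2 * L1 * L \<le> Q" .
    qed
    finally show ?thesis .
  qed
  obtain g H where gH: "g \<in> carrier (Aff R)" "abelian_subgroup (Aff R) H"
    "real (card D) \<le> 2 * Q\<^sup>2 * real (card (D \<inter> (g <#\<^bsub>Aff R\<^esub> H)))"
    using abelian_coset_of_small_growth[OF Dc Df D1 Dinv Q1 growth Dq esc] by blast
  have Hc: "H \<subseteq> carrier (Aff R)" using gH(2) by (auto simp: abelian_subgroup_def subgroup_def)
  obtain g' where g': "g' \<in> carrier (Aff R)"
    "t * real (card (D \<inter> (g <#\<^bsub>Aff R\<^esub> H))) \<le> m * real (card (M \<inter> (g' <#\<^bsub>Aff R\<^esub> H)))"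
    using A.popular_quotients_coset[OF Mf(2,1) \<open>M \<noteq> {}\<close> Hc gH(1) t] by (auto simp: m_def D_def)
  define a where "a = real (card (A \<inter> (g' <#\<^bsub>Aff R\<^esub> H)))"
  have "m * real (card (D \<inter> (g <#\<^bsub>Aff R\<^esub> H))) \<le> m * (2 * L1 * real (card (M \<inter> (g' <#\<^bsub>Aff R\<^esub> H))))"
    using g'(2) L1 by (simp add: t_def field_simps)
  then have "real (card (D \<inter> (g <#\<^bsub>Aff R\<^esub> H))) \<le> 2 * L1 * real (card (M \<inter> (g' <#\<^bsub>Aff R\<^esub> H)))"
    using m by simp
  also have "\<dots> \<le> 2 * L1 * a"
    unfolding a_def using M(1) A(2) L1 by (intro mult_left_mono of_nat_mono card_mono) auto
  finally have Da: "real (card (D \<inter> (g <#\<^bsub>Aff R\<^esub> H))) \<le> 2 * L1 * a" .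
  have a0: "0 \<le> a" by (simp add: a_def)
  have "real (card A) \<le> 8 * L * m" using M(2) by (simp add: m_def)
  also have "\<dots> \<le> 8 * L * (2 * L1 * (2 * Q\<^sup>2 * (2 * L1 * a)))"
  proof (rule mult_left_mono)
    note mD
    also have "2 * L1 * real (card D) \<le> 2 * L1 * (2 * Q\<^sup>2 * real (card (D \<inter> (g <#\<^bsub>Aff R\<^esub> H))))"
      using gH(3) L1 by (intro mult_left_mono) auto
    also have "\<dots> \<le> 2 * L1 * (2 * Q\<^sup>2 * (2 * L1 * a))"
      using Da L1 by (intro mult_left_mono) auto
    finally show "m \<le> 2 * L1 * (2 * Q\<^sup>2 * (2 * L1 * a))" .
  qed (use L in auto)
  also have "\<dots> = (64 * L) * L1\<^sup>2 * Q\<^sup>2 * a" by (simp add: power2_eq_square)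
  \<comment> \<open>231 = 1 + 2 + 2 * 114, where 114 = 3 * 38 because 2 L1^2 <= L1^3.\<close>
  also have "\<dots> \<le> L1 * L1\<^sup>2 * (L1 ^ 114)\<^sup>2 * a"
  proof (intro mult_right_mono mult_mono)
    have "2 * L1\<^sup>2 \<le> L1 * L1\<^sup>2" using L1 by (intro mult_right_mono) auto
    then have "Q \<le> (L1 ^ 3) ^ 38" unfolding Q_def using L1
      by (intro power_mono) (auto simp: power2_eq_square power3_eq_cube)
    also have "\<dots> = L1 ^ 114" by (simp add: power_mult[symmetric])
    finally show "Q\<^sup>2 \<le> (L1 ^ 114)\<^sup>2" using Q1 by (intro power_mono) auto
  qed (use LL L1 L a0 in auto)
  also have "L1 * L1\<^sup>2 * (L1 ^ 114)\<^sup>2 = L1 ^ 231"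
    by (simp only: power_mult[symmetric] power_add[symmetric] power_Suc[symmetric]) simp
  finally show ?thesis using g'(1) gH(2) unfolding a_def L1_def by blast
qed

lemma card_overlap_eq:
  assumes "g \<in> carrier (Aff R)" "Y \<subseteq> carrier R"
  shows "card (Y \<inter> g ` Y) = card {y \<in> Y. g y \<in> Y}"
proof -
  have "inj_on g {y \<in> Y. g y \<in> Y}"
    by (rule inj_on_subset[OF Aff_inj_on[OF assms(1)]]) (use assms in auto)
  moreover have "g ` {y \<in> Y. g y \<in> Y} = Y \<inter> g ` Y" by auto
  ultimately show ?thesis by (metis card_image)
qed

text \<open>x^2 - x counts the ordered pairs of distinct points of \<open>Y\<close> that g keeps in
  \<open>Y\<close>. Such a pair together with its image determines g.\<close>

lemma sum_overlap_pairs_le: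
  assumes S: "finite S" "S \<subseteq> carrier (Aff R)" and Y: "finite Y" "Y \<subseteq> carrier R"
  shows "(\<Sum>g\<in>S. (real (card (Y \<inter> g ` Y)))\<^sup>2 - real (card (Y \<inter> g ` Y)))
    \<le> ((real (card Y))\<^sup>2 - real (card Y))\<^sup>2"
proof -
  define Od where "Od = {(y, y'). y \<in> Y \<and> y' \<in> Y \<and> y \<noteq> y'}"
  have fOd: "finite Od" by (rule finite_subset[of _ "Y \<times> Y"]) (use Y in \<open>auto simp: Od_def\<close>)
  define P where "P g = {(y, y'). y \<in> {y \<in> Y. g y \<in> Y} \<and> y' \<in> {y \<in> Y. g y \<in> Y} \<and> y \<noteq> y'}" for g
  have fP: "finite (P g)" for g by (rule finite_subset[OF _ fOd]) (auto simp: P_def Od_def)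
  have "(\<Sum>g\<in>S. (real (card (Y \<inter> g ` Y)))\<^sup>2 - real (card (Y \<inter> g ` Y))) = (\<Sum>g\<in>S. real (card (P g)))"
  proof (rule sum.cong)
    fix g assume "g \<in> S"
    then have "card (Y \<inter> g ` Y) = card {y \<in> Y. g y \<in> Y}" using S Y by (intro card_overlap_eq) auto
    moreover have "finite {y \<in> Y. g y \<in> Y}" using Y by simp
    from card_offdiag[OF this]
    have "real (card (P g)) = (real (card {y \<in> Y. g y \<in> Y}))\<^sup>2 - real (card {y \<in> Y. g y \<in> Y})"
      unfolding P_def .
    ultimately show "(real (card (Y \<inter> g ` Y)))\<^sup>2 - real (card (Y \<inter> g ` Y)) = real (card (P g))"
      by (simp only:)
  qed simp
  also have "\<dots> = real (card (SIGMA g:S. P g))" using S fP by simp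
  also have "\<dots> \<le> real (card (Od \<times> Od))"
  proof (intro of_nat_mono card_inj_on_le[where f = "\<lambda>(g, (y, y')). ((y, y'), (g y, g y'))"])
    show "inj_on (\<lambda>(g, (y, y')). ((y, y'), (g y, g y'))) (SIGMA g:S. P g)"
    proof (rule inj_onI)
      fix p p' assume p: "p \<in> (SIGMA g:S. P g)" "p' \<in> (SIGMA g:S. P g)"
        "(\<lambda>(g, (y, y')). ((y, y'), (g y, g y'))) p = (\<lambda>(g, (y, y')). ((y, y'), (g y, g y'))) p'"
      obtain g y y' where gy: "p = (g, (y, y'))" by (metis surj_pair)
      obtain h z z' where hz: "p' = (h, (z, z'))" by (metis surj_pair)
      have e: "z = y" "z' = y'" "g y = h y" "g y' = h y'" using p(3) gy hz by auto
      have gh: "g \<in> carrier (Aff R)" "h \<in> carrier (Aff R)" using p gy hz S by auto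
      have y: "y \<in> carrier R" "y' \<in> carrier R" "y \<noteq> y'" using p(1) gy Y by (auto simp: P_def)
      have s: "slope g \<in> carrier R" "slope h \<in> carrier R" "g \<zero> \<in> carrier R" "h \<zero> \<in> carrier R"
        using gh slope_closed Aff_closed[OF gh(1)] Aff_closed[OF gh(2)] by auto
      have eq1: "slope g \<otimes> y \<oplus> g \<zero> = slope h \<otimes> y \<oplus> h \<zero>"
        using e(3) Aff_apply[OF gh(1) y(1)] Aff_apply[OF gh(2) y(1)] by simp
      have eq2: "slope g \<otimes> y' \<oplus> g \<zero> = slope h \<otimes> y' \<oplus> h \<zero>"
        using e(4) Aff_apply[OF gh(1) y(2)] Aff_apply[OF gh(2) y(2)] by simp
      have "slope g \<otimes> (y \<ominus> y') = (slope g \<otimes> y \<oplus> g \<zero>) \<ominus> (slope g \<otimes> y' \<oplus> g \<zero>)"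
        using s y by algebra
      also have "\<dots> = slope h \<otimes> (y \<ominus> y')" unfolding eq1 eq2 using s y by algebra
      finally have "(y \<ominus> y') \<otimes> slope g = (y \<ominus> y') \<otimes> slope h" using s y by (simp add: m_comm)
      moreover have "y \<ominus> y' \<noteq> \<zero>" using y by (metis r_right_minus_eq)
      ultimately have sl: "slope g = slope h" using s y m_lcancel by simp
      then have "g \<zero> = h \<zero>" using eq1 s y by simp
      then have "g = h" using sl gh by (intro Aff_eqI)
      then show "p = p'" using gy hz e by simp
    qed
    show "(\<lambda>(g, (y, y')). ((y, y'), (g y, g y'))) ` (SIGMA g:S. P g) \<subseteq> Od \<times> Od"
    proof
      fix r assume "r \<in> (\<lambda>(g, (y, y')). ((y, y'), (g y, g y'))) ` (SIGMA g:S. P g)"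
      then obtain g y y' where r: "g \<in> S" "(y, y') \<in> P g" "r = ((y, y'), (g y, g y'))" by auto
      have "inj_on g (carrier R)" using Aff_inj_on r(1) S by auto
      then have "g y \<noteq> g y'" using r(2) Y by (auto simp: P_def inj_on_def)
      then show "r \<in> Od \<times> Od" using r by (auto simp: P_def Od_def)
    qed
  qed (use fOd in auto)
  also have "\<dots> = ((real (card Y))\<^sup>2 - real (card Y))\<^sup>2"
    using card_offdiag[OF Y(1)] by (simp add: Od_def card_cartesian_product power2_eq_square)
  finally show ?thesis .
qed

lemma sum_square_ge_of_overlap:
  assumes w: "A.prob_weight S w" and Y: "finite Y" "Y \<subseteq> carrier R"
    and ov: "\<beta> * real (card Y) \<le> (\<Sum>g\<in>S. w g * real (card (Y \<inter> g ` Y)))"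
    and \<beta>: "4 \<le> \<beta> * real (card Y)"
  shows "9 / 16 * \<beta>\<^sup>2 \<le> (real (card Y))\<^sup>2 * (\<Sum>g\<in>S. (w g)\<^sup>2)"
proof -
  have S: "finite S" "S \<subseteq> carrier (Aff R)" "\<And>x. x \<in> S \<Longrightarrow> 0 \<le> w x" "(\<Sum>x\<in>S. w x) = 1"
    using w by (auto simp: A.prob_weight_def)
  define n where "n = real (card Y)"
  have n: "0 < n" using \<beta> by (cases "card Y = 0") (auto simp: n_def)
  define x where "x g = card (Y \<inter> g ` Y)" for g
  \<comment> \<open>Natural subtraction gives 0 for an empty overlap. The shift by 1 makes z^2 <=
    x^2 - x, which \<open>sum_overlap_pairs_le\<close> controls, and costs only a factor 3/4 since
    the mean overlap is at least 4.\<close>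
  define z where "z g = real (x g - 1)" for g
  have z2: "(z g)\<^sup>2 \<le> (real (x g))\<^sup>2 - real (x g)" for g
    by (cases "x g") (auto simp: z_def power2_eq_square algebra_simps)
  have zx: "real (x g) - 1 \<le> z g" for g by (auto simp: z_def)
  have "(3 / 4 * (\<beta> * n))\<^sup>2 \<le> (\<Sum>g\<in>S. w g * z g)\<^sup>2"
  proof (rule power_mono)
    have "3 / 4 * (\<beta> * n) \<le> \<beta> * n - 1" using \<beta> by (simp add: n_def)
    also have "\<dots> \<le> (\<Sum>g\<in>S. w g * real (x g)) - (\<Sum>g\<in>S. w g)" using ov S by (simp add: n_def x_def)
    also have "\<dots> = (\<Sum>g\<in>S. w g * (real (x g) - 1))" by (simp add: sum_subtractf algebra_simps)
    also have "\<dots> \<le> (\<Sum>g\<in>S. w g * z g)" using S zx by (intro sum_mono mult_left_mono) auto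
    finally show "3 / 4 * (\<beta> * n) \<le> (\<Sum>g\<in>S. w g * z g)" .
  qed (use \<beta> in \<open>auto simp: n_def\<close>)
  also have "\<dots> \<le> (\<Sum>g\<in>S. (w g)\<^sup>2) * (\<Sum>g\<in>S. (z g)\<^sup>2)" by (rule Cauchy_Schwarz_sum)
  also have "\<dots> \<le> (\<Sum>g\<in>S. (w g)\<^sup>2) * (n\<^sup>2)\<^sup>2"
  proof (rule mult_left_mono)
    have "(\<Sum>g\<in>S. (z g)\<^sup>2) \<le> (\<Sum>g\<in>S. (real (x g))\<^sup>2 - real (x g))" by (intro sum_mono z2)
    also have "\<dots> \<le> (n\<^sup>2 - n)\<^sup>2"
      using sum_overlap_pairs_le[OF S(1,2) Y] by (simp add: x_def n_def)
    also have "\<dots> \<le> (n\<^sup>2)\<^sup>2"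
    proof (rule power_mono)
      have "1 \<le> n" using n by (simp add: n_def)
      then show "0 \<le> n\<^sup>2 - n" by (simp add: power2_eq_square)
    qed (use n in auto)
    finally show "(\<Sum>g\<in>S. (z g)\<^sup>2) \<le> (n\<^sup>2)\<^sup>2" .
  qed (auto intro: sum_nonneg)
  finally have "n\<^sup>2 * (9 / 16 * \<beta>\<^sup>2) \<le> n\<^sup>2 * (n\<^sup>2 * (\<Sum>g\<in>S. (w g)\<^sup>2))"
    by (simp add: power_mult_distrib power2_eq_square algebra_simps)
  moreover have "0 < n\<^sup>2" using n by simp
  ultimately have "9 / 16 * \<beta>\<^sup>2 \<le> n\<^sup>2 * (\<Sum>g\<in>S. (w g)\<^sup>2)" by (simp only: mult_le_cancel_left_pos)
  then show ?thesis by (simp only: n_def)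
qed

section \<open>Second moment of the overlap over a finite field\<close>

lemma Aff_image:
  "carrier (Aff R) = (\<lambda>(a, b). affine_map R a b) ` ((carrier R - {\<zero>}) \<times> carrier R)"
  by (auto simp: Aff_def)

lemma card_Aff:
  assumes "finite (carrier R)"
  shows "finite (carrier (Aff R))"
    "card (carrier (Aff R)) = (card (carrier R) - 1) * card (carrier R)"
proof -
  have "inj_on (\<lambda>(a, b). affine_map R a b) ((carrier R - {\<zero>}) \<times> carrier R)"
    by (rule inj_on_inverseI[where g = "\<lambda>g. (slope g, g \<zero>)"]) auto
  then show "card (carrier (Aff R)) = (card (carrier R) - 1) * card (carrier R)"
    unfolding Aff_image using assms by (simp add: card_image card_cartesian_product)
  show "finite (carrier (Aff R))" unfolding Aff_image using assms by auto
qed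

lemma card_Aff_maps_to:
  assumes "finite (carrier R)" "y \<in> carrier R" "z \<in> carrier R"
  shows "card {g \<in> carrier (Aff R). g y = z} = card (carrier R) - 1"
proof -
  have "bij_betw (\<lambda>a. affine_map R a (z \<ominus> a \<otimes> y)) (carrier R - {\<zero>}) {g \<in> carrier (Aff R). g y = z}"
  proof (rule bij_betw_byWitness[where f' = slope])
    show "\<forall>g\<in>{g \<in> carrier (Aff R). g y = z}. affine_map R (slope g) (z \<ominus> slope g \<otimes> y) = g"
    proof
      fix g assume g: "g \<in> {g \<in> carrier (Aff R). g y = z}"
      then have gc: "g \<in> carrier (Aff R)" "slope g \<in> carrier R" "g \<zero> \<in> carrier R"
        using slope_closed Aff_closed[of g] by auto
      have "z = slope g \<otimes> y \<oplus> g \<zero>" using g Aff_apply[OF gc(1) assms(2)] by simp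
      then have "z \<ominus> slope g \<otimes> y = (slope g \<otimes> y \<oplus> g \<zero>) \<ominus> slope g \<otimes> y" by simp
      also have "\<dots> = g \<zero>" using gc assms by algebra
      finally show "affine_map R (slope g) (z \<ominus> slope g \<otimes> y) = g"
        using Aff_eq_affine_map[OF gc(1)] by simp
    qed
    show "(\<lambda>a. affine_map R a (z \<ominus> a \<otimes> y)) ` (carrier R - {\<zero>}) \<subseteq> {g \<in> carrier (Aff R). g y = z}"
    proof clarsimp
      fix a assume a: "a \<in> carrier R" "a \<noteq> \<zero>"
      have "affine_map R a (z \<ominus> a \<otimes> y) y = a \<otimes> y \<oplus> (z \<ominus> a \<otimes> y)"
        using assms by (simp add: affine_map_def)
      also have "\<dots> = z" using a assms by algebra
      finally show "affine_map R a (z \<ominus> a \<otimes> y) \<in> carrier (Aff R) \<and> affine_map R a (z \<ominus> a \<otimes> y) y = z"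
        using a assms by (simp add: affine_map_mem)
    qed
  qed (use assms slope_closed slope_nonzero in auto)
  from bij_betw_same_card[OF this] show ?thesis using assms by simp
qed

text \<open>Exactly p - 1 affine maps send one given point to another. The mean overlap over the
  whole group is therefore n^2 / p.\<close>

lemma sum_overlap_Aff:
  assumes fin: "finite (carrier R)" and Y: "Y \<subseteq> carrier R"
  shows "(\<Sum>g\<in>carrier (Aff R). real (card (Y \<inter> g ` Y))) = (real (card Y))\<^sup>2 * (real (card (carrier R)) - 1)"
proof -
  have fY: "finite Y" using fin Y finite_subset by blast
  have one: "1 \<le> card (carrier R)" using fin by (metis One_nat_def Suc_leI card_gt_0_iff empty_iff zero_closed)
  have "(\<Sum>g\<in>carrier (Aff R). real (card (Y \<inter> g ` Y))) = (\<Sum>g\<in>carrier (Aff R). \<Sum>y\<in>Y. \<Sum>z\<in>Y. if g y = z then 1 else 0)"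
  proof (rule sum.cong)
    fix g assume g: "g \<in> carrier (Aff R)"
    have "real (card (Y \<inter> g ` Y)) = (\<Sum>y\<in>Y. if g y \<in> Y then 1 else 0)"
      unfolding card_overlap_eq[OF g Y] using fY by (simp add: sum.If_cases Int_def)
    also have "\<dots> = (\<Sum>y\<in>Y. \<Sum>z\<in>Y. if g y = z then 1 else 0)"
      using fY by (intro sum.cong refl) simp
    finally show "real (card (Y \<inter> g ` Y)) = (\<Sum>y\<in>Y. \<Sum>z\<in>Y. if g y = z then 1 else 0)" .
  qed simp
  also have "\<dots> = (\<Sum>y\<in>Y. \<Sum>z\<in>Y. \<Sum>g\<in>carrier (Aff R). if g y = z then 1 else 0)"
    by (subst sum.swap) (intro sum.cong refl sum.swap)
  also have "\<dots> = (\<Sum>y\<in>Y. \<Sum>z\<in>Y. real (card (carrier R) - 1))"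
  proof (intro sum.cong refl)
    fix y z assume yz: "y \<in> Y" "z \<in> Y"
    have "(\<Sum>g\<in>carrier (Aff R). if g y = z then 1 else 0 :: real) = real (card {g \<in> carrier (Aff R). g y = z})"
      using card_Aff(1)[OF fin] by (simp add: sum.If_cases Int_def)
    also have "card {g \<in> carrier (Aff R). g y = z} = card (carrier R) - 1"
      using yz Y by (intro card_Aff_maps_to fin) auto
    finally show "(\<Sum>g\<in>carrier (Aff R). if g y = z then 1 else 0) = real (card (carrier R) - 1)" .
  qed
  also have "\<dots> = (real (card Y))\<^sup>2 * (real (card (carrier R)) - 1)"
    using one by (simp add: power2_eq_square of_nat_diff)
  finally show ?thesis .
qed

text \<open>Centred at their mean n^2 / p, the overlaps have total square at most p n^2 over the
  group, against n^4 in the uncentred bound. The hypothesis on \<beta> makes the overlap under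
  \<open>w\<close> at least twice this mean, so half of it survives the centring.\<close>

lemma sum_square_ge_of_overlap_finite:
  assumes w: "A.prob_weight S w" and fin: "finite (carrier R)" and Y: "Y \<subseteq> carrier R" "Y \<noteq> {}"
    and ov: "\<beta> * real (card Y) \<le> (\<Sum>g\<in>S. w g * real (card (Y \<inter> g ` Y)))"
    and \<beta>: "2 * real (card Y) \<le> \<beta> * real (card (carrier R))"
  shows "\<beta>\<^sup>2 \<le> 4 * real (card (carrier R)) * (\<Sum>g\<in>S. (w g)\<^sup>2)"
proof -
  have S: "finite S" "S \<subseteq> carrier (Aff R)" "\<And>x. x \<in> S \<Longrightarrow> 0 \<le> w x" "(\<Sum>x\<in>S. w x) = 1"
    using w by (auto simp: A.prob_weight_def)
  have fY: "finite Y" using fin Y finite_subset by blast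
  let ?G = "carrier (Aff R)"
  define n where "n = real (card Y)"
  define p where "p = real (card (carrier R))"
  have n: "1 \<le> n" using fY Y by (simp add: n_def Suc_le_eq card_gt_0_iff)
  have np: "n \<le> p" using card_mono[OF fin Y(1)] by (simp add: n_def p_def)
  have p: "0 < p" using n np by linarith
  define x where "x g = real (card (Y \<inter> g ` Y))" for g
  define z where "z g = x g - n\<^sup>2 / p" for g
  have \<beta>n: "n\<^sup>2 / p \<le> \<beta> * n / 2"
  proof -
    have "n * (2 * n) \<le> n * (\<beta> * p)" using \<beta> n by (intro mult_left_mono) (auto simp: n_def p_def)
    then show ?thesis using p by (simp add: field_simps power2_eq_square)
  qed
  have \<beta>0: "0 \<le> \<beta> * n / 2" using \<beta>n p by (smt (verit) divide_nonneg_pos zero_le_power2)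
  have cG: "real (card ?G) = (p - 1) * p"
  proof -
    have "1 \<le> card (carrier R)" using np n by (simp add: p_def)
    then show ?thesis by (simp add: card_Aff(2)[OF fin] p_def of_nat_diff)
  qed
  \<comment> \<open>The square is arranged around x^2 - x, for which only an upper bound is known.
    The coefficient of x may be negative, so the exact value from \<open>sum_overlap_Aff\<close> is
    used there.\<close>
  have "(\<Sum>g\<in>?G. (z g)\<^sup>2) = (\<Sum>g\<in>?G. ((x g)\<^sup>2 - x g) + (1 - 2 * (n\<^sup>2 / p)) * x g + (n\<^sup>2 / p)\<^sup>2)"
    by (intro sum.cong refl) (simp add: z_def power2_diff algebra_simps)
  also have "\<dots> = (\<Sum>g\<in>?G. (x g)\<^sup>2 - x g) + (1 - 2 * (n\<^sup>2 / p)) * (\<Sum>g\<in>?G. x g) + real (card ?G) * (n\<^sup>2 / p)\<^sup>2"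
    by (simp only: sum.distrib sum_distrib_left[symmetric]) simp
  also have "\<dots> \<le> (n\<^sup>2 - n)\<^sup>2 + (1 - 2 * (n\<^sup>2 / p)) * (n\<^sup>2 * (p - 1)) + ((p - 1) * p) * (n\<^sup>2 / p)\<^sup>2"
    using sum_overlap_pairs_le[OF card_Aff(1)[OF fin] subset_refl fY Y(1)] sum_overlap_Aff[OF fin Y(1)]
    by (simp add: x_def n_def p_def cG[unfolded p_def])
  also have "\<dots> = p * n\<^sup>2 + n ^ 3 * (n / p - 2)"
    using p by (simp add: field_simps power2_eq_square power3_eq_cube)
  also have "\<dots> \<le> p * n\<^sup>2"
  proof -
    have "n / p \<le> 1" using np p by simp
    then have "n ^ 3 * (n / p - 2) \<le> 0" using n by (intro mult_nonneg_nonpos) auto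
    then show ?thesis by simp
  qed
  finally have zG: "(\<Sum>g\<in>?G. (z g)\<^sup>2) \<le> p * n\<^sup>2" .
  have "(\<beta> * n / 2)\<^sup>2 \<le> (\<Sum>g\<in>S. w g * z g)\<^sup>2"
  proof (rule power_mono)
    have "\<beta> * n / 2 \<le> (\<Sum>g\<in>S. w g * x g) - (\<Sum>g\<in>S. w g) * (n\<^sup>2 / p)"
      using ov \<beta>n S(4) by (simp add: n_def x_def)
    also have "\<dots> = (\<Sum>g\<in>S. w g * z g)" by (simp add: z_def sum_subtractf right_diff_distrib sum_distrib_right sum_divide_distrib)
    finally show "\<beta> * n / 2 \<le> (\<Sum>g\<in>S. w g * z g)" .
  qed (rule \<beta>0)
  also have "\<dots> \<le> (\<Sum>g\<in>S. (w g)\<^sup>2) * (\<Sum>g\<in>S. (z g)\<^sup>2)" by (rule Cauchy_Schwarz_sum)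
  also have "\<dots> \<le> (\<Sum>g\<in>S. (w g)\<^sup>2) * (p * n\<^sup>2)"
  proof (rule mult_left_mono)
    have "(\<Sum>g\<in>S. (z g)\<^sup>2) \<le> (\<Sum>g\<in>?G. (z g)\<^sup>2)"
      using card_Aff(1)[OF fin] S by (intro sum_mono2) auto
    then show "(\<Sum>g\<in>S. (z g)\<^sup>2) \<le> p * n\<^sup>2" using zG by linarith
  qed (auto intro: sum_nonneg)
  finally have "n\<^sup>2 * \<beta>\<^sup>2 \<le> n\<^sup>2 * (4 * p * (\<Sum>g\<in>S. (w g)\<^sup>2))"
    by (simp add: power_mult_distrib power_divide algebra_simps)
  then show ?thesis using n by (simp add: p_def)
qed

end

subsection \<open>Iterated quotient convolutions\<close>

context group
begin

primrec iter_supp :: "'a set \<Rightarrow> nat \<Rightarrow> 'a set" where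
  "iter_supp A 0 = A"
| "iter_supp A (Suc j) = qsupp (iter_supp A j)"

primrec iter_weight :: "'a set \<Rightarrow> nat \<Rightarrow> 'a \<Rightarrow> real" where
  "iter_weight A 0 = (\<lambda>_. 1 / real (card A))"
| "iter_weight A (Suc j) = qconv (iter_supp A j) (iter_weight A j)"

definition iter_energy :: "'a set \<Rightarrow> nat \<Rightarrow> real" where
  "iter_energy A j = (\<Sum>x\<in>iter_supp A j. (iter_weight A j x)\<^sup>2)"

lemma prob_weight_iter:
  assumes "finite A" "A \<noteq> {}" "A \<subseteq> carrier G"
  shows "prob_weight (iter_supp A j) (iter_weight A j)"
proof (induction j)
  case 0
  then show ?case using assms by (simp add: prob_weight_def)
qed (simp add: prob_weight_qconv)

lemma iter_energy_0: "finite A \<Longrightarrow> A \<noteq> {} \<Longrightarrow> iter_energy A 0 = 1 / real (card A)"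
  by (simp add: iter_energy_def power2_eq_square)

lemma iter_weight_Suc_le:
  assumes "finite A" "A \<noteq> {}" "A \<subseteq> carrier G"
  shows "iter_weight A (Suc j) x \<le> iter_energy A j"
  using qconv_le[OF prob_weight_iter[OF assms, of j]] by (simp add: iter_energy_def)

lemma iter_weight_coset_le:
  assumes A: "finite A" "A \<noteq> {}" "A \<subseteq> carrier G" and H: "H \<subseteq> carrier G"
    and \<kappa>: "\<And>g. g \<in> carrier G \<Longrightarrow> real (card (A \<inter> (g <# H))) \<le> \<kappa> * real (card A)"
  shows "g \<in> carrier G \<Longrightarrow> (\<Sum>x\<in>iter_supp A j \<inter> (g <# H). iter_weight A j x) \<le> \<kappa>"
proof (induction j arbitrary: g)
  case 0
  then show ?case using \<kappa>[OF 0] A by (simp add: divide_le_eq card_gt_0_iff)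
next
  case (Suc j)
  then show ?case using qconv_coset_le[OF prob_weight_iter[OF A] H, of j \<kappa> g] by simp
qed

text \<open>Each application of \<open>overlap_qconv_ge\<close> squares the density of the
  overlap.\<close>

lemma iter_overlap_ge:
  fixes act :: "'a \<Rightarrow> 'x \<Rightarrow> 'x"
  assumes A: "finite A" "A \<noteq> {}" "A \<subseteq> carrier G" and Y: "finite Y" "Y \<subseteq> E" "Y \<noteq> {}"
    and inj: "\<And>g. g \<in> carrier G \<Longrightarrow> inj_on (act g) E"
    and closed: "\<And>g x. g \<in> carrier G \<Longrightarrow> x \<in> E \<Longrightarrow> act g x \<in> E"
    and comp: "\<And>g h x. g \<in> carrier G \<Longrightarrow> h \<in> carrier G \<Longrightarrow> x \<in> E \<Longrightarrow> act (g \<otimes> h) x = act g (act h x)"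
    and \<alpha>: "0 \<le> \<alpha>" "\<And>g. g \<in> A \<Longrightarrow> \<alpha> * real (card Y) \<le> real (card (Y \<inter> act g ` Y))"
  shows "\<alpha> ^ (2 ^ j) * real (card Y)
    \<le> (\<Sum>g\<in>iter_supp A j. iter_weight A j g * real (card (Y \<inter> act g ` Y)))"
proof (induction j)
  case 0
  have "\<alpha> * real (card Y) = (\<Sum>g\<in>A. 1 / real (card A) * (\<alpha> * real (card Y)))"
    using A by simp
  also have "\<dots> \<le> (\<Sum>g\<in>A. 1 / real (card A) * real (card (Y \<inter> act g ` Y)))"
    by (intro sum_mono mult_left_mono \<alpha>) auto
  finally show ?case by simp
next
  case (Suc j)
  let ?n = "real (card Y)"
  have n: "0 < ?n" using Y by (simp add: card_gt_0_iff)
  have "(\<alpha> ^ (2 ^ j) * ?n)\<^sup>2 \<le> (\<Sum>g\<in>iter_supp A j. iter_weight A j g * real (card (Y \<inter> act g ` Y)))\<^sup>2"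
    using \<alpha>(1) by (intro power_mono Suc.IH) auto
  also have "\<dots> \<le> ?n * (\<Sum>g\<in>qsupp (iter_supp A j). qconv (iter_supp A j) (iter_weight A j) g * real (card (Y \<inter> act g ` Y)))"
    by (rule overlap_qconv_ge[OF prob_weight_iter[OF A] Y(1,2) inj closed comp])
  finally have "?n * (\<alpha> ^ (2 ^ Suc j) * ?n) \<le> ?n * (\<Sum>g\<in>iter_supp A (Suc j). iter_weight A (Suc j) g * real (card (Y \<inter> act g ` Y)))"
    by (simp add: power_mult_distrib power_mult[symmetric] power2_eq_square[of ?n] mult.commute mult.left_commute)
  then show ?case using n by (simp only: mult_le_cancel_left_pos)
qed

end

text \<open>If every step lost more than a factor \<open>K\<close>, then K^i a_i would stay at most
  1 up to i = m.\<close>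

lemma exists_flat_step:
  fixes a :: "nat \<Rightarrow> real"
  assumes "a 0 \<le> 1" "1 < K ^ m * a m" "0 < K"
  shows "\<exists>i<m. a i \<le> K * a (Suc i)"
proof (rule ccontr)
  assume no: "\<not> ?thesis"
  have "K ^ i * a i \<le> 1" if "i \<le> m" for i
    using that
  proof (induction i)
    case 0
    then show ?case using assms by simp
  next
    case (Suc i)
    then have "K * a (Suc i) \<le> a i" using no by (auto simp: not_le intro: less_imp_le)
    then have "K ^ i * (K * a (Suc i)) \<le> K ^ i * a i" using assms(3) by (intro mult_left_mono) auto
    then show ?case using Suc by (simp add: algebra_simps)
  qed
  then show False using assms(2) by fastforce
qed

context affine_group
begin

text \<open>With \<open>s\<close> the energy at step i, the weight at step i + 1 is at most
  \<open>s\<close>, and its level set \<open>B\<close> has about 1 / s elements and nearly maximal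
  energy, up to powers of \<open>K\<close>. In the second alternative of \<open>esc\<close>, 1 / s
  is at most 2 K q, which bounds \<open>B\<close> in terms of q.\<close>

lemma concentration:
  fixes K :: real
  assumes A: "finite A" "A \<noteq> {}" "A \<subseteq> carrier (Aff R)" and K: "2 \<le> K"
    and flat: "A.iter_energy A i \<le> K * A.iter_energy A (Suc (Suc i))"
    and esc: "(\<forall>q. escapes R q) \<or>
      (\<exists>q. escapes R q \<and> 1 \<le> 2 * K * q * A.iter_energy A i)"
  shows "\<exists>g H. g \<in> carrier (Aff R) \<and> abelian_subgroup (Aff R) H \<and>
    real (card A) \<le> K ^ 37891 * real (card (A \<inter> (g <#\<^bsub>Aff R\<^esub> H)))"
proof -
  define S where "S = A.iter_supp A (Suc i)"
  define w where "w = A.iter_weight A (Suc i)"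
  define s where "s = A.iter_energy A i"
  have pw: "A.prob_weight S w" unfolding S_def w_def by (rule A.prob_weight_iter[OF A])
  have S: "finite S" "S \<subseteq> carrier (Aff R)" "\<And>x. x \<in> S \<Longrightarrow> 0 \<le> w x"
    using pw by (auto simp: A.prob_weight_def)
  have s: "0 < s"
  proof (rule ccontr)
    assume "\<not> 0 < s"
    then have "w x \<le> 0" for x using A.iter_weight_Suc_le[OF A, of i x] by (simp add: w_def s_def)
    then have "(\<Sum>x\<in>S. w x) \<le> 0" by (intro sum_nonpos) auto
    then show False using pw by (simp add: A.prob_weight_def)
  qed
  have le: "w x \<le> s" for x using A.iter_weight_Suc_le[OF A, of i x] by (simp add: w_def s_def)
  have fl: "s \<le> K * (\<Sum>x\<in>A.qsupp S. (A.qconv S w x)\<^sup>2)"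
    using flat by (simp add: s_def S_def w_def A.iter_energy_def)
  define B where "B = {x \<in> S. s / (8 * K) \<le> w x}"
  have K1: "1 \<le> K" using K by simp
  have en: "1 \<le> 2 * K * s ^ 3 * real (card (A.lcoll B))" and Bs: "real (card B) * s \<le> 8 * K"
    using A.level_set_energy[OF pw le s K1 fl] by (auto simp: B_def)
  have B: "finite B" "B \<subseteq> carrier (Aff R)" using S by (auto simp: B_def)
  have "B \<noteq> {}"
  proof
    assume "B = {}"
    then have "A.lcoll B = {}" by (simp add: A.lcoll_def)
    then show False using en by simp
  qed
  define b where "b = real (card B)"
  have b: "0 < b" using B(1) \<open>B \<noteq> {}\<close> by (simp add: b_def card_gt_0_iff)
  define c where "c = real (card (A.lcoll B))"
  have cb: "c \<le> b ^ 3" using A.card_lcoll_le[OF B(2,1)] by (simp add: c_def b_def flip: of_nat_power)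
  \<comment> \<open>1024 K^4 = (8 K)^3 * 2 K combines the two bounds of
    \<open>level_set_energy\<close>.\<close>
  define L where "L = 1024 * K ^ 4"
  have "1 \<le> K ^ 4" using K1 by (rule one_le_power)
  then have L: "1 \<le> L" by (simp add: L_def)
  have bs3: "(b * s) ^ 3 \<le> (8 * K) ^ 3" using Bs b s by (intro power_mono) (auto simp: b_def)
  have "s ^ 3 * b ^ 3 \<le> 512 * K ^ 3 * 1" using bs3 by (simp add: power_mult_distrib mult.commute)
  also have "\<dots> \<le> 512 * K ^ 3 * (2 * K * s ^ 3 * c)"
    using en K by (intro mult_left_mono) (auto simp: c_def)
  also have "\<dots> = s ^ 3 * (L * c)" by (simp add: L_def eval_nat_numeral)
  finally have energy: "b ^ 3 \<le> L * c" using s by simp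
  obtain q where q: "escapes R q" "b \<le> L * q"
  proof (cases "\<forall>q. escapes R q")
    case True
    have "b \<le> L * b" using L b by simp
    then show thesis using True that by blast
  next
    case False
    then obtain q where q: "escapes R q" "1 \<le> 2 * K * q * s" using esc by (auto simp: s_def)
    have q0: "0 < q"
    proof (rule ccontr)
      assume "\<not> 0 < q"
      then have "2 * K * s * q \<le> 0" using K s by (intro mult_nonneg_nonpos) auto
      then show False using q(2) by (simp add: mult_ac)
    qed
    have "b * s \<le> 8 * K * 1" using Bs by (simp add: b_def)
    also have "\<dots> \<le> 8 * K * (2 * K * q * s)" using q(2) K by (intro mult_left_mono) auto
    also have "\<dots> = (16 * K\<^sup>2 * q) * s" by (simp add: power2_eq_square)
    finally have "b \<le> 16 * K\<^sup>2 * q" using s by simp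
    also have "\<dots> \<le> L * q"
    proof (rule mult_right_mono)
      have "1 * K\<^sup>2 \<le> K\<^sup>2 * K\<^sup>2" using K1 by (intro mult_right_mono) auto
      then have "K\<^sup>2 \<le> K ^ 4" by (simp flip: power_add)
      then show "16 * K\<^sup>2 \<le> L" using \<open>1 \<le> K ^ 4\<close> by (simp add: L_def)
    qed (use q0 in simp)
    finally show thesis using q(1) that by blast
  qed
  obtain g H where gH: "g \<in> carrier (Aff R)" "abelian_subgroup (Aff R) H"
    "b \<le> (2 ^ 24 * L ^ 10) ^ 231 * real (card (B \<inter> (g <#\<^bsub>Aff R\<^esub> H)))"
    using abelian_coset_of_large_energy[OF B(2,1) \<open>B \<noteq> {}\<close> L _ _ q(1)] energy q(2)
      A.card_lcoll_eq_card_rcoll[OF B(2)] by (auto simp: b_def c_def)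
  have Hc: "H \<subseteq> carrier (Aff R)" using gH(2) by (auto simp: abelian_subgroup_def subgroup_def)
  define d where "d = real (card (B \<inter> (g <#\<^bsub>Aff R\<^esub> H)))"
  \<comment> \<open>37884 = 231 * (24 + 10 * 14), where L <= K^14 because 1024 <= K^10.\<close>
  have LK: "(2 ^ 24 * L ^ 10) ^ 231 \<le> K ^ 37884"
  proof -
    have "(1024 :: real) = 2 ^ 10" by simp
    also have "\<dots> \<le> K ^ 10" using K by (intro power_mono) auto
    finally have "L \<le> K ^ 10 * K ^ 4" unfolding L_def using K by (intro mult_right_mono) auto
    then have "L \<le> K ^ 14" by (simp flip: power_add)
    then have L14: "L ^ 10 \<le> (K ^ 14) ^ 10" using L by (intro power_mono) auto
    have K24: "(2 :: real) ^ 24 \<le> K ^ 24" using K by (intro power_mono) auto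
    have "2 ^ 24 * L ^ 10 \<le> K ^ 24 * (K ^ 14) ^ 10"
      by (rule mult_mono[OF K24 L14]) (use K L in auto)
    also have "\<dots> = K ^ 164" by (simp flip: power_add power_mult)
    finally have "(2 ^ 24 * L ^ 10) ^ 231 \<le> (K ^ 164) ^ 231" using L by (intro power_mono) auto
    also have "\<dots> = K ^ 37884" by (simp flip: power_mult)
    finally show ?thesis .
  qed
  have d0: "0 \<le> d" by (simp add: d_def)
  have "b \<le> K ^ 37884 * d"
    using gH(3) mult_right_mono[OF LK d0] by (simp only: d_def) 
  then have bd: "b * s \<le> K ^ 37884 * (d * s)"
    using mult_right_mono[of b "K ^ 37884 * d" s] s by (simp only: mult.assoc)
  \<comment> \<open>The energy of \<open>B\<close> is trivially at most b^3, so the lower bound on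
    it also bounds b s from below: \<open>B\<close> is not too small.\<close>
  have "1 \<le> 2 * K * (b * s)"
  proof (rule ccontr)
    assume "\<not> ?thesis"
    then have lt: "b * s < 1 / (2 * K)" using K by (simp add: field_simps)
    have "1 / (2 * K) \<le> 1" using K by simp
    then have bs1: "b * s \<le> 1" using lt by linarith
    have "1 \<le> 2 * K * (s ^ 3 * c)" using en by (simp add: c_def mult.assoc)
    also have "\<dots> \<le> 2 * K * (b * s) ^ 3"
      using cb s K by (simp add: power_mult_distrib mult.commute)
    also have "\<dots> \<le> 2 * K * (b * s)"
    proof (rule mult_left_mono)
      have "(b * s) ^ 3 \<le> (b * s) ^ 1" using b s bs1 by (intro power_decreasing) auto
      then show "(b * s) ^ 3 \<le> b * s" by simp
    qed (use K in simp)
    finally show False using \<open>\<not> 1 \<le> 2 * K * (b * s)\<close> by simp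
  qed
  also have "2 * K * (b * s) \<le> 2 * K * (K ^ 37884 * (d * s))"
    using bd K by (intro mult_left_mono) auto
  finally have one: "1 \<le> 2 * K * (K ^ 37884 * (d * s))" .
  define \<kappa> where "\<kappa> = s / (8 * K) * d"
  have \<kappa>S: "\<kappa> \<le> (\<Sum>x\<in>S \<inter> (g <#\<^bsub>Aff R\<^esub> H). w x)"
  proof -
    have "\<kappa> = (\<Sum>x\<in>B \<inter> (g <#\<^bsub>Aff R\<^esub> H). s / (8 * K))" by (simp add: \<kappa>_def d_def)
    also have "\<dots> \<le> (\<Sum>x\<in>B \<inter> (g <#\<^bsub>Aff R\<^esub> H). w x)" by (intro sum_mono) (auto simp: B_def)
    also have "\<dots> \<le> (\<Sum>x\<in>S \<inter> (g <#\<^bsub>Aff R\<^esub> H). w x)" using S by (intro sum_mono2) (auto simp: B_def)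
    finally show ?thesis .
  qed
  \<comment> \<open>16 K^2 collects 2 K from \<open>one\<close> and 8 K from the level defining
    \<open>B\<close>. With the factor 2 lost at the end, the exponent rises from 37884 to
    37891.\<close>
  have K6: "16 * K\<^sup>2 \<le> K ^ 6"
  proof -
    have "(16 :: real) = 2 ^ 4" by simp
    also have "\<dots> \<le> K ^ 4" using K by (intro power_mono) auto
    finally have "16 * K\<^sup>2 \<le> K ^ 4 * K\<^sup>2" by (intro mult_right_mono) auto
    then show ?thesis by (simp flip: power_add)
  qed
  have one': "1 \<le> K ^ 37890 * \<kappa>"
  proof -
    have \<kappa>0: "0 \<le> \<kappa>" using s K d0 by (simp add: \<kappa>_def)
    have "d * s = 8 * K * \<kappa>" using K by (simp add: \<kappa>_def)
    then have "1 \<le> (16 * K\<^sup>2) * (K ^ 37884 * \<kappa>)" using one by (simp add: power2_eq_square mult_ac)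
    also have "\<dots> \<le> K ^ 6 * (K ^ 37884 * \<kappa>)"
      using K6 K \<kappa>0 by (intro mult_right_mono) auto
    also have "\<dots> = K ^ (6 + 37884) * \<kappa>" by (simp only: power_add mult.assoc)
    finally show ?thesis by simp
  qed
  have \<kappa>pos: "0 < \<kappa>"
  proof (rule ccontr)
    assume "\<not> 0 < \<kappa>"
    then have "K ^ 37890 * \<kappa> \<le> 0" using K by (intro mult_nonneg_nonpos) auto
    then show False using one' by linarith
  qed
  \<comment> \<open>Halving \<kappa> makes the contradiction with the mass at least \<kappa> on the
    coset strict.\<close>
  have "\<exists>g\<in>carrier (Aff R). \<kappa> / 2 * real (card A) < real (card (A \<inter> (g <#\<^bsub>Aff R\<^esub> H)))"
  proof (rule ccontr)
    assume "\<not> ?thesis"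
    then have "real (card (A \<inter> (g <#\<^bsub>Aff R\<^esub> H))) \<le> \<kappa> / 2 * real (card A)" if "g \<in> carrier (Aff R)" for g
      using that by (auto simp: not_less)
    from A.iter_weight_coset_le[OF A Hc this gH(1), of "Suc i"]
    have "(\<Sum>x\<in>S \<inter> (g <#\<^bsub>Aff R\<^esub> H). w x) \<le> \<kappa> / 2" unfolding S_def w_def .
    then show False using \<kappa>S \<kappa>pos by linarith
  qed
  then obtain h where h: "h \<in> carrier (Aff R)"
    "\<kappa> / 2 * real (card A) < real (card (A \<inter> (h <#\<^bsub>Aff R\<^esub> H)))" by blast
  have "real (card A) \<le> (K ^ 37890 * \<kappa>) * real (card A)"
    using mult_right_mono[OF one', of "real (card A)"] by simp
  also have "\<dots> = 2 * K ^ 37890 * (\<kappa> / 2 * real (card A))" by simp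
  also have "\<dots> \<le> 2 * K ^ 37890 * real (card (A \<inter> (h <#\<^bsub>Aff R\<^esub> H)))"
    using h(2) K by (intro mult_left_mono) auto
  also have "\<dots> \<le> K * K ^ 37890 * real (card (A \<inter> (h <#\<^bsub>Aff R\<^esub> H)))"
    using K by (intro mult_right_mono) auto
  also have "K * K ^ 37890 = K ^ Suc 37890" by (simp only: power_Suc)
  also have "Suc 37890 = 37891" by simp
  finally show ?thesis using h(1) gH(2) by blast
qed

end

section \<open>Escape along multiples in prime fields and in the complex field\<close>

text \<open>Two distinct pairs collide for at most one \<open>x\<close>, so over all
  \<open>x\<close> there are at most N p + N^2 collisions. A point with at most N + N^2 / p of them
  has, by Cauchy-Schwarz, an image of size at least p N / (p + N).\<close>

lemma (in field) exists_large_image: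
  assumes fin: "finite (carrier R)" and U: "U \<subseteq> carrier R" and T: "T \<subseteq> carrier R"
  shows "\<exists>x\<in>carrier R. min (real (card U) * real (card T)) (real (card (carrier R)))
    \<le> 2 * real (card ((\<lambda>(u, t). u \<oplus> t \<otimes> x) ` (U \<times> T)))"
proof (cases "U \<times> T = {}")
  case True
  then have "real (card U) * real (card T) = 0" by auto
  then show ?thesis by (intro bexI[of _ \<zero>]) auto
next
  case False
  define P where "P = U \<times> T"
  define f where "f x = (\<lambda>(u, t). u \<oplus> t \<otimes> x)" for x
  have fP: "finite P" using fin U T finite_subset unfolding P_def by blast
  define N where "N = real (card P)"
  define p where "p = real (card (carrier R))"
  have N: "0 < N" using fP False by (simp add: N_def P_def card_gt_0_iff)
  have p: "0 < p" using fin by (auto simp: p_def card_gt_0_iff)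
  have NUT: "N = real (card U) * real (card T)" by (simp add: N_def P_def card_cartesian_product)
  define Q where "Q = {(a, b). a \<in> P \<and> b \<in> P}"
  have QP: "Q = P \<times> P" by (auto simp: Q_def)
  define E where "E x = {(a, b). a \<in> P \<and> b \<in> P \<and> f x a = f x b}" for x
  have solutions: "real (card {x \<in> carrier R. f x a = f x b}) \<le> (if a = b then p else 0) + 1" if ab: "a \<in> P" "b \<in> P" for a b
  proof (cases "a = b")
    case True
    then show ?thesis by (simp add: p_def)
  next
    case False
    obtain u t where a: "a = (u, t)" by (cases a)
    obtain u' t' where b: "b = (u', t')" by (cases b)
    have car: "u \<in> carrier R" "t \<in> carrier R" "u' \<in> carrier R" "t' \<in> carrier R"
      using ab a b U T by (auto simp: P_def)
    have key: "(t \<ominus> t') \<otimes> x = u' \<ominus> u" if x: "x \<in> carrier R" "f x a = f x b" for x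
    proof -
      have eq: "u \<oplus> t \<otimes> x = u' \<oplus> t' \<otimes> x" using x(2) by (simp add: f_def a b)
      have "(t \<ominus> t') \<otimes> x = (u \<oplus> t \<otimes> x) \<ominus> u \<ominus> t' \<otimes> x" using car x(1) by algebra
      also have "\<dots> = u' \<ominus> u" unfolding eq using car x(1) by algebra
      finally show ?thesis .
    qed
    have "x = y" if x: "x \<in> carrier R" "f x a = f x b" and y: "y \<in> carrier R" "f y a = f y b" for x y
    proof (cases "t = t'")
      case True
      then have "u = u'" using x car by (simp add: f_def a b)
      then show ?thesis using True False a b by simp
    next
      case ne: False
      have "t \<ominus> t' \<noteq> \<zero>" using ne car by (metis r_right_minus_eq)
      moreover have "(t \<ominus> t') \<otimes> x = (t \<ominus> t') \<otimes> y" using key[OF x] key[OF y] by simp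
      ultimately show ?thesis using x y car m_lcancel by simp
    qed
    then have "card {x \<in> carrier R. f x a = f x b} \<le> 1"
      using fin by (auto simp: card_le_Suc0_iff_eq)
    then show ?thesis using False by simp
  qed
  have "(\<Sum>x\<in>carrier R. real (card (E x))) = (\<Sum>x\<in>carrier R. \<Sum>q\<in>Q. if f x (fst q) = f x (snd q) then 1 else 0)"
  proof (intro sum.cong refl)
    fix x
    have "E x = {q \<in> Q. f x (fst q) = f x (snd q)}" by (auto simp: E_def Q_def)
    then show "real (card (E x)) = (\<Sum>q\<in>Q. if f x (fst q) = f x (snd q) then 1 else 0)"
      using fP by (simp add: sum.If_cases Int_def QP)
  qed
  also have "\<dots> = (\<Sum>q\<in>Q. real (card {x \<in> carrier R. f x (fst q) = f x (snd q)}))"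
    using fin by (subst sum.swap) (simp add: sum.If_cases Int_def)
  also have "\<dots> \<le> (\<Sum>q\<in>Q. (if fst q = snd q then p else 0) + 1)"
    by (intro sum_mono solutions) (auto simp: Q_def)
  also have "\<dots> = (\<Sum>a\<in>P. \<Sum>b\<in>P. if a = b then p else 0) + real (card Q)"
    by (simp add: sum.distrib QP sum.cartesian_product case_prod_unfold)
  also have "\<dots> = N * p + N\<^sup>2"
    using fP by (simp add: N_def QP card_cartesian_product power2_eq_square)
  finally have tot: "(\<Sum>x\<in>carrier R. real (card (E x))) \<le> N * p + N\<^sup>2" .
  have "\<exists>x\<in>carrier R. p * real (card (E x)) \<le> N * p + N\<^sup>2"
  proof (rule ccontr)
    assume no: "\<not> ?thesis"
    have "p * (N * p + N\<^sup>2) = (\<Sum>x\<in>carrier R. N * p + N\<^sup>2)" by (simp add: p_def)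
    also have "\<dots> < (\<Sum>x\<in>carrier R. p * real (card (E x)))"
      using no fin by (intro sum_strict_mono) (auto simp: not_le)
    also have "\<dots> \<le> p * (N * p + N\<^sup>2)"
      unfolding sum_distrib_left[symmetric] using tot p by (intro mult_left_mono) auto
    finally show False by simp
  qed
  then obtain x where x: "x \<in> carrier R" "p * real (card (E x)) \<le> N * p + N\<^sup>2" by blast
  define I where "I = real (card (f x ` P))"
  have "N\<^sup>2 \<le> I * real (card (E x))"
    using card_square_le_collisions[OF fP, of "f x"] by (simp add: N_def I_def E_def)
  then have "p * N\<^sup>2 \<le> p * (I * real (card (E x)))" using p by (intro mult_left_mono) auto
  also have "\<dots> = I * (p * real (card (E x)))" by simp
  also have "\<dots> \<le> I * (N * p + N\<^sup>2)" using x(2) by (intro mult_left_mono) (auto simp: I_def)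
  finally have "N * (p * N) \<le> N * (I * (p + N))" by (simp add: power2_eq_square algebra_simps)
  then have pN: "p * N \<le> I * (p + N)" using N by simp
  have I0: "0 \<le> I" by (simp add: I_def)
  have "min N p \<le> 2 * I"
  proof (cases "N \<le> p")
    case True
    have "p * N \<le> I * (2 * p)"
      using pN mult_left_mono[of "p + N" "2 * p" I] True I0 by linarith
    then have "p * N \<le> p * (2 * I)" by (simp add: mult_ac)
    then have "N \<le> 2 * I" using p by (simp only: mult_le_cancel_left_pos)
    then show ?thesis by simp
  next
    case False
    have "p * N \<le> I * (2 * N)"
      using pN mult_left_mono[of "p + N" "2 * N" I] False I0 by linarith
    then have "N * p \<le> N * (2 * I)" by (simp add: mult_ac)
    then have "p \<le> 2 * I" using N by (simp only: mult_le_cancel_left_pos)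
    then show ?thesis by simp
  qed
  then show ?thesis using x(1) by (intro bexI[of _ x]) (simp_all add: NUT p_def I_def P_def f_def)
qed

lemma residue_ring_add_pow:
  assumes "1 < m"
  shows "[(n::nat)] \<cdot>\<^bsub>residue_ring m\<^esub> v = (int n * v) mod m"
proof -
  interpret residues m "residue_ring m" using assms by unfold_locales
  show ?thesis
  proof (induction n)
    case 0
    then show ?case by (simp add: add_pow_def nat_pow_def res_zero_eq)
  next
    case (Suc n)
    have "[Suc n] \<cdot>\<^bsub>residue_ring m\<^esub> v = ([n] \<cdot>\<^bsub>residue_ring m\<^esub> v) \<oplus>\<^bsub>residue_ring m\<^esub> v"
      by (simp add: add_pow_def nat_pow_def)
    then show ?case unfolding Suc.IH res_add_eq by (simp add: algebra_simps mod_simps)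
  qed
qed

lemma escapes_residue_ring:
  assumes p: "Factorial_Ring.prime p"
  shows "escapes (residue_ring (int p)) (real p)"
proof -
  interpret residues_prime p "residue_ring (int p)" using p by unfold_locales
  have p1: "1 < int p" using p prime_gt_1_nat by auto
  have fin: "finite (carrier (residue_ring (int p)))" and card: "card (carrier (residue_ring (int p))) = p"
    using p1 by (auto simp: res_carrier_eq)
  show ?thesis
    unfolding escapes_def
  proof (intro allI impI, elim conjE)
    fix U T v
    assume UT: "finite U" "finite T" "U \<subseteq> carrier (residue_ring (int p))" "T \<subseteq> carrier (residue_ring (int p))"
      and v: "v \<in> carrier (residue_ring (int p))" "v \<noteq> \<zero>\<^bsub>residue_ring (int p)\<^esub>"
    obtain x where x: "x \<in> carrier (residue_ring (int p))" "min (real (card U) * real (card T)) (real p)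
      \<le> 2 * real (card ((\<lambda>(u, t). u \<oplus>\<^bsub>residue_ring (int p)\<^esub> t \<otimes>\<^bsub>residue_ring (int p)\<^esub> x) ` (U \<times> T)))"
      using field.exists_large_image[OF is_field fin UT(3,4)] unfolding card by blast
    \<comment> \<open>The good point \<open>x\<close> becomes a multiple of \<open>v\<close>, with
      \<open>w * x\<close> as the number of summands.\<close>
    define w where "w = inv\<^bsub>residue_ring (int p)\<^esub> v"
    have vU: "v \<in> Units (residue_ring (int p))" using v field_Units by auto
    have w: "w \<in> carrier (residue_ring (int p))" "v \<otimes>\<^bsub>residue_ring (int p)\<^esub> w = \<one>\<^bsub>residue_ring (int p)\<^esub>"
      using vU by (auto simp: w_def)
    have vw: "(v * w) mod int p = 1" using w(2) by (simp add: res_mult_eq res_one_eq)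
    have nn: "0 \<le> w * x" using w(1) x(1) by (auto simp: res_carrier_eq)
    have "[nat (w * x)] \<cdot>\<^bsub>residue_ring (int p)\<^esub> v = (w * x * v) mod int p"
      using nn by (simp add: residue_ring_add_pow[OF p1])
    also have "\<dots> = ((v * w) mod int p * x) mod int p" by (simp add: mod_simps mult_ac)
    also have "\<dots> = x" using x(1) by (simp add: vw res_carrier_eq)
    finally show "\<exists>n::nat. min (real (card U) * real (card T)) (real p) \<le> 2 * real (card ((\<lambda>(u, t). u \<oplus>\<^bsub>residue_ring (int p)\<^esub>
        t \<otimes>\<^bsub>residue_ring (int p)\<^esub> ([n] \<cdot>\<^bsub>residue_ring (int p)\<^esub> v)) ` (U \<times> T)))"
      using x(2) by (intro exI[of _ "nat (w * x)"]) simp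
  qed
qed

lemma complex_field_simps:
  "carrier complex_field = UNIV" "x \<oplus>\<^bsub>complex_field\<^esub> y = x + y" "x \<otimes>\<^bsub>complex_field\<^esub> y = x * y"
  "\<zero>\<^bsub>complex_field\<^esub> = 0"
  by (simp_all add: ring_of_type_algebra_def)

lemma complex_field_add_pow: "[(n::nat)] \<cdot>\<^bsub>complex_field\<^esub> v = of_nat n * v"
proof (induction n)
  case 0
  then show ?case by (simp add: add_pow_def nat_pow_def complex_field_simps)
next
  case (Suc n)
  have "[Suc n] \<cdot>\<^bsub>complex_field\<^esub> v = ([n] \<cdot>\<^bsub>complex_field\<^esub> v) \<oplus>\<^bsub>complex_field\<^esub> v"
    by (simp add: add_pow_def nat_pow_def)
  then show ?case unfolding Suc.IH complex_field_simps by (simp add: algebra_simps)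
qed

lemma escapes_complex_field: "escapes complex_field q"
  unfolding escapes_def complex_field_simps complex_field_add_pow
proof (intro allI impI, elim conjE)
  fix U T :: "complex set" and v :: complex
  assume fin: "finite U" "finite T" and v: "v \<noteq> 0"
  define Z where "Z = (\<lambda>((u, u'), (t, t')). (u' - u) / (t - t')) ` ((U \<times> U) \<times> (T \<times> T))"
  have "finite Z" using fin by (simp add: Z_def)
  \<comment> \<open>Characteristic zero enters here: some multiple of \<open>v\<close> avoids all
    collision points \<open>Z\<close>, so the map is injective there whatever \<open>q\<close>
    is.\<close>
  moreover have "infinite (range (\<lambda>n::nat. of_nat n * v))"
    using v by (intro range_inj_infinite) (auto simp: inj_def)
  ultimately obtain n :: nat where n: "of_nat n * v \<notin> Z"
    by (meson finite_subset image_subsetI)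
  have "inj_on (\<lambda>(u, t). u + t * (of_nat n * v)) (U \<times> T)"
  proof (rule inj_onI, clarify)
    fix u t u' t' assume *: "u \<in> U" "t \<in> T" "u' \<in> U" "t' \<in> T" "u + t * (of_nat n * v) = u' + t' * (of_nat n * v)"
    then have eq: "(t - t') * (of_nat n * v) = u' - u" by (simp add: algebra_simps)
    have "t = t'"
    proof (rule ccontr)
      assume "t \<noteq> t'"
      then have "of_nat n * v = (u' - u) / (t - t')" using eq by (simp add: eq_divide_eq mult.commute)
      then have "of_nat n * v \<in> Z" unfolding Z_def using * by (intro rev_image_eqI[of "((u, u'), (t, t'))"]) auto
      with n show False by simp
    qed
    then show "u = u' \<and> t = t'" using eq by simp
  qed
  then have "real (card ((\<lambda>(u, t). u + t * (of_nat n * v)) ` (U \<times> T))) = real (card U) * real (card T)"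
    by (simp add: card_image card_cartesian_product)
  moreover have "min (real (card U) * real (card T)) q \<le> 2 * (real (card U) * real (card T))"
    by (intro min.coboundedI1) simp
  ultimately show "\<exists>n::nat. min (real (card U) * real (card T)) q
      \<le> 2 * real (card ((\<lambda>(u, t). u + t * (of_nat n * v)) ` (U \<times> T)))"
    by (intro exI[of _ n]) simp
qed

section \<open>The bound for both base fields\<close>

text \<open>A single argument for both fields, which differ only in the alternative of
  \<open>esc\<close>. In the finite case the sparsity of \<open>Y\<close> is what gives access to
  the second energy bound.\<close>

lemma (in affine_group) rich_affine_maps_concentrate:
  fixes \<alpha> :: real
  assumes Y: "Y \<subseteq> carrier R" "finite Y" "Y \<noteq> {}" and \<alpha>: "0 < \<alpha>" "\<alpha> < 1"
    and A: "A \<subseteq> Sym R \<alpha> Y" "finite A" and J: "1 \<le> J"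
    and large: "1 / real (card Y) \<le> (\<alpha> / 2) ^ (2 ^ J)"
    and esc: "(\<forall>q. escapes R q) \<or> (finite (carrier R) \<and> escapes R (real (card (carrier R))) \<and>
      real (card Y) \<le> (\<alpha> / 2) ^ (2 ^ J) * real (card (carrier R)))"
  shows "\<exists>g H. g \<in> carrier (Aff R) \<and> subgroup H (Aff R) \<and> comm_group ((Aff R)\<lparr>carrier := H\<rparr>) \<and>
    1 * (\<alpha> / 2) powr (227346 * 2 ^ J) * real (card Y) powr (- 227346 / real J) * real (card A)
      \<le> real (card (A \<inter> (g <#\<^bsub>Aff R\<^esub> H)))"
proof (cases "A = {}")
  case True
  then show ?thesis using abelian_transl_group
    by (intro exI[of _ "\<one>\<^bsub>Aff R\<^esub>"] exI[of _ transl_group]) (auto simp: abelian_subgroup_def)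
next
  case ne: False
  define n where "n = real (card Y)"
  define \<gamma> where "\<gamma> = (\<alpha> / 2) ^ (2 ^ J)"
  define \<beta> where "\<beta> = \<alpha> ^ (2 ^ J)"
  define C :: real where "C = 227346"
  define E where "E = A.iter_energy A"
  have Ac: "A \<subseteq> carrier (Aff R)" using A(1) by (auto simp: Sym_def)
  have two_J: "(2::nat) ^ 1 \<le> 2 ^ J" using J by (intro power_increasing) auto
  have \<gamma>0: "0 < \<gamma>" using \<alpha> by (simp add: \<gamma>_def)
  have \<gamma>1: "\<gamma> \<le> 1" unfolding \<gamma>_def using \<alpha> by (intro power_le_one) auto
  have "1 \<le> card Y" using Y(2,3) by (simp add: Suc_le_eq card_gt_0_iff)
  then have n1: "1 \<le> n" by (simp add: n_def)
  have n\<gamma>: "1 \<le> \<gamma> * n" using large n1 by (simp add: \<gamma>_def n_def field_simps)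
  \<comment> \<open>The hypotheses are stated with \<alpha> / 2 and the overlaps with \<alpha>. The
    ratio 2^(2^J) >= 4 between \<beta> and \<gamma> turns them into 4 <= \<beta> n and, over a
    finite field, 2 n <= \<beta> p.\<close>
  have "(2::real) ^ 2 \<le> 2 ^ (2 ^ J)" using two_J by (intro power_increasing) auto
  then have "4 * \<gamma> \<le> 2 ^ (2 ^ J) * \<gamma>" using \<gamma>0 by (intro mult_right_mono) auto
  also have "\<dots> = \<beta>" by (simp add: \<beta>_def \<gamma>_def power_divide)
  finally have \<beta>\<gamma>: "4 * \<gamma> \<le> \<beta>" .
  have \<beta>0: "0 < \<beta>" using \<alpha> by (simp add: \<beta>_def)
  have \<beta>1: "\<beta> \<le> 1" unfolding \<beta>_def using \<alpha> by (intro power_le_one) auto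
  have \<beta>n: "4 \<le> \<beta> * n" using mult_right_mono[OF \<beta>\<gamma>, of n] n1 n\<gamma> by linarith
  have rich: "\<alpha> * real (card Y) \<le> real (card (Y \<inter> g ` Y))" if "g \<in> A" for g
    using that A(1) by (auto simp: Sym_def)
  have ov: "\<beta> * real (card Y) \<le> (\<Sum>g\<in>A.iter_supp A j. A.iter_weight A j g * real (card (Y \<inter> g ` Y)))"
    if "j \<le> J" for j
  proof -
    have "\<beta> \<le> \<alpha> ^ (2 ^ j)" unfolding \<beta>_def using that \<alpha> by (intro power_decreasing power_increasing) auto
    then have "\<beta> * real (card Y) \<le> \<alpha> ^ (2 ^ j) * real (card Y)" by (rule mult_right_mono) simp
    also have "\<dots> \<le> (\<Sum>g\<in>A.iter_supp A j. A.iter_weight A j g * real (card (Y \<inter> g ` Y)))"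
      by (rule A.iter_overlap_ge[where E = "carrier R" and act = "\<lambda>g. g"])
         (use A(2) ne Ac Y \<alpha> rich Aff_inj_on Aff_closed mult_apply in auto)
    finally show ?thesis .
  qed
  have En: "9 / 16 * \<beta>\<^sup>2 \<le> n\<^sup>2 * E j" if "j \<le> J" for j
    using sum_square_ge_of_overlap[OF A.prob_weight_iter[OF A(2) ne Ac] Y(2,1) ov[OF that]] \<beta>n
    by (simp add: E_def A.iter_energy_def n_def)
  have pC: "(\<alpha> / 2) powr (C * 2 ^ J) = \<gamma> powr C"
  proof -
    have "\<gamma> = (\<alpha> / 2) powr (2 ^ J)" unfolding \<gamma>_def using \<alpha> powr_realpow[of "\<alpha> / 2" "2 ^ J"] by simp
    then show ?thesis by (simp add: powr_powr mult.commute)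
  qed
  have cA: "1 \<le> real (card A)" using A(2) ne by (simp add: Suc_le_eq card_gt_0_iff)
  have "\<exists>g H. g \<in> carrier (Aff R) \<and> abelian_subgroup (Aff R) H \<and>
    \<gamma> powr C * n powr (- C / real J) * real (card A) \<le> real (card (A \<inter> (g <#\<^bsub>Aff R\<^esub> H)))"
  proof (cases "J = 1")
    case True
    \<comment> \<open>The energy bound at step 0 amounts to \<gamma>^2 |A| <= n^2. The claimed lower
      bound is then at most 1, and a coset through any element of \<open>A\<close> suffices.\<close>
    have E0: "E 0 * real (card A) = 1" using A.iter_energy_0[OF A(2) ne] cA by (simp add: E_def)
    have "9 / 16 * \<beta>\<^sup>2 * real (card A) \<le> n\<^sup>2 * E 0 * real (card A)"
      using En[of 0] by (intro mult_right_mono) auto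
    also have "\<dots> = n\<^sup>2" using E0 by (simp only: mult.assoc mult_1_right)
    finally have "9 / 16 * \<beta>\<^sup>2 * real (card A) \<le> n\<^sup>2" .
    moreover have "(4 * \<gamma>)\<^sup>2 \<le> \<beta>\<^sup>2" using \<beta>\<gamma> \<gamma>0 by (intro power_mono) auto
    then have "9 / 16 * (4 * \<gamma>)\<^sup>2 * real (card A) \<le> 9 / 16 * \<beta>\<^sup>2 * real (card A)"
      by (intro mult_right_mono) auto
    moreover have "9 / 16 * (4 * \<gamma>)\<^sup>2 * real (card A) = 9 * (\<gamma>\<^sup>2 * real (card A))"
      by (simp add: power2_eq_square)
    moreover have "0 \<le> \<gamma>\<^sup>2 * real (card A)" by simp
    ultimately have \<gamma>A: "\<gamma>\<^sup>2 * real (card A) \<le> n\<^sup>2" by linarith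
    have "\<gamma> powr C * n powr (- C / real J) * real (card A) \<le> \<gamma> powr 2 * n powr (- 2) * real (card A)"
    proof (intro mult_right_mono mult_mono)
      show "\<gamma> powr C \<le> \<gamma> powr 2" using \<gamma>0 \<gamma>1 by (intro powr_mono') (auto simp: C_def)
      show "n powr (- C / real J) \<le> n powr (- 2)" using n1 True by (intro powr_mono) (auto simp: C_def)
    qed auto
    also have "\<dots> = (\<gamma>\<^sup>2 * real (card A)) * n powr (- 2)"
      using \<gamma>0 powr_realpow[of \<gamma> 2] by simp
    also have "\<dots> \<le> n\<^sup>2 * n powr (- 2)" using \<gamma>A by (intro mult_right_mono) auto
    also have "\<dots> = 1" using n1 powr_realpow[of n 2] by (simp add: powr_minus)
    finally have le1: "\<gamma> powr C * n powr (- C / real J) * real (card A) \<le> 1" .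
    obtain a where a: "a \<in> A" using ne by blast
    have ac: "a \<in> carrier (Aff R)" using a Ac by auto
    have "\<one>\<^bsub>Aff R\<^esub> \<in> transl_group" by (simp add: transl_group_def)
    then have "a \<in> A \<inter> (a <#\<^bsub>Aff R\<^esub> transl_group)" using a ac by (force simp: l_coset_def)
    then have "1 \<le> card (A \<inter> (a <#\<^bsub>Aff R\<^esub> transl_group))"
      using A(2) by (metis One_nat_def Suc_leI card_gt_0_iff empty_iff finite_Int)
    then show ?thesis using le1 ac abelian_transl_group
      by (intro exI[of _ a] exI[of _ transl_group]) auto
  next
    case False
    \<comment> \<open>The flat step is sought among the even indices up to 2 m. As \<open>J\<close>
      is at least 2, it is at most 3 m, so exponents in 1 / m become exponents in 1 / J.\<close>
    define m where "m = J div 2"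
    have m: "1 \<le> m" "2 * m \<le> J" "J \<le> 3 * m" using False J by (auto simp: m_def)
    \<comment> \<open>K^m is at least n^2 * 2 / \<beta>^2, while the energy at step 2 m is at least
      (9/16) \<beta>^2 / n^2. The product is at least 9/8, as \<open>exists_flat_step\<close>
      requires.\<close>
    define K where "K = n powr (2 / real m) * (2 / \<beta>\<^sup>2)"
    have "\<beta>\<^sup>2 \<le> 1" using \<beta>0 \<beta>1 by (intro power_le_one) auto
    then have b2: "2 \<le> 2 / \<beta>\<^sup>2" using \<beta>0 by (simp add: le_divide_eq)
    have np: "1 \<le> n powr (2 / real m)" using n1 by (intro ge_one_powr_ge_zero) auto
    have Kb: "2 / \<beta>\<^sup>2 \<le> K" unfolding K_def using mult_right_mono[OF np, of "2 / \<beta>\<^sup>2"] b2 by simp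
    have K2: "2 \<le> K" using Kb b2 by linarith
    have "\<exists>i<m. E (2 * i) \<le> K * E (2 * Suc i)"
    proof (rule exists_flat_step[where a = "\<lambda>i. E (2 * i)"])
      show "E (2 * 0) \<le> 1" using A.iter_energy_0[OF A(2) ne] cA by (simp add: E_def)
      have "K ^ m = n powr 2 * (2 / \<beta>\<^sup>2) ^ m"
        unfolding K_def power_mult_distrib using m n1 by (simp add: powr_power)
      also have "n powr 2 = n\<^sup>2" using n1 powr_realpow[of n 2] by simp
      finally have Km: "K ^ m = n\<^sup>2 * (2 / \<beta>\<^sup>2) ^ m" .
      have "(2 / \<beta>\<^sup>2) ^ 1 \<le> (2 / \<beta>\<^sup>2) ^ m" using b2 m by (intro power_increasing) auto
      then have b2m: "2 / \<beta>\<^sup>2 \<le> (2 / \<beta>\<^sup>2) ^ m" by simp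
      have "1 < 2 / \<beta>\<^sup>2 * (9 / 16 * \<beta>\<^sup>2)" using \<beta>0 by simp
      also have "\<dots> \<le> (2 / \<beta>\<^sup>2) ^ m * (n\<^sup>2 * E (2 * m))"
        by (rule mult_mono[OF b2m En[OF m(2)]]) auto
      also have "\<dots> = K ^ m * E (2 * m)" by (simp add: Km)
      finally show "1 < K ^ m * E (2 * m)" .
    qed (use K2 in simp)
    then obtain i where i: "i < m" "E (2 * i) \<le> K * E (2 * Suc i)" by blast
    have iJ: "2 * i \<le> J" using i m by simp
    have "\<exists>g H. g \<in> carrier (Aff R) \<and> abelian_subgroup (Aff R) H \<and>
      real (card A) \<le> K ^ 37891 * real (card (A \<inter> (g <#\<^bsub>Aff R\<^esub> H)))"
    proof (rule concentration[OF A(2) ne Ac K2, of "2 * i"])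
      show "A.iter_energy A (2 * i) \<le> K * A.iter_energy A (Suc (Suc (2 * i)))"
        using i(2) by (simp add: E_def)
      show "(\<forall>q. escapes R q) \<or> (\<exists>q. escapes R q \<and> 1 \<le> 2 * K * q * A.iter_energy A (2 * i))"
        using esc
      proof (elim disjE conjE)
        assume fin: "finite (carrier R)" and es: "escapes R (real (card (carrier R)))"
          and small: "real (card Y) \<le> (\<alpha> / 2) ^ (2 ^ J) * real (card (carrier R))"
        define p where "p = real (card (carrier R))"
        have np: "n \<le> \<gamma> * p" using small by (simp add: n_def \<gamma>_def p_def)
        have "0 \<le> p" by (simp add: p_def)
        from mult_right_mono[OF \<beta>\<gamma> this] have "2 * n \<le> \<beta> * p" using np n1 by linarith
        then have "\<beta>\<^sup>2 \<le> 4 * p * E (2 * i)"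
          using sum_square_ge_of_overlap_finite[OF A.prob_weight_iter[OF A(2) ne Ac] fin Y(1,3) ov[OF iJ]]
          by (simp add: E_def A.iter_energy_def n_def p_def)
        then have "2 / \<beta>\<^sup>2 * \<beta>\<^sup>2 \<le> 2 / \<beta>\<^sup>2 * (4 * p * E (2 * i))" using b2 by (intro mult_left_mono) auto
        then have "2 \<le> 2 / \<beta>\<^sup>2 * (4 * p * E (2 * i))" using \<beta>0 by simp
        also have "\<dots> \<le> K * (4 * p * E (2 * i))"
          using Kb by (intro mult_right_mono) (auto simp: p_def E_def A.iter_energy_def intro!: mult_nonneg_nonneg sum_nonneg)
        finally have "1 \<le> 2 * K * p * E (2 * i)" by simp
        then show ?thesis using es unfolding p_def E_def by blast
      qed blast
    qed
    then obtain g H where gH: "g \<in> carrier (Aff R)" "abelian_subgroup (Aff R) H"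
      "real (card A) \<le> K ^ 37891 * real (card (A \<inter> (g <#\<^bsub>Aff R\<^esub> H)))" by blast
    define a where "a = real (card (A \<inter> (g <#\<^bsub>Aff R\<^esub> H)))"
    \<comment> \<open>The exponent 6 / J comes from 2 / m <= 6 / J, and \<gamma> is given the same
      6, so that C = 6 * 37891 = 227346 cancels both.\<close>
    have KD: "K \<le> n powr (6 / real J) * \<gamma> powr (- 6)"
      unfolding K_def
    proof (rule mult_mono)
      have "2 / real m \<le> 6 / real J" using m J by (simp add: field_simps)
      then show "n powr (2 / real m) \<le> n powr (6 / real J)" using n1 by (intro powr_mono) auto
      have "(4 * \<gamma>)\<^sup>2 \<le> \<beta>\<^sup>2" using \<beta>\<gamma> \<gamma>0 by (intro power_mono) auto
      moreover have "(4 * \<gamma>)\<^sup>2 = 16 * \<gamma>\<^sup>2" by (simp add: power_mult_distrib)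
      moreover have "0 \<le> \<gamma>\<^sup>2" by simp
      ultimately have "2 * \<gamma>\<^sup>2 \<le> \<beta>\<^sup>2" by linarith
      then have "2 / \<beta>\<^sup>2 \<le> 1 / \<gamma>\<^sup>2" using \<gamma>0 \<beta>0 by (simp add: field_simps)
      also have "\<dots> = \<gamma> powr (- 2)" using \<gamma>0 powr_realpow[of \<gamma> 2] by (simp add: powr_minus divide_inverse)
      also have "\<dots> \<le> \<gamma> powr (- 6)" using \<gamma>0 \<gamma>1 by (intro powr_mono') auto
      finally show "2 / \<beta>\<^sup>2 \<le> \<gamma> powr (- 6)" .
    qed (use b2 in auto)
    have "\<gamma> powr C * n powr (- C / real J) * real (card A) \<le> \<gamma> powr C * n powr (- C / real J) * (K ^ 37891 * a)"
      using gH(3) by (intro mult_left_mono) (auto simp: a_def)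
    also have "\<dots> \<le> \<gamma> powr C * n powr (- C / real J) * ((n powr (6 / real J) * \<gamma> powr (- 6)) ^ 37891 * a)"
      using KD K2 by (intro mult_left_mono mult_right_mono power_mono) (auto simp: a_def)
    also have "(n powr (6 / real J) * \<gamma> powr (- 6)) ^ 37891 = n powr (C / real J) * \<gamma> powr (- C)"
      using n1 \<gamma>0 unfolding power_mult_distrib by (simp add: powr_power C_def)
    also have "\<gamma> powr C * n powr (- C / real J) * (n powr (C / real J) * \<gamma> powr (- C) * a)
        = (\<gamma> powr C * \<gamma> powr (- C)) * (n powr (- C / real J) * n powr (C / real J)) * a" by simp
    also have "\<dots> = a" using n1 \<gamma>0 by (simp add: powr_add[symmetric])
    finally show ?thesis using gH(1,2) unfolding a_def by blast
  qed
  then show ?thesis unfolding pC[unfolded C_def] abelian_subgroup_def n_def C_def mult_1 by blast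
qed

theorem theorem3p3:
  shows "\<exists>C c :: real. C > 0 \<and> c > 0 \<and>
    (\<forall>(Y :: complex set) (\<alpha> :: real) A (J :: nat).
        Y \<subseteq> carrier complex_field \<longrightarrow> finite Y \<longrightarrow> Y \<noteq> {} \<longrightarrow> 0 < \<alpha> \<longrightarrow> \<alpha> < 1 \<longrightarrow>
        A \<subseteq> Sym complex_field \<alpha> Y \<longrightarrow> finite A \<longrightarrow>
        J \<ge> 1 \<longrightarrow> (\<alpha> / 2) ^ (2 ^ J) \<ge> 1 / real (card Y) \<longrightarrow>
        (\<exists>g H. g \<in> carrier (Aff complex_field) \<and>
           subgroup H (Aff complex_field) \<and> comm_group ((Aff complex_field)\<lparr>carrier := H\<rparr>) \<and>
           real (card (A \<inter> (g <#\<^bsub>Aff complex_field\<^esub> H)))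
             \<ge> c * (\<alpha> / 2) powr (C * 2 ^ J) * real (card Y) powr (- C / real J) * real (card A)))
    \<and>
    (\<forall>(p :: nat) (Y :: int set) (\<alpha> :: real) A (J :: nat).
        Factorial_Ring.prime p \<longrightarrow>
        Y \<subseteq> carrier (residue_ring (int p)) \<longrightarrow> finite Y \<longrightarrow> Y \<noteq> {} \<longrightarrow> 0 < \<alpha> \<longrightarrow> \<alpha> < 1 \<longrightarrow>
        A \<subseteq> Sym (residue_ring (int p)) \<alpha> Y \<longrightarrow> finite A \<longrightarrow>
        J \<ge> 1 \<longrightarrow> (\<alpha> / 2) ^ (2 ^ J) \<ge> 1 / real (card Y) \<longrightarrow>
        real (card Y) \<le> (\<alpha> / 2) ^ (2 ^ J) * real p \<longrightarrow>
        (\<exists>g H. g \<in> carrier (Aff (residue_ring (int p))) \<and>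
           subgroup H (Aff (residue_ring (int p))) \<and>
           comm_group ((Aff (residue_ring (int p)))\<lparr>carrier := H\<rparr>) \<and>
           real (card (A \<inter> (g <#\<^bsub>Aff (residue_ring (int p))\<^esub> H)))
             \<ge> c * (\<alpha> / 2) powr (C * 2 ^ J) * real (card Y) powr (- C / real J) * real (card A)))"
proof (rule exI[of _ 227346], rule exI[of _ 1], intro conjI allI impI)
  fix Y :: "complex set" and \<alpha> :: real and A and J :: nat
  assume *: "Y \<subseteq> carrier complex_field" "finite Y" "Y \<noteq> {}" "0 < \<alpha>" "\<alpha> < 1"
    "A \<subseteq> Sym complex_field \<alpha> Y" "finite A" "1 \<le> J" "1 / real (card Y) \<le> (\<alpha> / 2) ^ (2 ^ J)"
  interpret affine_group complex_field
    unfolding affine_group_def by (rule field_from_type_algebra)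
  show "\<exists>g H. g \<in> carrier (Aff complex_field) \<and>
      subgroup H (Aff complex_field) \<and> comm_group ((Aff complex_field)\<lparr>carrier := H\<rparr>) \<and>
      1 * (\<alpha> / 2) powr (227346 * 2 ^ J) * real (card Y) powr (- 227346 / real J) * real (card A)
        \<le> real (card (A \<inter> (g <#\<^bsub>Aff complex_field\<^esub> H)))"
    by (rule rich_affine_maps_concentrate[OF * disjI1]) (simp add: escapes_complex_field)
next
  fix p :: nat and Y :: "int set" and \<alpha> :: real and A and J :: nat
  assume p: "Factorial_Ring.prime p" and *: "Y \<subseteq> carrier (residue_ring (int p))" "finite Y" "Y \<noteq> {}" "0 < \<alpha>" "\<alpha> < 1"
    "A \<subseteq> Sym (residue_ring (int p)) \<alpha> Y" "finite A" "1 \<le> J" "1 / real (card Y) \<le> (\<alpha> / 2) ^ (2 ^ J)"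
    and small: "real (card Y) \<le> (\<alpha> / 2) ^ (2 ^ J) * real p"
  interpret P: residues_prime p "residue_ring (int p)" using p by unfold_locales
  interpret affine_group "residue_ring (int p)"
    unfolding affine_group_def by (rule P.is_field)
  have "finite (carrier (residue_ring (int p)))" "card (carrier (residue_ring (int p))) = p"
    by (auto simp: P.res_carrier_eq)
  then show "\<exists>g H. g \<in> carrier (Aff (residue_ring (int p))) \<and>
      subgroup H (Aff (residue_ring (int p))) \<and> comm_group ((Aff (residue_ring (int p)))\<lparr>carrier := H\<rparr>) \<and>
      1 * (\<alpha> / 2) powr (227346 * 2 ^ J) * real (card Y) powr (- 227346 / real J) * real (card A)
        \<le> real (card (A \<inter> (g <#\<^bsub>Aff (residue_ring (int p))\<^esub> H)))"
    using small escapes_residue_ring[OF p]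
    by (intro rich_affine_maps_concentrate[OF * disjI2]) simp
qed auto

end
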